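(* Let $k_1\geq k_2\geq t+2$, $n\geq 2L(k_1,t)$, and let $\mathcal{F}_1\subseteq\Pi(n,k_1)$ and $\mathcal{F}_2\subseteq\Pi(n,k_2)$ be non-trivial cross $t$-intersecting families. (i) If $k_2\geq 2t+2$ and $n\geq t+1+(k_1-t)(k_2-t)$, then $$|\mathcal{F}_1||\mathcal{F}_2|\leq\Big(\sum_{j=1}^{k_2-t}(-1)^{j-1}\binom{k_2-t}{j}S(n-t-j,k_1-t-j)\Big)\big(S(n-t,k_2-t)+t\big),$$ with equality if and only if $(\mathcal{F}_1,\mathcal{F}_2)\cong(\mathcal{A}(k_1,k_2,t),\mathcal{B}(k_2,t))$, or $k_1=k_2$ and $(\mathcal{F}_1,\mathcal{F}_2)\cong(\mathcal{B}(k_1,t),\mathcal{A}(k_2,k_1,t))$. (ii) If $k_2\leq 2t+1$ and $(k_1,k_2)\notin\{(2t+1,2t+1),(4,3)\}$, then $$|\mathcal{F}_1||\mathcal{F}_2|\leq S(n-t-1,k_1-t-1)\big((t+1)S(n-t,k_2-t)-t\,S(n-t-1,k_2-t-1)\big),$$ with equality if and only if $(\mathcal{F}_1,\mathcal{F}_2)\cong(\mathcal{C}(k_1,t),\mathcal{D}(k_2,t))$, or $k_1=k_2$ and $(\mathcal{F}_1,\mathcal{F}_2)\cong(\mathcal{D}(k_1,t),\mathcal{C}(k_2,t))$.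
   Context: All letters denote positive integers. $[n]=\{1,\ldots,n\}$. A partition is a set of pairwise disjoint nonempty sets (blocks); $|P|$ is its number of blocks and $\cup P$ the union of its blocks. $\Pi(n,k)$ is the set of all partitions of $[n]$ into $k$ blocks; $S(n,k)=|\Pi(n,k)|$, with $S(n,a)=0$ for $a\leq0$. For partitions $F,G$, $F\cap G$ is the set of common blocks. $[[s]]:=\{\{1\},\ldots,\{s\}\}$. $L(k,t):=(t+1)+(k-t+1)\log_2((t+1)(k-t+1))$. $\mathcal{F}\subseteq\Pi(n,k)$, $\mathcal{G}\subseteq\Pi(n,\ell)$ are cross $t$-intersecting if $|F\cap G|\geq t$ for all $F\in\mathcal{F},G\in\mathcal{G}$; non-trivial if fewer than $t$ blocks belong to every member of $\mathcal{F}\cup\mathcal{G}$. Pairs of families are isomorphic ($\cong$) if they agree up to a permutation of $[n]$. For an $\ell$-partition $M$ and $X\subseteq M$ with $|X|=t$, $\overline{\cup M}=[n]\setminus\cup M$, $\mathcal{A}(k,X,M)=\{F\in\Pi(n,k):X\subseteq F,\ F\cap(M\setminus X)\neq\emptyset\}$, $\mathcal{B}(\ell,X,M)=\{F\in\Pi(n,\ell):X\subseteq F\}\cup\{(M\setminus\{B\})\cup\{B\cup\overline{\cup M}\}:B\in X\}$; $\mathcal{A}(k,\ell,t)=\mathcal{A}(k,[[t]],[[\ell]])$, $\mathcal{B}(\ell,t)=\mathcal{B}(\ell,[[t]],[[\ell]])$. For a $(t+1)$-partition $T$: $\mathcal{C}(k,T)=\{F\in\Pi(n,k):T\subseteq F\}$,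 $\mathcal{D}(\ell,T)=\{F\in\Pi(n,\ell):|T\cap F|\geq t\}$; $\mathcal{C}(k,t)=\mathcal{C}(k,[[t+1]])$, $\mathcal{D}(\ell,t)=\mathcal{D}(\ell,[[t+1]])$. *)

theory Defs
  imports Complex_Main "HOL-Library.Disjoint_Sets"
begin

definition Pi_part :: "nat \<Rightarrow> nat \<Rightarrow> nat set set set" where
  "Pi_part n k = {P. partition_on {1..n} P \<and> card P = k}"

definition Stir :: "nat \<Rightarrow> nat \<Rightarrow> nat" where
  "Stir n k = card (Pi_part n k)"

definition L :: "nat \<Rightarrow> nat \<Rightarrow> real" where
  "L k t = real (t + 1) + real (k - t + 1) * log 2 (real ((t + 1) * (k - t + 1)))"

definition sing :: "nat \<Rightarrow> nat set set" where
  "sing s = (\<lambda>i. {i}) ` {1..s}"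

definition cross_t_int :: "nat \<Rightarrow> nat set set set \<Rightarrow> nat set set set \<Rightarrow> bool" where
  "cross_t_int t F G \<longleftrightarrow> (\<forall>A\<in>F. \<forall>B\<in>G. card (A \<inter> B) \<ge> t)"

definition non_trivial :: "nat \<Rightarrow> nat set set set \<Rightarrow> nat set set set \<Rightarrow> bool" where
  "non_trivial t F G \<longleftrightarrow> card {B. \<forall>P\<in>F \<union> G. B \<in> P} < t"

definition perm_fam :: "(nat \<Rightarrow> nat) \<Rightarrow> nat set set set \<Rightarrow> nat set set set" where
  "perm_fam \<sigma> F = (\<lambda>P. (\<lambda>B. \<sigma> ` B) ` P) ` F"

definition iso_pair :: "nat \<Rightarrow> nat set set set \<times> nat set set set
    \<Rightarrow> nat set set set \<times> nat set set set \<Rightarrow> bool" where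
  "iso_pair n FG HK \<longleftrightarrow> (\<exists>\<sigma>. bij_betw \<sigma> {1..n} {1..n} \<and>
      perm_fam \<sigma> (fst FG) = fst HK \<and> perm_fam \<sigma> (snd FG) = snd HK)"

definition AX :: "nat \<Rightarrow> nat \<Rightarrow> nat set set \<Rightarrow> nat set set \<Rightarrow> nat set set set" where
  "AX n k X M = {F \<in> Pi_part n k. X \<subseteq> F \<and> F \<inter> (M - X) \<noteq> {}}"

definition BX :: "nat \<Rightarrow> nat \<Rightarrow> nat set set \<Rightarrow> nat set set \<Rightarrow> nat set set set" where
  "BX n l X M = {F \<in> Pi_part n l. X \<subseteq> F} \<union>
     {(M - {B}) \<union> {B \<union> ({1..n} - \<Union>M)} | B. B \<in> X}"

definition Afam :: "nat \<Rightarrow> nat \<Rightarrow> nat \<Rightarrow> nat \<Rightarrow> nat set set set" where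
  "Afam n k l t = AX n k (sing t) (sing l)"

definition Bfam :: "nat \<Rightarrow> nat \<Rightarrow> nat \<Rightarrow> nat set set set" where
  "Bfam n l t = BX n l (sing t) (sing l)"

definition CT :: "nat \<Rightarrow> nat \<Rightarrow> nat set set \<Rightarrow> nat set set set" where
  "CT n k T = {F \<in> Pi_part n k. T \<subseteq> F}"

definition DT :: "nat \<Rightarrow> nat \<Rightarrow> nat \<Rightarrow> nat set set \<Rightarrow> nat set set set" where
  "DT n t l T = {F \<in> Pi_part n l. card (T \<inter> F) \<ge> t}"

definition Cfam :: "nat \<Rightarrow> nat \<Rightarrow> nat \<Rightarrow> nat set set set" where
  "Cfam n k t = CT n k (sing (t + 1))"

definition Dfam :: "nat \<Rightarrow> nat \<Rightarrow> nat \<Rightarrow> nat set set set" where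
  "Dfam n l t = DT n t l (sing (t + 1))"

end

theory Submission
  imports Defs "HOL-Combinatorics.Stirling" "HOL-Combinatorics.Permutations"
begin

text \<open>
  Write \<open>S(n - s, k - s)\<close> for the number of k-partitions of [n] containing s given singletons.
  The bound on n makes consecutive values of this number differ by a factor of at least
  \<open>Q\<^sup>2\<close>, where \<open>Q = (t + 1)(k\<^sub>1 - t + 1)\<close>. If neither family has t common blocks, then
  choosing t blocks from a minimal cover of one family and branching along members of the other
  makes both families small. Otherwise the members of one family share a t-set X of blocks, and
  some member G of the other family misses X. A block B is heavy if more than
  \<open>(l - t + 1) S(n - t - 2, k - t - 2)\<close> members of the first family contain X and B; branching once
  more shows that every G not containing X contains all heavy blocks. If there are \<open>l - t\<close> heavy blocks, the
  pair is contained in a pair of type (A, B); if the first family has a further common block, it is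
  contained in a pair of type (C, D); in all other cases the product loses a constant factor.
  Finally, the two types, and the two roles of \<open>k\<^sub>1\<close> and \<open>k\<^sub>2\<close>, are compared through
  \<open>j^m - j (j - 1)^m \<le> j! S(m, j) \<le> j^m\<close>.
\<close>

section \<open>Counting set partitions\<close>

text \<open>\<open>Q\<close> is the price of one level of branching: a cover with m blocks contains
  at most \<open>(t + 1) ^ (m - t)\<close> sets of t blocks, and every added block is picked from at
  most \<open>a + 1\<close> candidates. A level pays back \<open>Q^2\<close>, so a surplus
  \<open>Q\<close> per level absorbs constants. Take
  \<open>\<theta> l = \<phi> K (t + 1) * \<phi> l t\<close> as unit. In its range of l, each
  extremal product is at least \<open>max (l - t) (t + 1) - 1/4\<close> units. A non-extremal pair
  only has to stay more than a quarter of a unit below that maximum, and rough estimates achieve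
  this. Two places resist. For \<open>K = t + 2\<close> there is no level beyond
  \<open>t + 1\<close>, because t + 1 blocks already determine the partition; a direct count with
  weights \<open>2 ^ (card B - 1)\<close> takes over. For \<open>l = 2 * t + 1\<close> the types (A,
  B) and (C, D) have the same leading term and the next terms decide; both excluded pairs of block
  numbers belong to this range.\<close>

definition parts :: "'a set \<Rightarrow> nat \<Rightarrow> 'a set set set" where
  "parts A k = {P. partition_on A P \<and> card P = k}"

text \<open>An arbitrary carrier is what the induction on points in \<open>card_parts\<close> and
  the deletion of blocks in \<open>card_parts_containing\<close> require.\<close>

lemma Pi_part_parts: "Pi_part n k = parts {1..n} k"
  by (simp add: Pi_part_def parts_def)

lemma finite_parts [simp]: "finite A \<Longrightarrow> finite (parts A k)"
  unfolding parts_def using finitely_many_partition_on[of A]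
  by (auto intro: finite_subset)

lemma parts_finite: "finite A \<Longrightarrow> P \<in> parts A k \<Longrightarrow> finite P"
  unfolding parts_def using finite_elements by auto

lemma parts_0: "parts A 0 = (if A = {} then {{}} else {})" if "finite A"
  using that by (auto simp: parts_def partition_on_def dest: finite_UnionD)

lemma disjnt_Union_Diff: "disjoint P \<Longrightarrow> B \<in> P \<Longrightarrow> disjnt B (\<Union>(P - {B}))"
  by (auto simp: disjnt_iff dest: disjointD)

text \<open>The point x forms a block of its own or joins a block of a partition of A; deleting x
  from its block inverts both constructions.\<close>

lemma parts_insert:
  assumes A: "finite A" and x: "x \<notin> A"
  shows "parts (insert x A) (Suc k) =
    insert {x} ` parts A k \<union>
    (\<lambda>(P, B). insert (insert x B) (P - {B})) ` (SIGMA P:parts A (Suc k). P)" (is "?L = ?R1 \<union> ?R2")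
proof
  show "?L \<subseteq> ?R1 \<union> ?R2"
  proof
    fix P assume "P \<in> ?L"
    then have P: "partition_on (insert x A) P" and c: "card P = Suc k" by (auto simp: parts_def)
    have fP: "finite P" using c by (metis card.infinite nat.distinct(1))
    obtain B where B: "B \<in> P" "x \<in> B" using P by (auto simp: partition_on_def)
    have dis: "disjnt B (\<Union>(P - {B}))"
      using P B by (intro disjnt_Union_Diff) (auto simp: partition_on_def)
    have ins: "P = insert B (P - {B})" using B by auto
    have Q: "partition_on (insert x A - B) (P - {B})" "B \<subseteq> insert x A"
      using partition_on_insert[OF dis, of "insert x A"] P ins by auto
    have cQ: "card (P - {B}) = k" using c B fP by simp
    show "P \<in> ?R1 \<union> ?R2"
    proof (cases "B = {x}")
      case True
      then have "P - {B} \<in> parts A k" using Q cQ x by (auto simp: parts_def)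
      then have "P \<in> ?R1" using ins True by blast
      then show ?thesis by simp
    next
      case False
      define C where "C = B - {x}"
      have C: "C \<noteq> {}" "C \<subseteq> A" "insert x C = B" using False B Q by (auto simp: C_def)
      have "disjnt C (\<Union>(P - {B}))" using dis C unfolding disjnt_def by blast
      moreover have "A - C = insert x A - B" using C x by auto
      ultimately have "partition_on A (insert C (P - {B}))"
        using partition_on_insert[of C "P - {B}" A] Q C by simp
      moreover have Cn: "C \<notin> P - {B}"
        using \<open>disjnt C (\<Union>(P - {B}))\<close> C unfolding disjnt_def by blast
      ultimately have "insert C (P - {B}) \<in> parts A (Suc k)"
        using cQ fP by (simp add: parts_def)
      moreover have "P = insert (insert x C) (insert C (P - {B}) - {C})"
        using C Cn ins by auto
      ultimately have "P \<in> ?R2"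
        by (intro image_eqI[where x = "(insert C (P - {B}), C)"]) auto
      then show ?thesis by simp
    qed
  qed
  show "?R1 \<union> ?R2 \<subseteq> ?L"
  proof
    fix P assume "P \<in> ?R1 \<union> ?R2"
    then consider Q where "Q \<in> parts A k" "P = insert {x} Q"
      | Q B where "Q \<in> parts A (Suc k)" "B \<in> Q" "P = insert (insert x B) (Q - {B})" by auto
    then show "P \<in> ?L"
    proof cases
      case 1
      then have Q: "partition_on A Q" "card Q = k" "finite Q"
        using parts_finite[OF A, of Q k] by (auto simp: parts_def)
      then have d: "disjnt {x} (\<Union>Q)" "{x} \<notin> Q"
        using x by (auto simp: partition_on_def disjnt_def)
      have "insert x A - {x} = A" using x by auto
      then have "partition_on (insert x A) P"
        using Q partition_on_insert[OF d(1), of "insert x A"] 1 by auto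
      then show ?thesis using 1 Q d by (simp add: parts_def)
    next
      case 2
      then have Q: "partition_on A Q" "card Q = Suc k" "finite Q"
        using parts_finite[OF A, of Q "Suc k"] by (auto simp: parts_def)
      have dB: "disjnt B (\<Union>(Q - {B}))"
        using Q 2 by (intro disjnt_Union_Diff) (auto simp: partition_on_def)
      have "Q = insert B (Q - {B})" using 2 by auto
      then have QB: "partition_on (A - B) (Q - {B})" "B \<subseteq> A"
        using partition_on_insert[OF dB, of A] Q by auto
      have xQ: "x \<notin> \<Union>Q" using Q x by (auto simp: partition_on_def)
      have d: "disjnt (insert x B) (\<Union>(Q - {B}))"
        using dB xQ by (auto simp: disjnt_def)
      have nin: "insert x B \<notin> Q - {B}" using xQ by auto
      have "insert x A - insert x B = A - B" using x by auto
      then have "partition_on (insert x A) P"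
        using partition_on_insert[OF d, of "insert x A"] QB 2 by auto
      moreover have "card P = Suc k" using 2 Q nin by simp
      ultimately show ?thesis by (simp add: parts_def)
    qed
  qed
qed

text \<open>The two images in \<open>parts_insert\<close> are disjoint and both maps are injective,
  so the cardinalities obey the recurrence of \<open>Stirling\<close>.\<close>

lemma card_parts: "finite A \<Longrightarrow> card (parts A k) = Stirling (card A) k"
proof (induction A arbitrary: k rule: finite_induct)
  case empty
  show ?case
  proof (cases k)
    case 0
    then have "parts ({} :: 'a set) k = {{}}" by (auto simp: parts_def partition_on_empty)
    then show ?thesis using 0 by simp
  next
    case (Suc j)
    then have "parts ({} :: 'a set) k = {}" by (auto simp: parts_def partition_on_empty)
    then show ?thesis using Suc by simp
  qed
next
  case (insert x A)
  show ?case
  proof (cases k)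
    case 0
    then show ?thesis using insert by (simp add: parts_0)
  next
    case (Suc k')
    let ?f = "\<lambda>(P, B). insert (insert x B) (P - {B})"
    let ?S = "SIGMA P:parts A (Suc k'). P"
    have xU: "x \<notin> \<Union>P" if "P \<in> parts A j" for P j
      using that insert by (auto simp: parts_def partition_on_def)
    have inj1: "inj_on (insert {x}) (parts A k')"
      using xU by (intro inj_onI) (metis UnionI insert_ident singletonI)
    have inj2: "inj_on ?f ?S"
    proof (rule inj_onI, clarsimp)
      fix P B P' B'
      assume h: "P \<in> parts A (Suc k')" "B \<in> P" "P' \<in> parts A (Suc k')" "B' \<in> P'"
        and e: "insert (insert x B) (P - {B}) = insert (insert x B') (P' - {B'})"
      have n: "x \<notin> \<Union>P" "x \<notin> \<Union>P'" using xU h by blast+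
      have "insert x B \<in> insert (insert x B') (P' - {B'})" using e by blast
      then have "insert x B = insert x B'" using n by auto
      then have BB: "B = B'" using n h by (metis UnionI insert_ident)
      then have "P - {B} = P' - {B}" using e n by (metis DiffD1 UnionI insertI1 insert_ident)
      then show "P = P' \<and> B = B'" using BB h by blast
    qed
    have disj: "insert {x} ` parts A k' \<inter> ?f ` ?S = {}"
    proof -
      have False if "P \<in> parts A k'" "P' \<in> parts A (Suc k')" "B \<in> P'"
        "insert {x} P = insert (insert x B) (P' - {B})" for P P' B
      proof -
        have "{x} = insert x B" using that xU by (metis (no_types, lifting) DiffD1 UnionI insert_iff)
        moreover have "x \<notin> B" using that(2,3) xU by blast
        moreover have "B \<noteq> {}" using that by (auto simp: parts_def partition_on_def)
        ultimately show False by auto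
      qed
      then show ?thesis by (auto simp del: insert_iff)
    qed
    have "card (parts (insert x A) (Suc k')) = card (parts A k') + card ?S"
      unfolding parts_insert[OF insert(1,2)]
      using insert(1) parts_finite[OF insert(1)] disj
      by (subst card_Un_disjoint) (auto simp: card_image[OF inj1] card_image[OF inj2])
    also have "card ?S = Suc k' * card (parts A (Suc k'))"
    proof -
      have "card ?S = (\<Sum>P\<in>parts A (Suc k'). card P)"
        using parts_finite[OF insert(1)] finite_parts[OF insert(1)] by (intro card_SigmaI) blast+
      also have "\<dots> = (\<Sum>P\<in>parts A (Suc k'). Suc k')"
        by (rule sum.cong) (auto simp: parts_def)
      finally show ?thesis by simp
    qed
    finally show ?thesis using insert Suc by simp
  qed
qed

lemma Stir_eq: "Stir n k = Stirling n k"
  by (simp add: Stir_def Pi_part_parts card_parts)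

text \<open>Deleting W leaves an arbitrary partition of the points that W does not cover, so of W
  only \<open>card W\<close> and the size of \<open>\<Union>W\<close> matter.\<close>

lemma card_parts_containing:
  assumes "finite A" "disjoint W" "{} \<notin> W" "\<Union>W \<subseteq> A" "card W \<le> k"
  shows "card {P \<in> parts A k. W \<subseteq> P} = Stirling (card A - card (\<Union>W)) (k - card W)"
proof -
  have fW: "finite W" using assms by (meson finite_UnionD finite_subset)
  have "bij_betw (\<lambda>P. P \<union> W) (parts (A - \<Union>W) (k - card W)) {P \<in> parts A k. W \<subseteq> P}"
  proof (rule bij_betwI[where g = "\<lambda>P. P - W"])
    have nW: "P \<inter> W = {}" if "P \<in> parts (A - \<Union>W) (k - card W)" for P
    proof (rule ccontr)
      assume "P \<inter> W \<noteq> {}"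
      then obtain B where B: "B \<in> P" "B \<in> W" by blast
      then have "B \<noteq> {}" "B \<subseteq> \<Union>W" using assms(3) by auto
      moreover have "B \<subseteq> A - \<Union>W" using that B by (auto simp: parts_def partition_on_def)
      ultimately show False by blast
    qed
    show "(\<lambda>P. P \<union> W) \<in> parts (A - \<Union>W) (k - card W) \<rightarrow> {P \<in> parts A k. W \<subseteq> P}"
    proof
      fix P assume P: "P \<in> parts (A - \<Union>W) (k - card W)"
      have "finite P" using P parts_finite[of "A - \<Union>W"] assms by blast
      then have "card (P \<union> W) = k"
        using card_Un_disjoint[OF _ fW nW[OF P]] P assms by (simp add: parts_def)
      moreover have "partition_on A (P \<union> W)" unfolding partition_on_def
      proof (intro conjI)
        show "\<Union>(P \<union> W) = A" using P assms by (auto simp: parts_def partition_on_def)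
        show "{} \<notin> P \<union> W" using P assms by (auto simp: parts_def partition_on_def)
        have "disjoint P" "\<Union>P \<inter> \<Union>W = {}" using P by (auto simp: parts_def partition_on_def)
        then show "disjoint (P \<union> W)" using assms(2) by (intro disjoint_union)
      qed
      ultimately show "P \<union> W \<in> {P \<in> parts A k. W \<subseteq> P}" by (simp add: parts_def)
    qed
    show "(\<lambda>P. P - W) \<in> {P \<in> parts A k. W \<subseteq> P} \<rightarrow> parts (A - \<Union>W) (k - card W)"
    proof
      fix P assume P: "P \<in> {P \<in> parts A k. W \<subseteq> P}"
      have fin: "finite P" using P parts_finite[of A] assms by blast
      have "partition_on (A - \<Union>W) (P - W)" unfolding partition_on_def
      proof (intro conjI)
        have UP: "\<Union>P = A" and dP: "disjoint P" using P by (auto simp: parts_def partition_on_def)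
        have "x \<notin> \<Union>W" if "x \<in> B" "B \<in> P - W" for x B
        proof
          assume "x \<in> \<Union>W"
          then obtain C where "C \<in> W" "x \<in> C" by blast
          then show False using that P disjointD[OF dP, of B C] by auto
        qed
        then show "\<Union>(P - W) = A - \<Union>W" using UP by blast
        show "{} \<notin> P - W" using P by (auto simp: parts_def partition_on_def)
        show "disjoint (P - W)" using dP by (rule pairwise_subset) auto
      qed
      then show "P - W \<in> parts (A - \<Union>W) (k - card W)"
        using P fin fW by (simp add: parts_def card_Diff_subset)
    qed
    show "P \<union> W - W = P" if "P \<in> parts (A - \<Union>W) (k - card W)" for P
      using nW[OF that] by blast
    show "P - W \<union> W = P" if "P \<in> {P \<in> parts A k. W \<subseteq> P}" for P
      using that by blast
  qed
  then have "card {P \<in> parts A k. W \<subseteq> P} = card (parts (A - \<Union>W) (k - card W))"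
    by (rule bij_betw_same_card[symmetric])
  also have "\<dots> = Stirling (card (A - \<Union>W)) (k - card W)"
    using assms by (simp add: card_parts)
  also have "card (A - \<Union>W) = card A - card (\<Union>W)"
    using assms by (simp add: card_Diff_subset finite_subset)
  finally show ?thesis .
qed

lemma Stirling_Suc_ge: "k * Stirling n k \<le> Stirling (Suc n) k"
  by (cases k) auto

lemma Stirling_ge_1: "1 \<le> k \<Longrightarrow> k \<le> n \<Longrightarrow> 1 \<le> Stirling n k"
proof (induction n arbitrary: k)
  case (Suc n)
  show "1 \<le> Stirling (Suc n) k"
  proof (cases "k \<le> n")
    case True
    then have "1 \<le> Stirling n k" using Suc.IH[of k] Suc.prems by blast
    then have "1 \<le> k * Stirling n k" using Suc.prems(1) by (metis mult_le_mono nat_mult_1)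
    then show ?thesis using Stirling_Suc_ge le_trans by blast
  next
    case False
    then have "k = Suc n" using Suc.prems by simp
    then show ?thesis by simp
  qed
qed simp



lemma Stirling_mono: "1 \<le> k \<Longrightarrow> m \<le> n \<Longrightarrow> Stirling m k \<le> Stirling n k"
proof (induction n)
  case 0
  then show ?case by simp
next
  case (Suc i)
  show ?case
  proof (cases "m = Suc i")
    case False
  have "Stirling i k \<le> k * Stirling i k" using Suc.prems by (cases k) auto
  also have "\<dots> \<le> Stirling (Suc i) k" by (rule Stirling_Suc_ge)
  finally show ?thesis using Suc.IH Suc.prems False by linarith
  qed simp
qed

text \<open>One more point multiplies the count by at least k. This is the source of the factor 2
  that is lost whenever a prescribed block is not a singleton.\<close>

lemma Stirling_double: "2 \<le> k \<Longrightarrow> m < n \<Longrightarrow> 2 * Stirling m k \<le> Stirling n k"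
proof -
  assume k: "2 \<le> k" and "m < n"
  then have "Stirling (Suc m) k \<le> Stirling n k" by (intro Stirling_mono) auto
  moreover have "2 * Stirling m k \<le> Stirling (Suc m) k"
    using Stirling_Suc_ge[of k m] mult_le_mono1[OF k, of "Stirling m k"] by linarith
  ultimately show ?thesis by simp
qed

section \<open>Partitions with prescribed blocks\<close>

lemma card_Union_ge:
  assumes "disjoint W" "{} \<notin> W" "finite (\<Union>W)"
  shows "card W \<le> card (\<Union>W)"
proof -
  have f: "finite W" "\<And>B. B \<in> W \<Longrightarrow> finite B"
    using assms by (auto intro: finite_UnionD finite_subset)
  have "card (\<Union>W) = (\<Sum>B\<in>W. card B)" using assms f by (simp add: card_Union_disjoint)
  moreover have "(\<Sum>B\<in>W. 1) \<le> (\<Sum>B\<in>W. card B)"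
    using assms f by (intro sum_mono) (metis One_nat_def Suc_leI card_gt_0_iff)
  ultimately show ?thesis by simp
qed

lemma card_Union_gt:
  assumes "disjoint W" "{} \<notin> W" "finite (\<Union>W)" "B \<in> W" "card B \<noteq> 1"
  shows "card W < card (\<Union>W)"
proof -
  have f: "finite W" "\<And>B. B \<in> W \<Longrightarrow> finite B"
    using assms by (auto intro: finite_UnionD finite_subset)
  have "card (\<Union>W) = (\<Sum>B\<in>W. card B)" using assms f by (simp add: card_Union_disjoint)
  moreover have "(\<Sum>B\<in>W. 1) < (\<Sum>B\<in>W. card B)"
    using assms f by (intro sum_strict_mono_ex1)
      (auto simp: Suc_le_eq card_gt_0_iff, metis One_nat_def Suc_lessI card_gt_0_iff)
  ultimately show ?thesis by simp
qed

text \<open>Nonempty disjoint blocks cover at least \<open>card W\<close> points, and singletons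
  cover exactly that many. The strict \<open>card W < k\<close> keeps the second argument of
  \<open>Stirling\<close> positive: monotonicity breaks at 0, since \<open>Stirling 0 0 = 1\<close>
  but \<open>Stirling 1 0 = 0\<close>.\<close>

lemma card_containing_le:
  assumes "card W < k" "finite W"
  shows "card {P \<in> Pi_part n k. W \<subseteq> P} \<le> Stirling (n - card W) (k - card W)"
proof (cases "{P \<in> Pi_part n k. W \<subseteq> P} = {}")
  case False
  then obtain P where P: "partition_on {1..n} P" "W \<subseteq> P" by (auto simp: Pi_part_def)
  have W: "disjoint W" "{} \<notin> W" "\<Union>W \<subseteq> {1..n}"
    using P by (auto simp: partition_on_def intro: pairwise_subset)
  have "card W \<le> card (\<Union>W)" using W by (intro card_Union_ge) (auto intro: finite_subset)
  then show ?thesis unfolding Pi_part_parts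
    using card_parts_containing[OF _ W, of k] assms
    by (auto intro!: Stirling_mono)
next
  case True
  then show ?thesis by (simp only: True) simp
qed

text \<open>A block with several points makes W cover at least one point more than it has blocks,
  which halves the count as long as two further blocks remain to be chosen.\<close>

lemma card_containing_le_half:
  assumes "card W + 2 \<le> k" "finite W" "B \<in> W" "card B \<noteq> 1" "card W < n"
  shows "2 * card {P \<in> Pi_part n k. W \<subseteq> P} \<le> Stirling (n - card W) (k - card W)"
proof (cases "{P \<in> Pi_part n k. W \<subseteq> P} = {}")
  case False
  then obtain P where P: "partition_on {1..n} P" "W \<subseteq> P" by (auto simp: Pi_part_def)
  have W: "disjoint W" "{} \<notin> W" "\<Union>W \<subseteq> {1..n}"
    using P by (auto simp: partition_on_def intro: pairwise_subset)
  have "card W < card (\<Union>W)" using W assms by (intro card_Union_gt) (auto intro: finite_subset)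
  then show ?thesis unfolding Pi_part_parts
    using card_parts_containing[OF _ W, of k] assms
    by (auto intro!: Stirling_double)
next
  case True
  then show ?thesis by (simp only: True) simp
qed

section \<open>Stirling numbers of a large ground set\<close>

text \<open>Both sides count the maps from an m-set to a j-set, the left side sorted by the image.
  The proof is an induction on m through the Stirling recurrence.\<close>

lemma sum_binomial_fact_Stirling: "(\<Sum>i\<le>j. (j choose i) * (fact i * Stirling m i)) = j ^ m"
proof (induction m)
  case 0
  have "(\<Sum>i\<le>j. (j choose i) * (fact i * Stirling 0 i)) = (\<Sum>i\<in>{0}. (j choose i) * (fact i * Stirling 0 i))"
  proof (rule sum.mono_neutral_right)
    show "\<forall>i\<in>{..j} - {0}. (j choose i) * (fact i * Stirling 0 i) = 0"
    proof
      fix i assume "i \<in> {..j} - {0}"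
      then show "(j choose i) * (fact i * Stirling 0 i) = 0" by (cases i) auto
    qed
  qed auto
  then show ?case by simp
next
  case (Suc m)
  define u where "u i = (j choose i) * (fact i * Stirling m i)" for i
  \<comment> \<open>One summand of the recurrence contributes \<open>i * u i\<close>. The other one
    becomes \<open>(j - i) * u i\<close> after an index shift, by
    \<open>(i + 1) * (j choose (i + 1)) = (j - i) * (j choose i)\<close>. The two coefficients add
    up to j.\<close>
  have "(\<Sum>i\<le>j. (j choose i) * (fact i * Stirling (Suc m) i))
      = (\<Sum>i\<le>j. i * u i) + (\<Sum>i\<le>j. (j - i) * u i)"
  proof (cases j)
    case 0 then show ?thesis by (simp add: u_def)
  next
    case (Suc j')
    have "(\<Sum>i\<le>j. (j choose i) * (fact i * Stirling (Suc m) i))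
        = (\<Sum>i\<le>j'. (j choose Suc i) * (fact (Suc i) * Stirling (Suc m) (Suc i)))"
      unfolding Suc by (subst sum.atMost_Suc_shift) simp
    also have "\<dots> = (\<Sum>i\<le>j'. Suc i * u (Suc i) + (j - i) * u i)"
    proof (rule sum.cong[OF refl])
      fix i assume "i \<in> {..j'}"
      have "Suc i * (j choose Suc i) = (j - i) * (j choose i)"
        using Suc binomial_absorb_comp[of j i] Suc_times_binomial[of i j'] by simp
      then have "(j choose Suc i) * (fact (Suc i) * Stirling m i) = (j - i) * u i"
        unfolding u_def fact_Suc of_nat_id by (metis (no_types, lifting) mult.assoc mult.commute)
      then show "(j choose Suc i) * (fact (Suc i) * Stirling (Suc m) (Suc i)) = Suc i * u (Suc i) + (j - i) * u i"
        unfolding Stirling.simps add_mult_distrib2 by (simp add: u_def algebra_simps)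
    qed
    also have "\<dots> = (\<Sum>i\<le>j'. Suc i * u (Suc i)) + (\<Sum>i\<le>j'. (j - i) * u i)"
      by (rule sum.distrib)
    also have "(\<Sum>i\<le>j'. Suc i * u (Suc i)) = (\<Sum>i\<le>j. i * u i)"
      unfolding Suc by (subst sum.atMost_Suc_shift) simp
    also have "(\<Sum>i\<le>j'. (j - i) * u i) = (\<Sum>i\<le>j. (j - i) * u i)"
      unfolding Suc by simp
    finally show ?thesis .
  qed
  also have "\<dots> = (\<Sum>i\<le>j. j * u i)"
    unfolding sum.distrib[symmetric] by (rule sum.cong) (auto simp: add_mult_distrib[symmetric])
  also have "\<dots> = j * j ^ m" using Suc by (simp add: sum_distrib_left[symmetric] u_def)
  finally show ?case by simp
qed

lemma fact_Stirling_le: "fact j * Stirling m j \<le> j ^ m"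
proof -
  have "(j choose j) * (fact j * Stirling m j) \<le> (\<Sum>i\<le>j. (j choose i) * (fact i * Stirling m i))"
    by (rule member_le_sum) auto
  then show ?thesis by (simp add: sum_binomial_fact_Stirling)
qed

text \<open>A map that is not onto misses one of the j values, so there are at most
  \<open>j * (j - 1) ^ m\<close> such maps. In terms of the sum: \<open>(j choose i) \<le> (j - i) *
  (j choose i) = j * ((j - 1) choose i)\<close> for i < j.\<close>

lemma fact_Stirling_ge:
  assumes "1 \<le> j"
  shows "j ^ m \<le> fact j * Stirling m j + j * (j - 1) ^ m"
proof -
  obtain j' where j: "j = Suc j'" using assms by (cases j) auto
  have "j ^ m = (\<Sum>i\<le>j'. (j choose i) * (fact i * Stirling m i)) + fact j * Stirling m j"
    using sum_binomial_fact_Stirling[of j m] unfolding j by simp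
  also have "(\<Sum>i\<le>j'. (j choose i) * (fact i * Stirling m i))
      \<le> (\<Sum>i\<le>j'. j * ((j' choose i) * (fact i * Stirling m i)))"
  proof (rule sum_mono)
    fix i assume i: "i \<in> {..j'}"
    have "(j choose i) \<le> (j - i) * (j choose i)" using i j by simp
    also have "\<dots> = j * (j' choose i)" using binomial_absorb_comp[of j i] j by simp
    finally show "(j choose i) * (fact i * Stirling m i) \<le> j * ((j' choose i) * (fact i * Stirling m i))"
      by (metis mult.assoc mult_le_mono1)
  qed
  also have "\<dots> = j * j' ^ m" by (simp add: sum_distrib_left[symmetric] sum_binomial_fact_Stirling)
  finally show ?thesis using j by simp
qed

section \<open>Consequences of the lower bound on \<open>n\<close>\<close>

locale large_ground_set =
  fixes n t K :: nat
  assumes t1: "1 \<le> t" and K: "t + 2 \<le> K" and nL: "2 * L K t \<le> real n"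
begin

definition a where "a = K - t"
definition N where "N = n - t"
text \<open>The argument of the logarithm in \<open>L K t\<close>.\<close>

definition Q where "Q = (t + 1) * (a + 1)"
text \<open>The relative error of \<open>j^m\<close> as an approximation of \<open>j! S(m, j)\<close>.\<close>
definition \<epsilon> :: real where "\<epsilon> = a / Q\<^sup>2"

lemma a2: "2 \<le> a" and Kta: "K = t + a" using K by (auto simp: a_def)

lemma Q_ge: "2 * (a + 1) \<le> Q" "3 * (t + 1) \<le> Q" "6 \<le> Q"
proof -
  show 1: "2 * (a + 1) \<le> Q" unfolding Q_def using t1 by (intro mult_le_mono1) simp
  show "3 * (t + 1) \<le> Q" unfolding Q_def mult.commute[of "t+1"] using a2 by (intro mult_le_mono1) simp
  show "6 \<le> Q" using 1 a2 by simp
qed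

lemma n_real: "real (t + 1) + 2 * (real (a + 1) * log 2 (real Q)) \<le> real n - real t - 1"
  using nL K unfolding L_def Q_def a_def by (simp add: algebra_simps)

lemma n_ge: "2 * t + 2 + 4 * (a + 1) \<le> n"
proof -
  have "2 = log 2 (2 powr 2)" by (simp only: log_powr_cancel)
  also have "\<dots> \<le> log 2 (real Q)" using Q_ge(3) by (subst log_le_cancel_iff) auto
  finally have "2 * (real (a + 1) * 2) \<le> 2 * (real (a + 1) * log 2 (real Q))"
    by (intro mult_left_mono) auto
  then have "real (2 * t + 2 + 4 * (a + 1)) \<le> real n" using n_real by simp
  then show ?thesis by linarith
qed

lemma N_ge: "t + 3 + 4 * (a + 1) \<le> N + 1" "n = N + t"
  using n_ge by (auto simp: N_def)

text \<open>The hypothesis on n with the logarithm removed. Of the summand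
  \<open>2 * (t + 1)\<close> in \<open>2 * L K t\<close>, one half is absorbed by the passage from n
  to \<open>N - 1 = n - t - 1\<close>; the other half remains as a spare power of 2.\<close>

lemma two_pow: "2 ^ (t + 1) * Q ^ (2 * a + 2) \<le> 2 ^ (N - 1)"
proof -
  have Q: "0 < real Q" using Q_ge(3) by simp
  have "real (2 ^ (t + 1) * Q ^ (2 * a + 2)) = 2 powr real (t + 1) * real Q powr (2 * real (a + 1))"
  proof -
    have "2 * real (a + 1) = real (2 * a + 2)" by simp
    then have "real Q powr (2 * real (a + 1)) = real Q ^ (2 * a + 2)"
      using powr_realpow[OF Q] by metis
    moreover have "2 powr real (t + 1) = (2 :: real) ^ (t + 1)" by (rule powr_realpow) simp
    ultimately show ?thesis by (simp only: of_nat_mult of_nat_power of_nat_numeral)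
  qed
  also have "real Q powr (2 * real (a + 1)) = (2 powr log 2 (real Q)) powr (2 * real (a + 1))"
    using Q by simp
  also have "\<dots> = 2 powr (2 * (real (a + 1) * log 2 (real Q)))"
    unfolding powr_powr by (simp add: algebra_simps)
  also have "2 powr real (t + 1) * 2 powr (2 * (real (a + 1) * log 2 (real Q)))
     = 2 powr (real (t + 1) + 2 * (real (a + 1) * log 2 (real Q)))" by (simp only: powr_add)
  also have "\<dots> \<le> 2 powr real (N - 1)"
    using n_real N_ge by (intro powr_mono) auto
  also have "\<dots> = real (2 ^ (N - 1))" by (simp add: powr_realpow)
  finally show ?thesis unfolding of_nat_le_iff .
qed

lemma Q_sq: "4 * ((a + 1) * (a + 1)) \<le> Q\<^sup>2"
  using mult_le_mono[OF Q_ge(1) Q_ge(1)] by (simp add: power2_eq_square algebra_simps)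

lemma eps: "0 \<le> \<epsilon>" "real a * \<epsilon> \<le> 1 / 4" "\<epsilon> \<le> 1 / 8" "real (t + 1) * \<epsilon> \<le> 1 / 4"
proof -
  show e0: "0 \<le> \<epsilon>" by (simp add: \<epsilon>_def)
  have Q0: "0 < (real Q)\<^sup>2" using Q_ge(3) by simp
  have "real (4 * ((a + 1) * (a + 1))) \<le> real (Q\<^sup>2)" using Q_sq of_nat_mono by blast
  then have "4 * (real a * real a) \<le> (real Q)\<^sup>2" by (simp add: algebra_simps)
  then show 1: "real a * \<epsilon> \<le> 1 / 4" using Q0 by (simp add: \<epsilon>_def field_simps)
  have "2 * \<epsilon> \<le> real a * \<epsilon>" using a2 e0 by (intro mult_right_mono) auto
  then show "\<epsilon> \<le> 1 / 8" using 1 by simp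
  have "4 * (real (t + 1) * real a) \<le> 4 * real Q" unfolding Q_def by (simp add: algebra_simps)
  also have "\<dots> \<le> real Q * real Q" using Q_ge(3) by (intro mult_right_mono) auto
  finally show "real (t + 1) * \<epsilon> \<le> 1 / 4" using Q0 by (simp add: \<epsilon>_def field_simps power2_eq_square)
qed

context
  fixes j m :: nat
  assumes j: "2 \<le> j" "j \<le> a" and m: "N + j \<le> m + a"
begin

text \<open>Bernoulli gives \<open>(j / (j - 1)) ^ (j - 1) \<ge> 2\<close>, and
  \<open>(j - 1) * (N - 1) \<le> (m - 1) * (a - 1)\<close> with equality for j = a, m = N. The
  condition on m admits every pair m = n - s, j = k - s with k at most K. The exponent
  \<open>a - 1\<close> stays outside so that no roots are taken; later estimates compare powers with
  this exponent.\<close>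

lemma quot_power: "2 ^ (N - 1) \<le> ((real j / real (j - 1)) ^ (m - 1)) ^ (a - 1)"
proof -
  define x where "x = real j / real (j - 1)"
  have x: "x = 1 + 1 / real (j - 1)" using j by (simp add: x_def field_simps of_nat_diff)
  have "1 + real (j - 1) * (1 / real (j - 1)) \<le> x ^ (j - 1)"
    unfolding x by (rule Bernoulli_inequality) (auto intro: order_trans[of _ 0])
  then have x2: "2 \<le> x ^ (j - 1)" using j by simp
  have x1: "1 \<le> x" unfolding x by simp
  \<comment> \<open>Slack variables turn the inequality between the exponents into a comparison of
    polynomials with nonnegative coefficients.\<close>
  obtain i where i: "a = j + i" using j le_Suc_ex by blast
  have "N - i \<le> m" using m i by simp
  then obtain c where c: "m = (N - i) + c" by (rule less_eqE)
  have "1 + i + j \<le> N" using N_ge i by simp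
  then obtain d where d: "N = 1 + i + j + d" by (rule less_eqE)
  obtain e where e: "j = e + 1" using j by (metis le_Suc_ex add.commute Suc_1 Suc_leD One_nat_def)
  have "(j - 1) * (N - 1) \<le> (m - 1) * (a - 1)"
    unfolding c i d e by (simp add: algebra_simps)
  then have "x ^ ((j - 1) * (N - 1)) \<le> x ^ ((m - 1) * (a - 1))" using x1 by (rule power_increasing)
  moreover have "2 ^ (N - 1) \<le> (x ^ (j - 1)) ^ (N - 1)" using x2 by (intro power_mono) auto
  ultimately show ?thesis unfolding x_def[symmetric] by (simp add: power_mult)
qed

lemma quot_ge_Q2: "(real Q)\<^sup>2 \<le> (real j / real (j - 1)) ^ (m - 1)"
proof (rule power_le_imp_le_base[where n = "a - 2"])
  have "Q ^ (2 * a - 2) \<le> Q ^ (2 * a + 2)" using Q_ge(3) by (intro power_increasing) auto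
  also have "\<dots> \<le> 2 ^ (t + 1) * Q ^ (2 * a + 2)" by simp
  also have "\<dots> \<le> 2 ^ (N - 1)" by (rule two_pow)
  finally have "real (Q ^ (2 * a - 2)) \<le> real (2 ^ (N - 1))" by (rule of_nat_mono)
  moreover have "2 * a - 2 = 2 * (Suc (a - 2))" "a - 1 = Suc (a - 2)" using a2 by auto
  ultimately show "((real Q)\<^sup>2) ^ Suc (a - 2) \<le> ((real j / real (j - 1)) ^ (m - 1)) ^ Suc (a - 2)"
    using quot_power by (simp only: power_mult[symmetric] of_nat_power of_nat_numeral)
qed (use j in auto)

text \<open>By \<open>quot_ge_Q2\<close> the subtracted term of \<open>fact_Stirling_ge\<close> is
  at most \<open>a / Q^2\<close> times \<open>j ^ m\<close>, which is where
  \<open>\<epsilon>\<close> comes from.\<close>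

lemma Stirling_low: "(1 - \<epsilon>) * real j ^ m \<le> fact j * real (Stirling m j)"
proof -
  have jm: "m = Suc (m - 1)" using m j N_ge by auto
  have "real (j ^ m) \<le> real (fact j * Stirling m j + j * (j - 1) ^ m)"
    using j by (intro of_nat_mono fact_Stirling_ge) auto
  then have 1: "real j ^ m - real j * real (j - 1) ^ m \<le> fact j * real (Stirling m j)" by simp
  have Q0: "0 < (real Q)\<^sup>2" using Q_ge(3) by simp
  have jp: "0 < real (j - 1) ^ (m - 1)" using j by simp
  have "(real Q)\<^sup>2 * real (j - 1) ^ (m - 1) \<le> real j ^ (m - 1)"
    using quot_ge_Q2 jp by (simp add: power_divide pos_le_divide_eq)
  then have "real (j - 1) * ((real Q)\<^sup>2 * real (j - 1) ^ (m - 1)) \<le> real j * real j ^ (m - 1)"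
    by (intro mult_mono) auto
  then have "(real Q)\<^sup>2 * real (j - 1) ^ m \<le> real j ^ m"
    by (subst (1 2) jm) (simp only: power_Suc mult.left_commute)
  then have "real j * ((real Q)\<^sup>2 * real (j - 1) ^ m) \<le> real a * real j ^ m"
    using j by (intro mult_mono) auto
  then have "real j * real (j - 1) ^ m \<le> \<epsilon> * real j ^ m"
    unfolding \<epsilon>_def using Q0 by (simp add: field_simps)
  then show ?thesis using 1 by (simp add: algebra_simps)
qed

lemma Stirling_ratio_low:
  "(1 - \<epsilon>) * (real j / real (j - 1)) ^ (m - 1) * real (Stirling (m - 1) (j - 1)) \<le> real (Stirling m j)"
proof -
  obtain i where i: "j = Suc i" "1 \<le> i" using j by (cases j) auto
  have jm: "m = Suc (m - 1)" using m j N_ge by auto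
  have "fact i * Stirling (m - 1) i \<le> i ^ (m - 1)" by (rule fact_Stirling_le)
  then have "real (fact i * Stirling (m - 1) i) \<le> real (i ^ (m - 1))" by (rule of_nat_mono)
  then have 1: "fact i * real (Stirling (m - 1) i) \<le> real i ^ (m - 1)" by simp
  have "(1 - \<epsilon>) * real j ^ (m - 1) * (fact i * real (Stirling (m - 1) i))
     \<le> (1 - \<epsilon>) * real j ^ (m - 1) * real i ^ (m - 1)"
    using 1 eps by (intro mult_left_mono) auto
  then have "(1 - \<epsilon>) * real j ^ (m - 1) * (fact i * real (Stirling (m - 1) i)) * real j
     \<le> (1 - \<epsilon>) * real j ^ (m - 1) * real i ^ (m - 1) * real j"
    by (intro mult_right_mono) auto
  also have "\<dots> = ((1 - \<epsilon>) * real j ^ m) * real i ^ (m - 1)"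
    by (subst (3) jm) simp
  also have "\<dots> \<le> (fact j * real (Stirling m j)) * real i ^ (m - 1)"
    by (intro mult_right_mono Stirling_low) auto
  finally have "fact i * real j * ((1 - \<epsilon>) * real j ^ (m - 1) * real (Stirling (m - 1) i))
    \<le> fact i * real j * (real (Stirling m j) * real i ^ (m - 1))"
    unfolding i(1) fact_Suc of_nat_id by (simp only: of_nat_mult of_nat_fact mult_ac)
  moreover have "0 < fact i * real j" using j by simp
  ultimately have "(1 - \<epsilon>) * real j ^ (m - 1) * real (Stirling (m - 1) i) \<le> real (Stirling m j) * real i ^ (m - 1)"
    by (metis mult_le_cancel_left_pos)
  then show ?thesis using i by (simp add: power_divide field_simps)
qed

text \<open>\<open>Stirling_ratio_low\<close> loses a factor \<open>1 - \<epsilon>\<close>. Its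
  power with exponent \<open>a - 1\<close> is at least 1/2 by Bernoulli, and a spare factor 2 in
  \<open>two_pow\<close> pays for it, so the clean factor \<open>Q^2\<close> survives.\<close>

lemma Stirling_ratio: "Q\<^sup>2 * Stirling (m - 1) (j - 1) \<le> Stirling m j"
proof -
  define x where "x = (real j / real (j - 1)) ^ (m - 1)"
  have Q0: "0 < real Q" using Q_ge(3) by simp
  have e: "0 < 1 - \<epsilon>" using eps by simp
  have "1 + real (a - 1) * (- \<epsilon>) \<le> (1 + - \<epsilon>) ^ (a - 1)"
    using eps by (intro Bernoulli_inequality) auto
  moreover have "real (a - 1) * \<epsilon> \<le> real a * \<epsilon>" using eps by (intro mult_right_mono) auto
  ultimately have h: "1 / 2 \<le> (1 - \<epsilon>) ^ (a - 1)" using eps by simp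
  have "(real Q)\<^sup>2 / (1 - \<epsilon>) \<le> x"
  proof (rule power_le_imp_le_base[where n = "a - 2"])
    have a: "a - 1 = Suc (a - 2)" "2 * a - 2 = 2 * (a - 1)" using a2 by auto
    have "2 * Q ^ (2 * a - 2) \<le> 2 ^ (t + 1) * Q ^ (2 * a + 2)"
      using Q_ge(3) by (intro mult_mono power_increasing) auto
    also have "\<dots> \<le> 2 ^ (N - 1)" by (rule two_pow)
    finally have "real (2 * Q ^ (2 * a - 2)) \<le> real (2 ^ (N - 1))" by (rule of_nat_mono)
    then have 1: "2 * ((real Q)\<^sup>2) ^ (a - 1) \<le> x ^ (a - 1)"
      using quot_power unfolding x_def a(2) by (simp add: power_mult)
    have "((real Q)\<^sup>2 / (1 - \<epsilon>)) ^ (a - 1) = ((real Q)\<^sup>2) ^ (a - 1) / (1 - \<epsilon>) ^ (a - 1)"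
      by (rule power_divide)
    also have "\<dots> \<le> ((real Q)\<^sup>2) ^ (a - 1) / (1 / 2)"
      using h by (intro divide_left_mono) auto
    finally show "((real Q)\<^sup>2 / (1 - \<epsilon>)) ^ Suc (a - 2) \<le> x ^ Suc (a - 2)" using 1 a(1) by simp
  qed (simp add: x_def)
  then have "(real Q)\<^sup>2 \<le> (1 - \<epsilon>) * x" using e by (simp add: field_simps)
  then have "(real Q)\<^sup>2 * real (Stirling (m - 1) (j - 1)) \<le> (1 - \<epsilon>) * x * real (Stirling (m - 1) (j - 1))"
    by (intro mult_right_mono) auto
  also have "\<dots> \<le> real (Stirling m j)" unfolding x_def by (rule Stirling_ratio_low)
  finally have "real (Q\<^sup>2 * Stirling (m - 1) (j - 1)) \<le> real (Stirling m j)" by simp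
  then show ?thesis unfolding of_nat_le_iff .
qed

end

lemma Stirling_low': "1 \<le> j \<Longrightarrow> j \<le> a \<Longrightarrow> N + j \<le> m + a \<Longrightarrow> (1 - \<epsilon>) * real j ^ m \<le> fact j * real (Stirling m j)"
proof (cases "j = 1")
  case True
  assume "1 \<le> j" "j \<le> a" "N + j \<le> m + a"
  then obtain m' where "m = Suc m'" using True N_ge by (cases m) auto
  then have "Stirling m j = 1" using True by (metis One_nat_def Stirling_1)
  then show ?thesis using True eps by simp
qed (use Stirling_low[of j m] in auto)

lemma Stirling_ratio_up:
  assumes "2 \<le> j" "j \<le> a" "N + j \<le> m + a"
  shows "(1 - \<epsilon>) * real (Stirling m j) \<le> (real j / real (j - 1)) ^ (m - 1) * real (Stirling (m - 1) (j - 1))"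
proof -
  obtain i where i: "j = Suc i" "1 \<le> i" using assms by (cases j) auto
  have jm: "m = Suc (m - 1)" using assms N_ge by auto
  have "fact j * Stirling m j \<le> j ^ m" by (rule fact_Stirling_le)
  then have "real (fact j * Stirling m j) \<le> real (j ^ m)" by (rule of_nat_mono)
  then have "fact j * real (Stirling m j) \<le> real j ^ m" by simp
  also have "\<dots> = real j * real j ^ (m - 1)" by (subst jm) simp
  finally have "real j * (fact i * real (Stirling m j)) \<le> real j * real j ^ (m - 1)"
    unfolding i(1) by (simp add: algebra_simps)
  then have 1: "fact i * real (Stirling m j) \<le> real j ^ (m - 1)" using i by simp
  have 2: "(1 - \<epsilon>) * real i ^ (m - 1) \<le> fact i * real (Stirling (m - 1) i)"
    using i assms jm by (intro Stirling_low') auto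
  have "(1 - \<epsilon>) * real i ^ (m - 1) * (fact i * real (Stirling m j))
     \<le> (fact i * real (Stirling (m - 1) i)) * real j ^ (m - 1)"
    by (rule mult_mono[OF 2 1]) auto
  then have "fact i * ((1 - \<epsilon>) * real i ^ (m - 1) * real (Stirling m j))
     \<le> fact i * (real (Stirling (m - 1) i) * real j ^ (m - 1))" by (simp add: algebra_simps)
  then have "(1 - \<epsilon>) * real i ^ (m - 1) * real (Stirling m j) \<le> real (Stirling (m - 1) i) * real j ^ (m - 1)"
    by simp
  then show ?thesis using i by (simp add: power_divide field_simps)
qed

text \<open>The quotient \<open>Stirling N b / Stirling (N - 1) (b - 1)\<close> is close to
  \<open>(b / (b - 1)) ^ (N - 1)\<close>, which decreases in b. So the base on the left exceeds 1,
  and the larger block number should sit in the family with t + 1 prescribed blocks.\<close>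

lemma Stirling_ratio_compare:
  assumes "2 \<le> b" "b < c" "c \<le> a"
  shows "(1 - \<epsilon>)\<^sup>2 * ((real (c - 1) * real b) / (real c * real (b - 1))) ^ (N - 1)
     * (real (Stirling N c) * real (Stirling (N - 1) (b - 1)))
     \<le> real (Stirling (N - 1) (c - 1)) * real (Stirling N b)"
proof -
  define x y where "x = (real b / real (b - 1)) ^ (N - 1)" and "y = (real c / real (c - 1)) ^ (N - 1)"
  have y0: "0 < y" using assms by (simp add: y_def)
  have 1: "(1 - \<epsilon>) * x * real (Stirling (N - 1) (b - 1)) \<le> real (Stirling N b)"
    unfolding x_def using assms by (intro Stirling_ratio_low) auto
  have "(1 - \<epsilon>) * real (Stirling N c) \<le> y * real (Stirling (N - 1) (c - 1))"
    unfolding y_def using assms by (intro Stirling_ratio_up) auto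
  then have 2: "(1 - \<epsilon>) * real (Stirling N c) / y \<le> real (Stirling (N - 1) (c - 1))"
    using y0 by (simp add: field_simps)
  have "((1 - \<epsilon>) * real (Stirling N c) / y) * ((1 - \<epsilon>) * x * real (Stirling (N - 1) (b - 1)))
    \<le> real (Stirling (N - 1) (c - 1)) * real (Stirling N b)"
    using 1 2 eps y0 by (intro mult_mono) (auto simp: x_def)
  moreover have "((real (c - 1) * real b) / (real c * real (b - 1))) ^ (N - 1) = x / y"
    unfolding x_def y_def using assms by (simp add: power_divide power_mult_distrib mult.commute)
  ultimately show ?thesis by (simp add: power2_eq_square mult_ac)
qed

text \<open>For k = t + 2 there is only one level to gain from. There the gain must also pay for
  factors \<open>t + 1\<close>, which this stronger bound allows.\<close>

lemma Stirling_2_large: "(t + 1)\<^sup>2 * Q\<^sup>2 \<le> Stirling N 2"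
proof -
  obtain M where M: "N = Suc M" using N_ge by (cases N) auto
  have "(t + 1)\<^sup>2 * Q\<^sup>2 \<le> Q\<^sup>2 * Q\<^sup>2"
    using Q_ge(2) by (intro mult_le_mono power_mono) auto
  also have "\<dots> = Q ^ 4" by (simp add: power_add[symmetric])
  also have "\<dots> \<le> Q ^ (2 * a + 2)" using Q_ge(3) a2 by (intro power_increasing) auto
  finally have "(t + 1)\<^sup>2 * Q\<^sup>2 + 1 \<le> 2 * Q ^ (2 * a + 2)" using Q_ge(3)
    by (smt (verit) One_nat_def Suc_leI add_mono mult_2 not_numeral_le_zero zero_less_iff_neq_zero zero_less_power)
  also have "\<dots> \<le> 2 ^ (t + 1) * Q ^ (2 * a + 2)" by simp
  also have "\<dots> \<le> 2 ^ M" using two_pow M by simp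
  finally have "(t + 1)\<^sup>2 * Q\<^sup>2 \<le> 2 ^ M - 1" by simp
  then show ?thesis using Stirling_2[of M] M by (simp add: numeral_2_eq_2)
qed

end

section \<open>Covers\<close>

definition t_cover :: "nat \<Rightarrow> nat set set set \<Rightarrow> nat set set \<Rightarrow> bool" where
  "t_cover t FF T \<longleftrightarrow> finite T \<and> (\<forall>F\<in>FF. t \<le> card (T \<inter> F))"

lemma finite_Pi_part [simp]: "finite (Pi_part n k)"
  by (simp add: Pi_part_parts)

lemma Pi_part_finite: "P \<in> Pi_part n k \<Longrightarrow> finite P"
  unfolding Pi_part_parts by (rule parts_finite[of "{1..n}"]) auto

lemma Pi_part_card: "P \<in> Pi_part n k \<Longrightarrow> card P = k"
  by (simp add: Pi_part_def)

lemma Pi_part_disjoint: "P \<in> Pi_part n k \<Longrightarrow> A \<in> P \<Longrightarrow> B \<in> P \<Longrightarrow> A \<noteq> B \<Longrightarrow> A \<inter> B = {}"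
  by (auto simp: Pi_part_def partition_on_def dest: disjointD)

lemma Pi_part_nonempty: "P \<in> Pi_part n k \<Longrightarrow> B \<in> P \<Longrightarrow> B \<noteq> {}"
  by (auto simp: Pi_part_def partition_on_def)

lemma Pi_part_Union: "P \<in> Pi_part n k \<Longrightarrow> \<Union>P = {1..n}"
  by (simp add: Pi_part_def partition_on_def)

lemma finite_subfam: "FF \<subseteq> Pi_part n k \<Longrightarrow> finite FF"
  by (rule finite_subset) auto

lemma cross_t_int_sym: "cross_t_int t F G \<Longrightarrow> cross_t_int t G F"
  unfolding cross_t_int_def by (metis Int_commute)

lemma Int_eq_Diff_singleton:
  assumes "finite X" "\<not> X \<subseteq> G" "card X \<le> card (X \<inter> G) + 1"
  shows "\<exists>x\<in>X. X \<inter> G = X - {x}"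
proof -
  obtain x where x: "x \<in> X" "x \<notin> G" using assms(2) by auto
  have "X \<inter> G = X - {x}"
  proof (rule card_seteq)
    show "finite (X - {x})" "X \<inter> G \<subseteq> X - {x}" using assms(1) x by auto
    show "card (X - {x}) \<le> card (X \<inter> G)" using assms x by simp
  qed
  then show ?thesis using x by blast
qed

lemma card_UN_bound:
  assumes "finite Y" "\<And>B. B \<in> Y \<Longrightarrow> card (f B) \<le> c"
  shows "card (\<Union>B\<in>Y. f B) \<le> card Y * c"
proof -
  have "card (\<Union>B\<in>Y. f B) \<le> (\<Sum>B\<in>Y. card (f B))" by (rule card_UN_le[OF assms(1)])
  also have "\<dots> \<le> (\<Sum>B\<in>Y. c)" using assms(2) by (rule sum_mono)
  finally show ?thesis by simp
qed

text \<open>A member of \<open>FF\<close> shares t blocks with G, so it misses at most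
  \<open>l - t\<close> blocks of G and hits any \<open>l - t + 1\<close> of them. Since W meets G in
  fewer than t blocks, that many can be chosen outside W.\<close>

lemma extend_block:
  assumes FG: "FF \<subseteq> Pi_part n k" "cross_t_int t FF GG" "G \<in> GG" "GG \<subseteq> Pi_part n l"
    and W: "finite W" "card (W \<inter> G) < t"
  obtains Y where "Y \<subseteq> G - W" "card Y \<le> l - t + 1"
    "{F \<in> FF. W \<subseteq> F} \<subseteq> (\<Union>B\<in>Y. {F \<in> FF. insert B W \<subseteq> F})"
proof (cases "FF = {}")
  case True
  then show ?thesis by (intro that[of "{}"]) auto
next
  case False
  then obtain F0 where F0: "F0 \<in> FF" by auto
  have "G \<in> Pi_part n l" using FG(3,4) by auto
  then have G: "finite G" "card G = l" by (simp_all only: Pi_part_finite Pi_part_card)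
  have cr: "t \<le> card (F \<inter> G)" if "F \<in> FF" for F
    using that FG(2,3) by (simp add: cross_t_int_def)
  have "t \<le> card (F0 \<inter> G)" using F0 by (rule cr)
  also have "\<dots> \<le> l" using G by (metis Int_lower2 card_mono)
  finally have tl: "t \<le> l" .
  define s where "s = card (W \<inter> G)"
  have "card (G - W) = l - s" using G W by (metis Int_commute card_Diff_subset_Int finite_Int s_def)
  moreover have "l - t + 1 \<le> l - s" using W(2) tl by (simp add: s_def)
  ultimately obtain Y where Y: "Y \<subseteq> G - W" "card Y = l - t + 1" by (metis obtain_subset_with_card_n)
  show ?thesis
  proof (rule that[OF Y(1)])
    show "{F \<in> FF. W \<subseteq> F} \<subseteq> (\<Union>B\<in>Y. {F \<in> FF. insert B W \<subseteq> F})"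
    proof
      fix F assume F: "F \<in> {F \<in> FF. W \<subseteq> F}"
      have "Y \<inter> F \<noteq> {}"
      proof
        assume e: "Y \<inter> F = {}"
        have "t \<le> card (F \<inter> G)" using F by (intro cr) simp
        also have "\<dots> \<le> card (G - Y)" using e G by (intro card_mono) auto
        also have "\<dots> = l - (l - t + 1)" using Y G by (metis card_Diff_subset Diff_subset finite_subset order_trans)
        also have "\<dots> < t" using tl W(2) by simp
        finally show False by simp
      qed
      then show "F \<in> (\<Union>B\<in>Y. {F \<in> FF. insert B W \<subseteq> F})" using F by auto
    qed
  qed (use Y in simp)
qed

lemma extend_card:
  assumes FG: "FF \<subseteq> Pi_part n k" "cross_t_int t FF GG" "G \<in> GG" "GG \<subseteq> Pi_part n l"
    and W: "finite W" "card (W \<inter> G) < t"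
    and c: "\<And>B. B \<in> G - W \<Longrightarrow> card {F \<in> FF. insert B W \<subseteq> F} \<le> c"
  shows "card {F \<in> FF. W \<subseteq> F} \<le> (l - t + 1) * c"
proof -
  obtain Y where Y: "Y \<subseteq> G - W" "card Y \<le> l - t + 1"
    "{F \<in> FF. W \<subseteq> F} \<subseteq> (\<Union>B\<in>Y. {F \<in> FF. insert B W \<subseteq> F})"
    by (rule extend_block[OF FG W])
  have fF: "finite FF" using FG(1) by (rule finite_subfam)
  have "finite G" using FG(3,4) Pi_part_finite[of G n l] by auto
  then have fY: "finite Y" using Y(1) by (meson finite_Diff finite_subset)
  have "card {F \<in> FF. W \<subseteq> F} \<le> card (\<Union>B\<in>Y. {F \<in> FF. insert B W \<subseteq> F})"
    using Y(3) fF fY by (intro card_mono) auto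
  also have "\<dots> \<le> card Y * c" using Y(1) by (intro card_UN_bound[OF fY] c) auto
  also have "\<dots> \<le> (l - t + 1) * c" using Y(2) by (rule mult_le_mono1)
  finally show ?thesis .
qed

lemma sub_containing_le:
  assumes "FF \<subseteq> Pi_part n k" "card W < k" "finite W"
  shows "card {F \<in> FF. W \<subseteq> F} \<le> Stirling (n - card W) (k - card W)"
proof -
  have "card {F \<in> FF. W \<subseteq> F} \<le> card {F \<in> Pi_part n k. W \<subseteq> F}"
    using assms by (intro card_mono) auto
  then show ?thesis using card_containing_le[OF assms(2,3), of n] by simp
qed

lemma extend_once:
  assumes FG: "FF \<subseteq> Pi_part n k" "cross_t_int t FF GG" "G \<in> GG" "GG \<subseteq> Pi_part n l"
    and W: "finite W" "card (W \<inter> G) < t" "card W + 1 < k"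
  shows "card {F \<in> FF. W \<subseteq> F} \<le> (l - t + 1) * Stirling (n - (card W + 1)) (k - (card W + 1))"
proof (rule extend_card[OF FG W(1,2)])
  fix B assume "B \<in> G - W"
  then have "card (insert B W) = card W + 1" using W by simp
  then show "card {F \<in> FF. insert B W \<subseteq> F} \<le> Stirling (n - (card W + 1)) (k - (card W + 1))"
    using sub_containing_le[OF FG(1), of "insert B W"] W by simp
qed

text \<open>A set of fewer than m blocks is not a cover of \<open>GG\<close>, so some G allows
  another application of \<open>extend_card\<close>; this goes on until m blocks are
  prescribed.\<close>

lemma extend_iterated:
  assumes FG: "FF \<subseteq> Pi_part n k" "cross_t_int t FF GG" "GG \<subseteq> Pi_part n l"
    and nocov: "\<And>W. finite W \<Longrightarrow> card W < m \<Longrightarrow> \<exists>G\<in>GG. card (W \<inter> G) < t"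
    and m: "m < k" and W: "finite W" "card W + d = m"
  shows "card {F \<in> FF. W \<subseteq> F} \<le> (l - t + 1) ^ d * Stirling (n - m) (k - m)"
  using W
proof (induction d arbitrary: W)
  case 0
  then show ?case using sub_containing_le[OF FG(1), of W] m by simp
next
  case (Suc d)
  obtain G where G: "G \<in> GG" "card (W \<inter> G) < t" using nocov[of W] Suc by auto
  have "card {F \<in> FF. W \<subseteq> F} \<le> (l - t + 1) * ((l - t + 1) ^ d * Stirling (n - m) (k - m))"
    using Suc by (intro extend_card[OF FG(1,2) G(1) FG(3) Suc.prems(1) G(2)] Suc.IH) auto
  then show ?case by (simp only: power_Suc mult.assoc)
qed

lemma t_cover_card:
  assumes FF: "FF \<subseteq> Pi_part n k" and T: "t_cover t FF T"
    and c: "\<And>X. X \<subseteq> T \<Longrightarrow> card X = t \<Longrightarrow> card {F \<in> FF. X \<subseteq> F} \<le> c"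
  shows "card FF \<le> (card T choose t) * c"
proof -
  have fT: "finite T" and fF: "finite FF" using T finite_subfam[OF FF] by (auto simp: t_cover_def)
  let ?X = "{X. X \<subseteq> T \<and> card X = t}"
  have fX: "finite ?X" using fT by simp
  have "FF \<subseteq> (\<Union>X\<in>?X. {F \<in> FF. X \<subseteq> F})"
  proof
    fix F assume F: "F \<in> FF"
    then have "t \<le> card (T \<inter> F)" using T by (simp add: t_cover_def)
    then obtain X where "X \<subseteq> T \<inter> F" "card X = t" by (metis obtain_subset_with_card_n)
    then show "F \<in> (\<Union>X\<in>?X. {F \<in> FF. X \<subseteq> F})" using F by auto
  qed
  then have "card FF \<le> card (\<Union>X\<in>?X. {F \<in> FF. X \<subseteq> F})"
    using fX fF by (intro card_mono) auto
  also have "\<dots> \<le> card ?X * c" by (intro card_UN_bound[OF fX] c) auto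
  also have "card ?X = (card T choose t)" using n_subsets[OF fT] by simp
  finally show ?thesis .
qed

text \<open>Every member of \<open>FF\<close> is a cover of \<open>GG\<close>, hence the least size
  exists and is at most k. Minimality is the assumption \<open>nocov\<close> of
  \<open>extend_iterated\<close>.\<close>

lemma obtain_min_cover:
  assumes "FF \<subseteq> Pi_part n k" "F \<in> FF" "cross_t_int t FF GG"
  obtains T where "t_cover t GG T" "card T \<le> k"
    "\<And>W. finite W \<Longrightarrow> card W < card T \<Longrightarrow> \<exists>G\<in>GG. card (W \<inter> G) < t"
proof -
  let ?P = "\<lambda>m. \<exists>T. t_cover t GG T \<and> card T = m"
  have "F \<in> Pi_part n k" using assms by auto
  then have F: "t_cover t GG F" "card F = k" using assms Pi_part_finite[of F n k]
    by (auto simp: t_cover_def cross_t_int_def Pi_part_card)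
  then have Pk: "?P k" by blast
  obtain T where T: "t_cover t GG T" "card T = (LEAST m. ?P m)" using LeastI[of ?P, OF Pk] by blast
  show ?thesis
  proof (rule that[OF T(1)])
    show "card T \<le> k" unfolding T(2) by (rule Least_le[of ?P, OF Pk])
    show "\<exists>G\<in>GG. card (W \<inter> G) < t" if W: "finite W" "card W < card T" for W
    proof (rule ccontr)
      assume "\<not> ?thesis"
      then have "t_cover t GG W" using W by (auto simp: t_cover_def not_less)
      then have "(LEAST m. ?P m) \<le> card W" by (intro Least_le) blast
      then show False using W T by simp
    qed
  qed
qed

text \<open>Raising m by one multiplies the binomial coefficient by
  \<open>(m + 1) / (m + 1 - t) \<le> t + 1\<close>.\<close>

lemma choose_le_power: "t \<le> m \<Longrightarrow> m choose t \<le> (t + 1) ^ (m - t)"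
proof (induction m rule: dec_induct)
  case (step m)
  have "(Suc m - t) * (Suc m choose t) = Suc m * (m choose t)"
    using binomial_absorb_comp[of "Suc m" t] by simp
  also have "\<dots> \<le> ((Suc m - t) * (t + 1)) * (m choose t)"
  proof (rule mult_le_mono1)
    obtain d where "m = t + d" using step(1) le_Suc_ex by blast
    then show "Suc m \<le> (Suc m - t) * (t + 1)" by (simp add: algebra_simps)
  qed
  finally have "Suc m choose t \<le> (t + 1) * (m choose t)"
    using step(1) by (simp only: mult.assoc) simp
  also have "\<dots> \<le> (t + 1) * (t + 1) ^ (m - t)" using step by (intro mult_le_mono2)
  also have "\<dots> = (t + 1) ^ (Suc m - t)" using step(1) by (simp add: Suc_diff_le)
  finally show ?case .
qed simp

text \<open>From m = t + 2 on a quarter is saved, because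
  \<open>(t + 2) / 2 \<le> 3 / 4 * (t + 1)\<close>. This quarter makes large covers fall short of
  the extremal product.\<close>

lemma choose_le_power': 
  assumes "1 \<le> t" "t + 2 \<le> m" shows "4 * (m choose t) \<le> 3 * (t + 1) ^ (m - t)"
  using assms(2)
proof (induction m rule: dec_induct)
  case base
  have "2 * (t + 2 choose t) = (t + 2) * (t + 1)"
    using binomial_absorb_comp[of "t + 2" t] binomial_absorb_comp[of "t + 1" t] by simp
  then have "4 * (t + 2 choose t) = 2 * ((t + 2) * (t + 1))" by simp
  also have "\<dots> \<le> 3 * ((t + 1) * (t + 1))"
    using assms(1) by (cases t) (auto simp: algebra_simps)
  finally show ?case by (simp add: power2_eq_square)
next
  case (step m)
  have "(Suc m - t) * (Suc m choose t) = Suc m * (m choose t)"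
    using binomial_absorb_comp[of "Suc m" t] by simp
  also have "\<dots> \<le> ((Suc m - t) * (t + 1)) * (m choose t)"
  proof (rule mult_le_mono1)
    have "t \<le> m" using step(1) by simp
    then obtain d where "m = t + d" using le_Suc_ex by blast
    then show "Suc m \<le> (Suc m - t) * (t + 1)" by (simp add: algebra_simps)
  qed
  finally have "Suc m choose t \<le> (t + 1) * (m choose t)"
    using step(1) by (simp only: mult.assoc) simp
  then have "4 * (Suc m choose t) \<le> (t + 1) * (4 * (m choose t))" by simp
  also have "\<dots> \<le> (t + 1) * (3 * (t + 1) ^ (m - t))" using step by (intro mult_le_mono2) auto
  also have "\<dots> = 3 * (t + 1) ^ (Suc m - t)" using step(1) by (simp add: Suc_diff_le)
  finally show ?case .
qed

section \<open>Branching costs against the gain per level\<close>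

context large_ground_set
begin

definition \<phi> where "\<phi> k s = Stirling (n - s) (k - s)"

lemma phi_ratio: "t \<le> s \<Longrightarrow> s + 2 \<le> k \<Longrightarrow> k \<le> K \<Longrightarrow> Q\<^sup>2 * \<phi> k (s + 1) \<le> \<phi> k s"
  using Stirling_ratio[of "k - s" "n - s"] N_ge Kta by (simp add: \<phi>_def)

lemma phi_pos: "s < k \<Longrightarrow> k \<le> K \<Longrightarrow> 1 \<le> \<phi> k s"
  unfolding \<phi>_def using N_ge Kta by (intro Stirling_ge_1) auto

lemma phi_power:
  assumes "t \<le> s" "s + d < k" "k \<le> K"
  shows "Q ^ (2 * d) * \<phi> k (s + d) \<le> \<phi> k s"
  using assms(2)
proof (induction d)
  case (Suc d)
  have "Q ^ (2 * Suc d) * \<phi> k (s + Suc d) = Q ^ (2 * d) * (Q\<^sup>2 * \<phi> k (s + d + 1))"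
    by (simp add: power2_eq_square)
  also have "\<dots> \<le> Q ^ (2 * d) * \<phi> k (s + d)"
    using Suc assms by (intro mult_le_mono2 phi_ratio) auto
  also have "\<dots> \<le> \<phi> k s" using Suc by simp
  finally show ?case .
qed simp

lemma phi_Q:
  assumes "t \<le> s" "s \<le> \<mu>" "\<mu> < k" "k \<le> K" "e \<le> 2 * (\<mu> - s)"
  shows "Q ^ e * \<phi> k \<mu> \<le> \<phi> k s"
proof -
  have "Q ^ e * \<phi> k \<mu> \<le> Q ^ (2 * (\<mu> - s)) * \<phi> k \<mu>"
    using assms Q_ge(3) by (intro mult_le_mono1 power_increasing) auto
  also have "\<dots> \<le> \<phi> k s" using phi_power[of s "\<mu> - s" k] assms by simp
  finally show ?thesis .
qed

lemma Q_power: "q \<le> a \<Longrightarrow> (t + 1) ^ d * (q + 1) ^ d \<le> Q ^ d"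
  unfolding power_mult_distrib[symmetric] Q_def by (rule power_mono, rule mult_le_mono2) auto

text \<open>Branching stops at \<open>k - 1\<close> blocks, since \<open>card_containing_le\<close>
  needs fewer than k. For m = k the binomial coefficient then has one factor \<open>t + 1\<close>
  more than the branching; it is the one on the right. From \<open>\<mu> \<ge> t + 2\<close> it
  follows that the gain \<open>Q ^ (2 * (\<mu> - t - 1))\<close> covers the cost
  \<open>Q ^ (\<mu> - t)\<close>.\<close>

lemma large_cover_bound:
  assumes k: "t + 3 \<le> k" "k \<le> K" and q: "q \<le> a" and m: "t + 2 \<le> m" "m \<le> k"
  defines "\<mu> \<equiv> min m (k - 1)"
  shows "4 * ((m choose t) * ((q + 1) ^ (\<mu> - t) * \<phi> k \<mu>)) \<le> 3 * (t + 1) * \<phi> k (t + 1)"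
proof -
  have mu: "t + 2 \<le> \<mu>" "m - t \<le> Suc (\<mu> - t)" "\<mu> < k" using k m by (auto simp: \<mu>_def)
  have "4 * (m choose t) \<le> 3 * (t + 1) ^ (m - t)" using t1 m by (intro choose_le_power') auto
  also have "\<dots> \<le> 3 * (t + 1) ^ Suc (\<mu> - t)" using mu by (intro mult_le_mono2 power_increasing) auto
  finally have "(4 * (m choose t)) * ((q + 1) ^ (\<mu> - t) * \<phi> k \<mu>)
    \<le> (3 * (t + 1) ^ Suc (\<mu> - t)) * ((q + 1) ^ (\<mu> - t) * \<phi> k \<mu>)" by (rule mult_le_mono1)
  also have "\<dots> = 3 * (t + 1) * (((t + 1) ^ (\<mu> - t) * (q + 1) ^ (\<mu> - t)) * \<phi> k \<mu>)"
    by (simp only: power_Suc mult_ac)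
  also have "\<dots> \<le> 3 * (t + 1) * (Q ^ (\<mu> - t) * \<phi> k \<mu>)"
    using Q_power[OF q] by (intro mult_le_mono2 mult_le_mono1)
  also have "\<dots> \<le> 3 * (t + 1) * \<phi> k (t + 1)"
    using k mu by (intro mult_le_mono2 phi_Q) auto
  finally show ?thesis by (simp only: mult.assoc)
qed

text \<open>The exponent \<open>e\<close> in the proof is 1 exactly for m = k and records the
  unmatched factor \<open>t + 1\<close>, which is at most Q. The second and third bound absorb it
  into the surplus of a further level when there is one.\<close>

lemma cover_bound:
  assumes k: "t + 2 \<le> k" "k \<le> K" and q: "q \<le> a" and m: "t + 1 \<le> m" "m \<le> k"
  defines "\<mu> \<equiv> min m (k - 1)"
  shows "(m choose t) * ((q + 1) ^ (\<mu> - t) * \<phi> k \<mu>) \<le> (t + 1) * Q * \<phi> k (t + 1)"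
    and "t + 3 \<le> k \<Longrightarrow> (m choose t) * ((q + 1) ^ (\<mu> - t) * \<phi> k \<mu>) \<le> Q * \<phi> k (t + 1)"
    and "Q * ((m choose t) * ((q + 1) ^ (\<mu> - t) * \<phi> k \<mu>)) \<le> \<phi> k t"
proof -
  have tQ: "t + 1 \<le> Q" using Q_ge(2) by simp
  have mu: "t + 1 \<le> \<mu>" "\<mu> < k" using k m by (auto simp: \<mu>_def)
  define e where "e = m - \<mu>"
  have e: "m - t = e + (\<mu> - t)" "e = 0 \<or> e = 1" using k m by (auto simp: \<mu>_def e_def)
  have "m choose t \<le> (t + 1) ^ e * (t + 1) ^ (\<mu> - t)"
    using choose_le_power[of t m] m e(1) by (simp add: power_add)
  then have "(m choose t) * ((q + 1) ^ (\<mu> - t) * \<phi> k \<mu>)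
    \<le> ((t + 1) ^ e * (t + 1) ^ (\<mu> - t)) * ((q + 1) ^ (\<mu> - t) * \<phi> k \<mu>)" by (rule mult_le_mono1)
  also have "\<dots> = (t + 1) ^ e * (((t + 1) ^ (\<mu> - t) * (q + 1) ^ (\<mu> - t)) * \<phi> k \<mu>)"
    by (simp only: mult_ac)
  also have "\<dots> \<le> (t + 1) ^ e * (Q ^ (\<mu> - t) * \<phi> k \<mu>)"
    using Q_power[OF q] by (intro mult_le_mono2 mult_le_mono1)
  finally have main: "(m choose t) * ((q + 1) ^ (\<mu> - t) * \<phi> k \<mu>) \<le> (t + 1) ^ e * (Q ^ (\<mu> - t) * \<phi> k \<mu>)" .
  have d: "\<mu> - t = Suc (\<mu> - (t + 1))" using mu by simp
  have "Q ^ (\<mu> - (t + 1)) * \<phi> k \<mu> \<le> \<phi> k (t + 1)" using mu k by (intro phi_Q) auto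
  then have B: "Q ^ (\<mu> - t) * \<phi> k \<mu> \<le> Q * \<phi> k (t + 1)" unfolding d power_Suc mult.assoc by (rule mult_le_mono2)
  have te: "(t + 1) ^ e \<le> t + 1" using e(2) by auto
  have "(t + 1) ^ e * (Q ^ (\<mu> - t) * \<phi> k \<mu>) \<le> (t + 1) * (Q * \<phi> k (t + 1))"
    by (rule mult_le_mono[OF te B])
  with main show "(m choose t) * ((q + 1) ^ (\<mu> - t) * \<phi> k \<mu>) \<le> (t + 1) * Q * \<phi> k (t + 1)"
    by (simp only: mult.assoc)
  show "(m choose t) * ((q + 1) ^ (\<mu> - t) * \<phi> k \<mu>) \<le> Q * \<phi> k (t + 1)" if k3: "t + 3 \<le> k"
  proof (cases "e = 0")
    case True
    show ?thesis using main B unfolding True power_0 mult_1 by (rule order_trans)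
  next
    case False
    then have mu2: "t + 2 \<le> \<mu>" using k3 m by (auto simp: e_def \<mu>_def)
    have "Q ^ (\<mu> - t) * \<phi> k \<mu> \<le> \<phi> k (t + 1)" using mu2 mu k by (intro phi_Q) auto
    then have "(t + 1) ^ e * (Q ^ (\<mu> - t) * \<phi> k \<mu>) \<le> Q * \<phi> k (t + 1)"
      using te tQ by (intro mult_le_mono) auto
    with main show ?thesis by (rule order_trans)
  qed
  show "Q * ((m choose t) * ((q + 1) ^ (\<mu> - t) * \<phi> k \<mu>)) \<le> \<phi> k t"
  proof -
    have main': "Q * ((m choose t) * ((q + 1) ^ (\<mu> - t) * \<phi> k \<mu>)) \<le> (t + 1) ^ e * (Q ^ Suc (\<mu> - t) * \<phi> k \<mu>)"
      using mult_le_mono2[OF main, of Q] by (simp only: power_Suc mult_ac)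
    consider "e = 0" | "e = 1" "t + 2 \<le> \<mu>" | "e = 1" "k = t + 2"
    proof -
      assume h: "e = 0 \<Longrightarrow> thesis" "e = 1 \<Longrightarrow> t + 2 \<le> \<mu> \<Longrightarrow> thesis" "e = 1 \<Longrightarrow> k = t + 2 \<Longrightarrow> thesis"
      have "\<mu> = k - 1" if "e = 1" using that by (auto simp: e_def \<mu>_def min_def split: if_splits)
      then have "k = t + 2" if "e = 1" "\<not> t + 2 \<le> \<mu>" using that mu by simp
      then show thesis using h e(2) by blast
    qed
    then show ?thesis
    proof cases
      case 1
      have "Q ^ Suc (\<mu> - t) * \<phi> k \<mu> \<le> \<phi> k t" using mu k by (intro phi_Q) auto
      then show ?thesis using main' unfolding 1 power_0 mult_1 by (rule order_trans[rotated])
    next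
      case 2
      have "(t + 1) ^ e * (Q ^ Suc (\<mu> - t) * \<phi> k \<mu>) \<le> Q * (Q ^ Suc (\<mu> - t) * \<phi> k \<mu>)"
        using te tQ by (intro mult_le_mono1) simp
      also have "\<dots> = Q ^ Suc (Suc (\<mu> - t)) * \<phi> k \<mu>" by simp
      also have "\<dots> \<le> \<phi> k t" using 2 mu k by (intro phi_Q) auto
      finally show ?thesis using main' by (rule order_trans[rotated])
    next
      \<comment> \<open>Covers of full size for k = t + 2: no further level exists,
        \<open>\<phi> k \<mu>\<close> is 1, and the size of \<open>Stirling N 2\<close> has to pay
        for everything.\<close>
      case 3
      then have mu1: "\<mu> = t + 1" using mu by simp
      have "n - (t + 1) = Suc (n - (t + 2))" using N_ge by simp
      then have p1: "\<phi> k \<mu> = 1" unfolding \<phi>_def mu1 3 by (simp del: Stirling.simps)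
      have "(t + 1) ^ e * (Q ^ Suc (\<mu> - t) * \<phi> k \<mu>) = (t + 1) * Q\<^sup>2"
        using 3 mu1 p1 by (simp add: power2_eq_square)
      also have "\<dots> \<le> (t + 1)\<^sup>2 * Q\<^sup>2" by (intro mult_le_mono1) (simp add: power2_eq_square)
      also have "\<dots> \<le> Stirling N 2" by (rule Stirling_2_large)
      also have "\<dots> = \<phi> k t" using 3 by (simp add: \<phi>_def N_def)
      finally show ?thesis using main' by (rule order_trans[rotated])
    qed
  qed
qed

text \<open>A cover with exactly t blocks would lie in every member, so both minimal covers have at
  least t + 1 blocks and each family can be branched up to the size of the cover of the
  other.\<close>

lemma no_common_bound:
  assumes kl: "t + 2 \<le> l" "l \<le> k" "k \<le> K"
    and FG: "FF \<subseteq> Pi_part n k" "GG \<subseteq> Pi_part n l" "cross_t_int t FF GG"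
    and ne: "FF \<noteq> {}" "GG \<noteq> {}"
    and no: "\<And>X. card X = t \<Longrightarrow> \<exists>F\<in>FF. \<not> X \<subseteq> F" "\<And>X. card X = t \<Longrightarrow> \<exists>G\<in>GG. \<not> X \<subseteq> G"
  shows "card FF * card GG \<le> \<phi> k (t + 1) * \<phi> l t"
proof -
  obtain F0 G0 where F0: "F0 \<in> FF" and G0: "G0 \<in> GG" using ne by auto
  note GF = cross_t_int_sym[OF FG(3)]
  obtain T1 where T1: "t_cover t FF T1" "card T1 \<le> l"
    "\<And>W. finite W \<Longrightarrow> card W < card T1 \<Longrightarrow> \<exists>F\<in>FF. card (W \<inter> F) < t"
    by (rule obtain_min_cover[OF FG(2) G0 GF]) (rule that)
  obtain T2 where T2: "t_cover t GG T2" "card T2 \<le> k"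
    "\<And>W. finite W \<Longrightarrow> card W < card T2 \<Longrightarrow> \<exists>G\<in>GG. card (W \<inter> G) < t"
    by (rule obtain_min_cover[OF FG(1) F0 FG(3)]) (rule that)
  have large: "t + 1 \<le> card T" if T: "t_cover t HH T" "H0 \<in> HH"
    and no: "\<And>X. card X = t \<Longrightarrow> \<exists>F\<in>HH. \<not> X \<subseteq> F" for HH T H0
  proof -
    have fT: "finite T" using T by (simp add: t_cover_def)
    have "t \<le> card (T \<inter> H0)" using T by (simp add: t_cover_def)
    also have "\<dots> \<le> card T" using fT by (intro card_mono) auto
    finally have "t \<le> card T" .
    moreover have "card T \<noteq> t"
    proof
      assume c: "card T = t"
      then obtain F where F: "F \<in> HH" "\<not> T \<subseteq> F" using no by blast
      then have "card (T \<inter> F) < card T" using fT by (intro psubset_card_mono) auto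
      then show False using T F c by (auto simp: t_cover_def not_less[symmetric])
    qed
    ultimately show ?thesis by simp
  qed
  have m1: "t + 1 \<le> card T1" and m2: "t + 1 \<le> card T2"
    using large[OF T1(1) F0 no(1)] large[OF T2(1) G0 no(2)] by auto
  define m1 m2 where "m1 = min (card T1) (l - 1)" and "m2 = min (card T2) (k - 1)"
  have F: "card FF \<le> (card T1 choose t) * ((l - t + 1) ^ (m2 - t) * \<phi> k m2)"
  proof (rule t_cover_card[OF FG(1) T1(1)])
    fix X assume X: "X \<subseteq> T1" "card X = t"
    then have "finite X" using T1(1) by (auto simp: t_cover_def intro: finite_subset)
    then show "card {F \<in> FF. X \<subseteq> F} \<le> (l - t + 1) ^ (m2 - t) * \<phi> k m2" unfolding \<phi>_def
      using X T2 kl m2 by (intro extend_iterated[OF FG(1,3,2)]) (auto simp: m2_def)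
  qed
  have G: "card GG \<le> (card T2 choose t) * ((k - t + 1) ^ (m1 - t) * \<phi> l m1)"
  proof (rule t_cover_card[OF FG(2) T2(1)])
    fix X assume X: "X \<subseteq> T2" "card X = t"
    then have "finite X" using T2(1) by (auto simp: t_cover_def intro: finite_subset)
    then show "card {F \<in> GG. X \<subseteq> F} \<le> (k - t + 1) ^ (m1 - t) * \<phi> l m1" unfolding \<phi>_def
      using X T1 kl m1 by (intro extend_iterated[OF FG(2) GF FG(1)]) (auto simp: m1_def)
  qed
  \<comment> \<open>The binomial coefficients are exchanged between the two bounds. Each of
    \<open>A1\<close> and \<open>A2\<close> then depends on a single cover size, as
    \<open>cover_bound\<close> demands. For k at least t + 3, \<open>A1\<close> wins a factor Q and
    \<open>A2\<close> loses at most one.\<close>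
  define A1 A2 where "A1 = (card T1 choose t) * ((k - t + 1) ^ (m1 - t) * \<phi> l m1)"
    and "A2 = (card T2 choose t) * ((l - t + 1) ^ (m2 - t) * \<phi> k m2)"
  have A12: "card FF * card GG \<le> A2 * A1"
    using mult_le_mono[OF F G] unfolding A1_def A2_def by (simp only: mult_ac)
  have ka: "k - t \<le> a" "l - t \<le> a" "l \<le> K" using kl Kta by auto
  have A1Q: "Q * A1 \<le> \<phi> l t" unfolding A1_def m1_def
    using kl ka m1 T1(2) by (intro cover_bound(3)) auto
  show ?thesis
  proof (cases "t + 3 \<le> k")
    case True
    have "A2 \<le> Q * \<phi> k (t + 1)" unfolding A2_def m2_def
      using kl ka m2 T2(2) True by (intro cover_bound(2)) auto
    then have "A2 * A1 \<le> \<phi> k (t + 1) * (Q * A1)" by (metis mult.assoc mult.commute mult_le_mono1)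
    also have "\<dots> \<le> \<phi> k (t + 1) * \<phi> l t" using A1Q by (rule mult_le_mono2)
    finally show ?thesis using A12 by simp
  next
    case False
    then have k2: "k = t + 2" "l = t + 2" using kl by auto
    have one: "\<phi> (t + 2) (t + 1) = 1"
    proof -
      have "n - (t + 1) = Suc (n - (t + 2))" using N_ge by simp
      then show ?thesis by (simp add: \<phi>_def del: Stirling.simps)
    qed
    have "A2 \<le> (t + 1) * Q * \<phi> k (t + 1)" unfolding A2_def m2_def
      using kl ka m2 T2(2) by (intro cover_bound(1)) auto
    moreover have "A1 \<le> (t + 1) * Q * \<phi> l (t + 1)" unfolding A1_def m1_def
      using kl ka m1 T1(2) by (intro cover_bound(1)) auto
    ultimately have "A2 * A1 \<le> ((t + 1) * Q) * ((t + 1) * Q)" unfolding k2 one by (intro mult_le_mono) auto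
    also have "\<dots> = (t + 1)\<^sup>2 * Q\<^sup>2" by (simp only: power2_eq_square mult_ac)
    also have "\<dots> \<le> \<phi> l t" using Stirling_2_large by (simp add: k2 \<phi>_def N_def)
    finally show ?thesis using A12 unfolding k2 one by simp
  qed
qed

end

section \<open>Families with t common blocks\<close>

context large_ground_set
begin

text \<open>One block better than \<open>extend_block\<close> when G lacks a single block of X. With
  \<open>l - t\<close> instead of \<open>l - t + 1\<close> blocks the leading coefficient is that of
  the family A.\<close>

lemma obtain_blocks:
  assumes FF: "FF \<subseteq> Pi_part n k" "FF \<noteq> {}" "\<And>F. F \<in> FF \<Longrightarrow> X \<subseteq> F"
    and G: "G \<in> Pi_part n l" "\<And>F. F \<in> FF \<Longrightarrow> t \<le> card (F \<inter> G)"
    and X: "finite X" "card X = t" "x \<in> X" "X \<inter> G = X - {x}"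
  obtains M where "M \<subseteq> G" "M \<inter> X = {}" "card M = l - t" "FF \<subseteq> (\<Union>B\<in>M. {F \<in> FF. insert B X \<subseteq> F})"
proof -
  have finG: "finite G" "card G = l" using Pi_part_finite[OF G(1)] Pi_part_card[OF G(1)] by auto
  have cX: "card (X \<inter> G) = t - 1" using X by simp
  obtain F0 where F0: "F0 \<in> FF" using FF(2) by auto
  have "x \<in> F0" "F0 \<in> Pi_part n k" using F0 FF X(3) by auto
  then have "x \<noteq> {}" "x \<subseteq> {1..n}"
    using Pi_part_nonempty[of F0 n k x] Pi_part_Union[of F0 n k] by auto
  then obtain y where y: "y \<in> x" "y \<in> {1..n}" by blast
  then obtain Z where Z: "y \<in> Z" "Z \<in> G" using Pi_part_Union[OF G(1)] by blast
  have Zx: "Z \<noteq> x" using Z X by auto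
  \<comment> \<open>of the \<open>l - t + 1\<close> blocks of G outside X, the block Z meets x and is therefore useless\<close>
  have ZF: "Z \<notin> F" if "F \<in> FF" for F
    using Pi_part_disjoint[of F n k Z x] that FF(1) FF(3)[of F] X(3) y Z Zx by auto
  have ZX: "Z \<notin> X" using ZF[OF F0] FF(3)[OF F0] by auto
  show ?thesis
  proof (rule that[of "G - X - {Z}"])
    have "card (G - X) = l - (t - 1)"
      using card_Diff_subset_Int[of G X] X(1) finG cX by (simp add: Int_commute)
    then show "card (G - X - {Z}) = l - t" using Z ZX finG X by (cases t) auto
    show "FF \<subseteq> (\<Union>B\<in>G - X - {Z}. {F \<in> FF. insert B X \<subseteq> F})"
    proof
      fix F assume F: "F \<in> FF"
      have "\<exists>B\<in>F \<inter> G. B \<notin> X"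
      proof (rule ccontr)
        assume "\<not> ?thesis"
        then have "card (F \<inter> G) \<le> card (X \<inter> G)" using X(1) by (intro card_mono) auto
        moreover have "1 \<le> t" using X by (metis One_nat_def Suc_leI card_gt_0_iff empty_iff)
        ultimately show False using G(2)[OF F] cX by simp
      qed
      then show "F \<in> (\<Union>B\<in>G - X - {Z}. {F \<in> FF. insert B X \<subseteq> F})"
        using F ZF[OF F] FF(3)[OF F] by auto
    qed
  qed auto
qed

lemma Q_sq_t: "4 * (t * ((a + 1) * (a + 1))) \<le> Q\<^sup>2"
proof -
  have "real (4 * t) \<le> real ((t + 1) * (t + 1))" using sum_squares_bound[of "real t" 1]
    by (simp add: power2_eq_square algebra_simps)
  then have "4 * t \<le> (t + 1) * (t + 1)" unfolding of_nat_le_iff .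
  then have "(4 * t) * ((a + 1) * (a + 1)) \<le> ((t + 1) * (t + 1)) * ((a + 1) * (a + 1))" by (rule mult_le_mono1)
  also have "\<dots> = Q\<^sup>2" by (simp only: Q_def power2_eq_square mult_ac)
  finally show ?thesis by (simp only: mult.assoc)
qed

definition singletons :: "nat set set \<Rightarrow> bool" where
  "singletons M \<longleftrightarrow> (\<forall>B\<in>M. card B = 1 \<and> B \<subseteq> {1..n})"

section \<open>Pairs whose first family shares t blocks, with no order between \<open>k\<close> and
  \<open>l\<close>\<close>

context
  fixes k l :: nat and FF GG :: "nat set set set" and X G0 :: "nat set set" and q :: nat
  assumes k: "t + 3 \<le> k" "k \<le> K" and l: "t + 2 \<le> l" "l \<le> K" and q: "l = t + q"
    and FF: "FF \<subseteq> Pi_part n k" and GG: "GG \<subseteq> Pi_part n l" and cr: "cross_t_int t FF GG"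
    and X: "card X = t" "\<And>F. F \<in> FF \<Longrightarrow> X \<subseteq> F" and ne: "FF \<noteq> {}"
    and G0: "G0 \<in> GG" "\<not> X \<subseteq> G0"
begin

lemma q_bounds: "2 \<le> q" "q \<le> a" using l q Kta by auto

lemma finX: "finite X" using X(1) t1 by (metis card.infinite not_one_le_zero)

lemma FF_X: "{F \<in> FF. X \<subseteq> F} = FF" using X(2) by auto

lemma f_ratio: "Q\<^sup>2 * \<phi> k (t + 2) \<le> \<phi> k (t + 1)" and g_ratio: "Q\<^sup>2 * \<phi> l (t + 1) \<le> \<phi> l t"
  using phi_ratio[of "t + 1" k] phi_ratio[of t l] k l by (simp_all add: eval_nat_numeral)

lemma g_large: "Q\<^sup>2 \<le> \<phi> l t"
proof -
  have "Q\<^sup>2 * 1 \<le> Q\<^sup>2 * \<phi> l (t + 1)" using phi_pos[of "t + 1" l] l by (intro mult_le_mono2) auto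
  then show ?thesis using g_ratio by linarith
qed

lemma cr': "F \<in> FF \<Longrightarrow> G \<in> GG \<Longrightarrow> t \<le> card (F \<inter> G)"
  using cr by (simp add: cross_t_int_def)

text \<open>A loss of one third suffices because the extremal products lose at most one quarter
  (\<open>Afam_low\<close>, \<open>Dfam_low\<close>). The value one third is what remains in the
  tightest case, a block of M that is not a singleton.\<close>

abbreviation small where
  "small \<equiv> 3 * (card FF * card GG) + \<phi> k (t + 1) * \<phi> l t \<le> 3 * (max q (t + 1) * (\<phi> k (t + 1) * \<phi> l t))"

lemma G_X: "card {G \<in> GG. X \<subseteq> G} \<le> \<phi> l t"
  using sub_containing_le[OF GG, of X] finX X l by (simp add: \<phi>_def)

text \<open>A cover of \<open>GG\<close> with at most t + 1 blocks would bound
  \<open>card GG\<close> by \<open>(t + 1) * \<phi> l t\<close>. So the minimal cover has at least t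
  + 2 blocks, and \<open>FF\<close> can be branched from X up to that size.\<close>

lemma large_cover_small:
  assumes "\<not> card GG \<le> (t + 1) * \<phi> l t" shows small
proof -
  obtain F0 where F0: "F0 \<in> FF" using ne by auto
  obtain T where T: "t_cover t GG T" "card T \<le> k"
    "\<And>W. finite W \<Longrightarrow> card W < card T \<Longrightarrow> \<exists>G\<in>GG. card (W \<inter> G) < t"
    by (rule obtain_min_cover[OF FF F0 cr]) (rule that)
  define m \<mu> where "m = card T" and "\<mu> = min m (k - 1)"
  have fT: "finite T" using T(1) by (simp add: t_cover_def)
  have G: "card GG \<le> (m choose t) * \<phi> l t" unfolding m_def
  proof (rule t_cover_card[OF GG T(1)])
    fix Y assume "Y \<subseteq> T" "card Y = t"
    then show "card {F \<in> GG. Y \<subseteq> F} \<le> \<phi> l t"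
      using sub_containing_le[OF GG, of Y] l finite_subset[OF _ fT] by (simp add: \<phi>_def)
  qed
  have m: "t + 2 \<le> m"
  proof (rule ccontr)
    assume "\<not> t + 2 \<le> m"
    then have "m < t \<or> m = t \<or> m = t + 1" by auto
    then have "m choose t \<le> t + 1" by (auto simp: binomial_eq_0)
    then have "(m choose t) * \<phi> l t \<le> (t + 1) * \<phi> l t" by (rule mult_le_mono1)
    then show False using G assms by simp
  qed
  have "card {F \<in> FF. X \<subseteq> F} \<le> (l - t + 1) ^ (\<mu> - t) * Stirling (n - \<mu>) (k - \<mu>)"
    using m k T(3) finX X(1) by (intro extend_iterated[OF FF cr GG]) (auto simp: \<mu>_def m_def)
  then have F: "card FF \<le> (q + 1) ^ (\<mu> - t) * \<phi> k \<mu>" unfolding FF_X q by (simp add: \<phi>_def)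
  have "4 * (card FF * card GG) \<le> 4 * (((q + 1) ^ (\<mu> - t) * \<phi> k \<mu>) * ((m choose t) * \<phi> l t))"
    using mult_le_mono[OF F G] by simp
  also have "\<dots> = (4 * ((m choose t) * ((q + 1) ^ (\<mu> - t) * \<phi> k \<mu>))) * \<phi> l t" by (simp only: mult_ac)
  also have "\<dots> \<le> (3 * (t + 1) * \<phi> k (t + 1)) * \<phi> l t"
    using k q_bounds m T(2) unfolding \<mu>_def by (intro mult_le_mono1 large_cover_bound) (auto simp: m_def)
  also have "\<dots> = 3 * ((t + 1) * (\<phi> k (t + 1) * \<phi> l t))" by (simp only: mult_ac)
  finally have 1: "4 * (card FF * card GG) \<le> 3 * ((t + 1) * (\<phi> k (t + 1) * \<phi> l t))" .
  have 2: "2 * (\<phi> k (t + 1) * \<phi> l t) \<le> (t + 1) * (\<phi> k (t + 1) * \<phi> l t)"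
    using t1 by (intro mult_le_mono1) simp
  have 3: "(t + 1) * (\<phi> k (t + 1) * \<phi> l t) \<le> max q (t + 1) * (\<phi> k (t + 1) * \<phi> l t)"
    by (intro mult_le_mono1) simp
  show ?thesis using 1 2 3 by linarith
qed

text \<open>The cost of two branchings and of the bound on \<open>GG\<close> is
  \<open>(t + 1) * (q + 1)^2\<close>, at most half of \<open>Q^2\<close>, which is the gain from
  level t + 1 to level t + 2.\<close>

lemma few_F_small:
  assumes G: "card GG \<le> (t + 1) * \<phi> l t" and F: "card FF \<le> (q + 1) * ((q + 1) * \<phi> k (t + 2))"
  shows small
proof -
  have "2 * ((t + 1) * ((q + 1) * (q + 1))) \<le> (t + 1) * ((t + 1) * ((a + 1) * (a + 1)))"
  proof -
    have "2 * ((q + 1) * (q + 1)) \<le> (t + 1) * ((a + 1) * (a + 1))"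
      using t1 q_bounds by (intro mult_le_mono) auto
    then show ?thesis unfolding mult.left_commute[of 2] by (rule mult_le_mono2)
  qed
  also have "\<dots> = Q\<^sup>2" by (simp only: Q_def power2_eq_square mult_ac)
  finally have c: "2 * ((t + 1) * ((q + 1) * (q + 1))) \<le> Q\<^sup>2" .
  have "2 * (card FF * card GG) \<le> 2 * (((q + 1) * ((q + 1) * \<phi> k (t + 2))) * ((t + 1) * \<phi> l t))"
    using mult_le_mono[OF F G] by simp
  also have "\<dots> = (2 * ((t + 1) * ((q + 1) * (q + 1)))) * (\<phi> k (t + 2) * \<phi> l t)" by (simp only: mult_ac)
  also have "\<dots> \<le> Q\<^sup>2 * (\<phi> k (t + 2) * \<phi> l t)" using c by (rule mult_le_mono1)
  also have "\<dots> = (Q\<^sup>2 * \<phi> k (t + 2)) * \<phi> l t" by (simp only: mult_ac)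
  also have "\<dots> \<le> \<phi> k (t + 1) * \<phi> l t" using f_ratio by (rule mult_le_mono1)
  finally have 1: "2 * (card FF * card GG) \<le> \<phi> k (t + 1) * \<phi> l t" .
  have "2 * (\<phi> k (t + 1) * \<phi> l t) \<le> max q (t + 1) * (\<phi> k (t + 1) * \<phi> l t)"
    using t1 by (intro mult_le_mono1) auto
  then show ?thesis using 1 by linarith
qed

text \<open>After one block is added to X, the result still meets \<open>G1\<close> in fewer than t
  blocks, so the same member serves for a second branching.\<close>

lemma far_member_small:
  assumes G: "card GG \<le> (t + 1) * \<phi> l t" and G1: "G1 \<in> GG" "card (X \<inter> G1) + 2 \<le> t"
  shows small
proof (rule few_F_small[OF G])
  have "card {F \<in> FF. X \<subseteq> F} \<le> (l - t + 1) * ((q + 1) * \<phi> k (t + 2))"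
  proof (rule extend_card[OF FF cr G1(1) GG finX])
    show "card (X \<inter> G1) < t" using G1 by simp
    fix B assume B: "B \<in> G1 - X"
    have "card (insert B X \<inter> G1) \<le> card (insert B (X \<inter> G1))" using finX by (intro card_mono) auto
    also have "\<dots> \<le> card (X \<inter> G1) + 1" using finX by (simp add: card_insert_if)
    finally have c: "card (insert B X \<inter> G1) < t" using G1 by simp
    have c2: "card (insert B X) = t + 1" using B finX X by simp
    have "card {F \<in> FF. insert B X \<subseteq> F} \<le> (l - t + 1) * Stirling (n - (card (insert B X) + 1)) (k - (card (insert B X) + 1))"
      using c c2 finX k by (intro extend_once[OF FF cr G1(1) GG]) auto
    then show "card {F \<in> FF. insert B X \<subseteq> F} \<le> (q + 1) * \<phi> k (t + 2)"
      unfolding c2 by (simp add: \<phi>_def q)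
  qed
  then show "card FF \<le> (q + 1) * ((q + 1) * \<phi> k (t + 2))" unfolding FF_X by (simp add: q)
qed



lemma not_in_X_small:
  assumes G1: "G1 \<in> GG" "B \<notin> X" "card (insert B X \<inter> G1) < t"
  shows "card {F \<in> FF. insert B X \<subseteq> F} \<le> (q + 1) * \<phi> k (t + 2)"
proof -
  have c2: "card (insert B X) = t + 1" using G1 finX X by simp
  have "card {F \<in> FF. insert B X \<subseteq> F} \<le> (l - t + 1) * Stirling (n - (card (insert B X) + 1)) (k - (card (insert B X) + 1))"
    using G1 c2 finX k by (intro extend_once[OF FF cr G1(1) GG]) auto
  then show ?thesis unfolding c2 by (simp add: \<phi>_def q)
qed

lemma one_more_le: "B \<notin> X \<Longrightarrow> card {F \<in> FF. insert B X \<subseteq> F} \<le> \<phi> k (t + 1)"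
  using sub_containing_le[OF FF, of "insert B X"] finX X k by (simp add: \<phi>_def)

lemma one_more_le_half:
  assumes "B \<notin> X" "C \<in> insert B X" "card C \<noteq> 1"
  shows "2 * card {F \<in> FF. insert B X \<subseteq> F} \<le> \<phi> k (t + 1)"
proof -
  have c: "card (insert B X) = t + 1" using assms finX X by simp
  have "2 * card {F \<in> FF. insert B X \<subseteq> F} \<le> 2 * card {F \<in> Pi_part n k. insert B X \<subseteq> F}"
    using FF by (intro mult_le_mono2 card_mono) auto
  also have "\<dots> \<le> \<phi> k (t + 1)"
    using card_containing_le_half[of "insert B X" k C n] assms finX c k N_ge unfolding c by (simp add: \<phi>_def)
  finally show ?thesis .
qed

lemma block_subset: "F \<in> FF \<Longrightarrow> B \<in> F \<Longrightarrow> B \<subseteq> {1..n}"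
  using FF Pi_part_Union[of F n k] by auto

text \<open>With \<open>T = insert B X\<close> the pair has type (C, D) unless some G meets T in
  fewer than t blocks, which allows another branching, or T contains a block with several points,
  which halves \<open>FF\<close>.\<close>

lemma common_extra_block:
  assumes G: "card GG \<le> (t + 1) * \<phi> l t" and B: "B \<notin> X" "\<And>F. F \<in> FF \<Longrightarrow> B \<in> F"
  shows "small \<or> (\<exists>T. card T = t + 1 \<and> singletons T \<and> FF \<subseteq> CT n k T \<and> GG \<subseteq> DT n t l T)"
proof -
  define T where "T = insert B X"
  have FT: "{F \<in> FF. insert B X \<subseteq> F} = FF" using X(2) B(2) by auto
  have cT: "card T = t + 1" using B finX X by (simp add: T_def)
  consider G1 where "G1 \<in> GG" "card (T \<inter> G1) < t"
    | C where "C \<in> T" "card C \<noteq> 1"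
    | "\<forall>G\<in>GG. t \<le> card (T \<inter> G)" "\<forall>C\<in>T. card C = 1"
    by (meson not_less)
  then show ?thesis
  proof cases
    case 1
    have "card FF \<le> (q + 1) * \<phi> k (t + 2)"
      using not_in_X_small[of G1 B] 1 B unfolding FT T_def by simp
    also have "\<dots> \<le> (q + 1) * ((q + 1) * \<phi> k (t + 2))" by (intro mult_le_mono2) simp
    finally show ?thesis using few_F_small[OF G] by simp
  next
    case 2
    have F: "2 * card FF \<le> \<phi> k (t + 1)" using one_more_le_half[of B C] 2 B unfolding FT T_def by simp
    have 1: "2 * (card FF * card GG) \<le> (t + 1) * (\<phi> k (t + 1) * \<phi> l t)"
      using mult_le_mono[OF F G] by (simp only: mult_ac)
    have 2: "2 * (\<phi> k (t + 1) * \<phi> l t) \<le> (t + 1) * (\<phi> k (t + 1) * \<phi> l t)"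
      using t1 by (intro mult_le_mono1) simp
    have 3: "(t + 1) * (\<phi> k (t + 1) * \<phi> l t) \<le> max q (t + 1) * (\<phi> k (t + 1) * \<phi> l t)"
      by (intro mult_le_mono1) simp
    show ?thesis using 1 2 3 by linarith
  next
    case 3
    obtain F where "F \<in> FF" using ne by auto
    then have "C \<subseteq> {1..n}" if "C \<in> T" for C
      using that X(2) B(2) block_subset[of F C] by (auto simp: T_def)
    then have "singletons T" unfolding singletons_def using 3(2) by blast
    moreover have "FF \<subseteq> CT n k T" using FF X(2) B(2) by (auto simp: CT_def T_def)
    moreover have "GG \<subseteq> DT n t l T" using GG 3(1) by (auto simp: DT_def)
    ultimately show ?thesis using cT by blast
  qed
qed

lemma generic_case:
  assumes G: "card GG \<le> (t + 1) * \<phi> l t"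
    and near: "\<And>G. G \<in> GG \<Longrightarrow> t \<le> card (X \<inter> G) + 1"
    and noB: "\<And>B. B \<notin> X \<Longrightarrow> \<exists>F\<in>FF. B \<notin> F"
  shows "small \<or> (\<exists>M. X \<subseteq> M \<and> card M = l \<and> singletons M \<and> FF \<subseteq> AX n k X M \<and> GG \<subseteq> BX n l X M)"
proof -
  define Gp where "Gp = {G \<in> GG. \<not> X \<subseteq> G}"
  have finGG: "finite GG" using GG by (rule finite_subfam)
  have finG: "finite G" "card G = l" if "G \<in> GG" for G
    using that GG Pi_part_finite[of G n l] Pi_part_card[of G n l] by auto
  have miss: "\<exists>x\<in>X. X \<inter> G = X - {x}" if "G \<in> Gp" for G
    using that near[of G] finX X(1) by (intro Int_eq_Diff_singleton) (auto simp: Gp_def)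
  have cX: "card (X \<inter> G) = t - 1" if "G \<in> Gp" for G
    using miss[OF that] X finX by auto
  have G0p: "G0 \<in> Gp" using G0 by (simp add: Gp_def)
  obtain x0 where x0: "x0 \<in> X" "X \<inter> G0 = X - {x0}" using miss[OF G0p] by blast
  obtain F0 where F0: "F0 \<in> FF" using ne by auto
  have G0P: "G0 \<in> Pi_part n l" using G0(1) GG by auto
  obtain M' where M': "M' \<subseteq> G0" "M' \<inter> X = {}" "card M' = l - t"
    and cov: "FF \<subseteq> (\<Union>B\<in>M'. {F \<in> FF. insert B X \<subseteq> F})"
    by (rule obtain_blocks[OF FF ne X(2) G0P cr'[OF _ G0(1)] finX X(1) x0]) (auto intro: that)
  have finM': "finite M'" using M'(1) finG(1)[OF G0(1)] by (rule finite_subset)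
  have cM': "card M' = q" using M' q by simp
  have M'X: "B \<notin> X" if "B \<in> M'" for B using that M' by auto
  define FB where "FB B = {F \<in> FF. insert B X \<subseteq> F}" for B
  have finFF: "finite FF" using FF by (rule finite_subfam)
  have cover: "FF \<subseteq> (\<Union>B\<in>M'. FB B)" using cov unfolding FB_def .
  have F_sum: "card FF \<le> (\<Sum>B\<in>M'. card (FB B))"
  proof -
    have "card FF \<le> card (\<Union>B\<in>M'. FB B)"
      using cover finFF finM' by (intro card_mono) (auto simp: FB_def)
    also have "\<dots> \<le> (\<Sum>B\<in>M'. card (FB B))" by (rule card_UN_le[OF finM'])
    finally show ?thesis .
  qed
  have FB_le: "card (FB B) \<le> \<phi> k (t + 1)" if "B \<in> M'" for B
    unfolding FB_def using one_more_le M'X[OF that] by blast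
  define H where "H = {B \<in> M'. (q + 1) * \<phi> k (t + 2) < card (FB B)}"
  have heavy: "B \<in> G" if "B \<in> H" "G \<in> Gp" for B G
  proof (rule ccontr)
    assume "B \<notin> G"
    then have "insert B X \<inter> G = X \<inter> G" by auto
    then have "card (insert B X \<inter> G) < t" using cX[OF that(2)] t1 by simp
    then have "card (FB B) \<le> (q + 1) * \<phi> k (t + 2)" unfolding FB_def
      using that M'X by (intro not_in_X_small[of G]) (auto simp: Gp_def H_def)
    then show False using that by (simp add: H_def)
  qed
  have GGp: "card GG \<le> \<phi> l t + card Gp"
  proof -
    have "GG = {G \<in> GG. X \<subseteq> G} \<union> Gp" by (auto simp: Gp_def)
    then have "card GG \<le> card {G \<in> GG. X \<subseteq> G} + card Gp" by (metis card_Un_le)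
    then show ?thesis using G_X by simp
  qed
  have fp: "1 \<le> \<phi> k (t + 1)" using phi_pos[of "t + 1" k] k by simp
  show ?thesis
  proof (cases "H = M'")
    case True
    define M where "M = X \<union> M'"
    \<comment> \<open>M is not given as part of one partition. A block of X and a heavy block occur
      together in some F, as heavy blocks have positive count; two blocks of \<open>M'\<close> occur
      together in \<open>G0\<close>.\<close>
    have M_disj: "A \<inter> B = {}" if "A \<in> M" "B \<in> M" "A \<noteq> B" for A B
    proof -
      have *: "A \<inter> B = {}" if "A \<in> X" "B \<in> M" "A \<noteq> B" for A B
      proof -
        have "\<exists>F\<in>FF. A \<in> F \<and> B \<in> F"
        proof (cases "B \<in> X")
          case False
          then have "B \<in> H" using that True by (simp add: M_def)
          then have "0 < card (FB B)" by (simp add: H_def)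
          then obtain F where "F \<in> FB B" by (metis all_not_in_conv card.empty less_irrefl)
          then show ?thesis using that by (auto simp: FB_def)
        qed (use F0 X(2)[OF F0] that in auto)
        then show ?thesis using Pi_part_disjoint[of _ n k A B] FF that by blast
      qed
      have "A \<inter> B = {}" if "A \<in> M'" "B \<in> M'" "A \<noteq> B" for A B
        using Pi_part_disjoint[OF G0P, of A B] that M'(1) by auto
      then show ?thesis using that * by (metis Int_commute M_def UnE)
    qed
    have XM': "X \<inter> M' = {}" using M'X by auto
    have cM: "card M = l" using card_Un_disjoint[OF finX finM' XM'] cM' X q by (simp add: M_def)
    have finM: "finite M" using finX finM' by (simp add: M_def)
    define ex where "ex x = (M - {x}) \<union> {x \<union> ({1..n} - \<Union>M)}" for x
    \<comment> \<open>G contains all heavy blocks and all of X except x, that is l - 1 of its l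
      blocks. The last block is the complement of their union, which is the exceptional member of B
      attached to x.\<close>
    have Gp_form: "G \<in> ex ` X" if Gp: "G \<in> Gp" for G
    proof -
      have GP: "G \<in> Pi_part n l" using Gp GG by (auto simp: Gp_def)
      obtain x where x: "x \<in> X" "X \<inter> G = X - {x}" using miss[OF Gp] by blast
      have sub: "M - {x} \<subseteq> G" using x heavy[OF _ Gp] True by (auto simp: M_def)
      have "card (M - {x}) = l - 1" using x cM finM by (simp add: M_def)
      moreover have "finite G" "card G = l" using Pi_part_finite[OF GP] Pi_part_card[OF GP] by auto
      ultimately have "card (G - (M - {x})) = 1" using sub finM l
        by (subst card_Diff_subset) auto
      then obtain C where C: "G - (M - {x}) = {C}" by (auto simp: card_1_singleton_iff)
      then have GC: "G = (M - {x}) \<union> {C}" "C \<notin> M - {x}" using sub by auto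
      have "C \<inter> \<Union>(M - {x}) = {}"
      proof (rule ccontr)
        assume "C \<inter> \<Union>(M - {x}) \<noteq> {}"
        then obtain D where D: "D \<in> M - {x}" "C \<inter> D \<noteq> {}" by auto
        then show False using Pi_part_disjoint[OF GP, of C D] GC by auto
      qed
      moreover have "\<Union>(M - {x}) \<union> C = {1..n}" using Pi_part_Union[OF GP] GC by auto
      ultimately have "C = {1..n} - \<Union>(M - {x})" by blast
      also have "\<dots> = x \<union> ({1..n} - \<Union>M)"
      proof -
        have "x \<in> M" using x by (simp add: M_def)
        have "x \<subseteq> {1..n}" using block_subset[OF F0] x X(2)[OF F0] by auto
        moreover have "x \<inter> \<Union>(M - {x}) = {}" using M_disj[OF \<open>x \<in> M\<close>] by auto
        moreover have "\<Union>M = \<Union>(M - {x}) \<union> x" using \<open>x \<in> M\<close> by auto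
        ultimately show ?thesis by blast
      qed
      finally show ?thesis using GC x by (auto simp: ex_def)
    qed
    have cGp: "card Gp \<le> t"
    proof -
      have "card Gp \<le> card (ex ` X)" using Gp_form finX by (intro card_mono) auto
      also have "\<dots> \<le> card X" by (rule card_image_le[OF finX])
      finally show ?thesis using X by simp
    qed
    show ?thesis
    proof (cases "\<forall>B\<in>M. card B = 1")
      case True
      have "B \<subseteq> {1..n}" if "B \<in> M" for B
        using that block_subset[OF F0, of B] X(2)[OF F0] Pi_part_Union[OF G0P] M'(1)
        by (auto simp: M_def)
      then have "singletons M" using True by (simp add: singletons_def)
      moreover have "FF \<subseteq> AX n k X M"
        using FF cover by (fastforce simp: AX_def FB_def M_def dest: M'X)
      moreover have "GG \<subseteq> BX n l X M"
      proof
        fix G assume "G \<in> GG"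
        then show "G \<in> BX n l X M" using Gp_form[of G] GG
          by (cases "X \<subseteq> G") (auto simp: BX_def Gp_def ex_def)
      qed
      ultimately show ?thesis using cM by (auto simp: M_def)
    next
      case False
      then obtain C where C: "C \<in> M" "card C \<noteq> 1" by auto
      \<comment> \<open>A block C with several points in X halves every \<open>FB B\<close>. If C
        lies in \<open>M'\<close>, only \<open>FB C\<close> is halved; this is the smaller loss and
        it gives the bound.\<close>
      have "2 * card FF \<le> (2 * q - 1) * \<phi> k (t + 1)"
      proof (cases "C \<in> X")
        case True
        have "2 * card FF \<le> (\<Sum>B\<in>M'. 2 * card (FB B))" using F_sum by (simp add: sum_distrib_left[symmetric])
        also have "\<dots> \<le> (\<Sum>B\<in>M'. \<phi> k (t + 1))"
          unfolding FB_def using True C M'X by (intro sum_mono one_more_le_half) auto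
        also have "\<dots> = q * \<phi> k (t + 1)" using cM' by simp
        also have "\<dots> \<le> (2 * q - 1) * \<phi> k (t + 1)" using q_bounds by (intro mult_le_mono1) simp
        finally show ?thesis .
      next
        case False
        then have CM: "C \<in> M'" using C by (simp add: M_def)
        have "2 * card FF \<le> 2 * (\<Sum>B\<in>M'. card (FB B))" using F_sum by simp
        also have "\<dots> = 2 * card (FB C) + 2 * (\<Sum>B\<in>M' - {C}. card (FB B))"
          by (subst sum.remove[OF finM' CM]) simp
        also have "\<dots> \<le> \<phi> k (t + 1) + 2 * (\<Sum>B\<in>M' - {C}. \<phi> k (t + 1))"
          using C CM FB_le M'X one_more_le_half[of C C]
          by (intro add_mono mult_le_mono2 sum_mono) (auto simp: FB_def)
        also have "\<dots> = (2 * q - 1) * \<phi> k (t + 1)"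
        proof -
          have "card (M' - {C}) = q - 1" using cM' CM finM' by simp
          then have "\<phi> k (t + 1) + 2 * (\<Sum>B\<in>M' - {C}. \<phi> k (t + 1)) = (1 + 2 * (q - 1)) * \<phi> k (t + 1)" by simp
          also have "1 + 2 * (q - 1) = 2 * q - 1" using q_bounds by simp
          finally show ?thesis .
        qed
        finally show ?thesis .
      qed
      moreover have "card GG \<le> \<phi> l t + t" using GGp cGp by simp
      ultimately have "(2 * card FF) * card GG \<le> ((2 * q - 1) * \<phi> k (t + 1)) * (\<phi> l t + t)" by (rule mult_le_mono)
      then have 1: "2 * (card FF * card GG) + \<phi> k (t + 1) * (\<phi> l t + t) \<le> 2 * (q * (\<phi> k (t + 1) * (\<phi> l t + t)))"
      proof -
        obtain q' where "q = Suc q'" using q_bounds by (cases q) auto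
        then show ?thesis using \<open>(2 * card FF) * card GG \<le> _\<close> by (simp add: algebra_simps)
      qed
      \<comment> \<open>The at most t members of \<open>Gp\<close> cost at most one sixth of a unit.
        Of the half unit lost to C one third remains.\<close>
      have "6 * (q * t) \<le> 4 * (t * ((a + 1) * (a + 1)))"
      proof -
        have "6 * q \<le> 4 * ((a + 1) * (a + 1))"
          using q_bounds mult_le_mono[of q "a + 1" 2 "a + 1"] by simp
        then have "t * (6 * q) \<le> t * (4 * ((a + 1) * (a + 1)))" by (rule mult_le_mono2)
        then show ?thesis by (simp only: mult_ac)
      qed
      also have "\<dots> \<le> \<phi> l t" using Q_sq_t g_large by simp
      finally have "\<phi> k (t + 1) * (6 * (q * t)) \<le> \<phi> k (t + 1) * \<phi> l t" by (rule mult_le_mono2)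
      then have 2: "6 * (q * (\<phi> k (t + 1) * t)) \<le> \<phi> k (t + 1) * \<phi> l t" by (simp only: mult_ac)
      have 3: "q * (\<phi> k (t + 1) * \<phi> l t) \<le> max q (t + 1) * (\<phi> k (t + 1) * \<phi> l t)"
        by (intro mult_le_mono1) simp
      have e: "q * (\<phi> k (t + 1) * (\<phi> l t + t)) = q * (\<phi> k (t + 1) * \<phi> l t) + q * (\<phi> k (t + 1) * t)"
        "\<phi> k (t + 1) * (\<phi> l t + t) = \<phi> k (t + 1) * \<phi> l t + \<phi> k (t + 1) * t"
        by (simp_all only: distrib_left)
      define U W where "U = \<phi> k (t + 1) * \<phi> l t" and "W = \<phi> k (t + 1) * t"
      have "6 * (card FF * card GG) + 3 * U \<le> 6 * (q * U) + 6 * (q * W)"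
        using 1 unfolding e U_def[symmetric] W_def[symmetric] by (simp add: distrib_left)
      moreover have "6 * (q * W) \<le> U" using 2 unfolding U_def W_def .
      ultimately have "3 * (card FF * card GG) + U \<le> 3 * (q * U)" by linarith
      also have "\<dots> \<le> 3 * (max q (t + 1) * U)" using 3 unfolding U_def by (rule mult_le_mono2)
      finally have small unfolding U_def .
      then show ?thesis by simp
    qed
  next
    case False
    have HM: "H \<subseteq> M'" by (auto simp: H_def)
    then have cH: "card H < q" using False finM' cM' psubset_card_mono[of M' H] by auto
    have finH: "finite H" using HM finM' by (rule finite_subset)
    \<comment> \<open>At least one of the q blocks is light, so a full unit is lost. By
      \<open>r1\<close> below, all light blocks together win back at most a quarter of it.\<close>
    have F1: "card FF \<le> card H * \<phi> k (t + 1) + q * ((q + 1) * \<phi> k (t + 2))"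
    proof -
      have "(\<Sum>B\<in>M'. card (FB B)) = (\<Sum>B\<in>M' - H. card (FB B)) + (\<Sum>B\<in>H. card (FB B))"
        by (rule sum.subset_diff[OF HM finM'])
      moreover have "(\<Sum>B\<in>H. card (FB B)) \<le> (\<Sum>B\<in>H. \<phi> k (t + 1))"
        using HM FB_le by (intro sum_mono) auto
      moreover have "(\<Sum>B\<in>M' - H. card (FB B)) \<le> (\<Sum>B\<in>M' - H. (q + 1) * \<phi> k (t + 2))"
        by (intro sum_mono) (auto simp: H_def)
      moreover have "card (M' - H) * ((q + 1) * \<phi> k (t + 2)) \<le> q * ((q + 1) * \<phi> k (t + 2))"
        using cM' card_mono[OF finM', of "M' - H"] by (intro mult_le_mono1) auto
      ultimately show ?thesis using F_sum unfolding sum_constant of_nat_id by linarith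
    qed
    show ?thesis
    proof (cases "H = {}")
      case True
      then have "card FF \<le> (q + 1) * ((q + 1) * \<phi> k (t + 2))" using F1 by simp
      then show ?thesis using few_F_small[OF G] by simp
    next
      case False
      then obtain B1 where B1: "B1 \<in> H" by auto
      have B1X: "B1 \<notin> X" using B1 M'X by (auto simp: H_def)
      obtain F1 where F1': "F1 \<in> FF" "B1 \<notin> F1" using noB[OF B1X] by auto
      have F1P: "F1 \<in> Pi_part n k" using F1' FF by auto
      have finF1: "finite F1" "card F1 = k" using Pi_part_finite[OF F1P] Pi_part_card[OF F1P] by auto
      have cF1X: "card (F1 - X) = k - t" using card_Diff_subset[of X F1] X(2)[OF F1'(1)] X(1) finX finF1 by simp
      \<comment> \<open>\<open>F1\<close> avoids the heavy block \<open>B1\<close>. A member of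
        \<open>Gp\<close> therefore contains \<open>B1\<close>, all but one block of X, and a block
        of \<open>F1\<close> outside X: t + 1 prescribed blocks with \<open>t * (k - t)\<close>
        choices.\<close>
      have "Gp \<subseteq> (\<Union>(x, B)\<in>X \<times> (F1 - X). {G \<in> GG. (X - {x}) \<union> {B1, B} \<subseteq> G})"
      proof
        fix G assume G: "G \<in> Gp"
        obtain x where x: "x \<in> X" "X \<inter> G = X - {x}" using miss[OF G] by blast
        have "\<exists>B\<in>F1 \<inter> G. B \<notin> X"
        proof (rule ccontr)
          assume "\<not> ?thesis"
          then have "card (F1 \<inter> G) \<le> card (X \<inter> G)" using finX by (intro card_mono) auto
          then show False using cr'[OF F1'(1), of G] cX[OF G] t1 G by (simp add: Gp_def)
        qed
        then obtain B where "B \<in> F1" "B \<in> G" "B \<notin> X" by auto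
        then show "G \<in> (\<Union>(x, B)\<in>X \<times> (F1 - X). {G \<in> GG. (X - {x}) \<union> {B1, B} \<subseteq> G})"
          using x G heavy[OF B1 G] by (auto simp: Gp_def)
      qed
      then have "card Gp \<le> card (\<Union>(x, B)\<in>X \<times> (F1 - X). {G \<in> GG. (X - {x}) \<union> {B1, B} \<subseteq> G})"
        using finGG finX finF1 by (intro card_mono) auto
      also have "\<dots> \<le> card (X \<times> (F1 - X)) * \<phi> l (t + 1)"
      proof (rule card_UN_bound)
        show "finite (X \<times> (F1 - X))" using finX finF1 by simp
        fix z assume "z \<in> X \<times> (F1 - X)"
        then obtain x B where z: "z = (x, B)" "x \<in> X" "B \<in> F1" "B \<notin> X" by auto
        have "B \<noteq> B1" using z F1' by auto
        then have "card ((X - {x}) \<union> {B1, B}) = t + 1"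
          using z B1X finX X t1 by (simp add: card_insert_if)
        then have "card {G \<in> GG. (X - {x}) \<union> {B1, B} \<subseteq> G} \<le> \<phi> l (t + 1)"
          using sub_containing_le[OF GG, of "(X - {x}) \<union> {B1, B}"] finX l by (simp add: \<phi>_def)
        then show "card (case z of (x, B) \<Rightarrow> {G \<in> GG. (X - {x}) \<union> {B1, B} \<subseteq> G}) \<le> \<phi> l (t + 1)"
          using z by simp
      qed
      also have "\<dots> = (t * (k - t)) * \<phi> l (t + 1)" using X cF1X by (simp add: card_cartesian_product)
      also have "\<dots> \<le> (t * a) * \<phi> l (t + 1)" using k Kta by (intro mult_le_mono1 mult_le_mono2) simp
      finally have cGp: "card Gp \<le> (t * a) * \<phi> l (t + 1)" .
      have r1: "4 * (q * ((q + 1) * \<phi> k (t + 2))) \<le> \<phi> k (t + 1)"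
      proof -
        have "4 * (q * (q + 1)) \<le> 4 * ((a + 1) * (a + 1))"
          using q_bounds by (intro mult_le_mono2 mult_le_mono) auto
        then have "4 * (q * (q + 1)) \<le> Q\<^sup>2" using Q_sq by simp
        then have "4 * (q * (q + 1)) * \<phi> k (t + 2) \<le> Q\<^sup>2 * \<phi> k (t + 2)" by (rule mult_le_mono1)
        then show ?thesis using f_ratio by (simp only: mult.assoc)
      qed
      have h: "card H + 1 \<le> q" using cH by simp
      have "4 * card FF \<le> (4 * card H + 1) * \<phi> k (t + 1)" using F1 r1 by (simp add: algebra_simps)
      also have "\<dots> \<le> (4 * q - 3) * \<phi> k (t + 1)" using h by (intro mult_le_mono1) simp
      finally have F4: "4 * card FF \<le> (4 * q - 3) * \<phi> k (t + 1)" .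
      have G4: "card GG \<le> \<phi> l t + t * a * \<phi> l (t + 1)" using GGp cGp by simp
      define U V where "U = \<phi> k (t + 1) * \<phi> l t" and "V = \<phi> k (t + 1) * (t * a * \<phi> l (t + 1))"
      have "(4 * card FF) * card GG \<le> ((4 * q - 3) * \<phi> k (t + 1)) * (\<phi> l t + t * a * \<phi> l (t + 1))"
        by (rule mult_le_mono[OF F4 G4])
      then have "4 * (card FF * card GG) \<le> (4 * q - 3) * (U + V)"
        unfolding U_def V_def distrib_left[symmetric] by (simp only: mult.assoc)
      then have 1: "4 * (card FF * card GG) + 3 * (U + V) \<le> 4 * (q * (U + V))"
      proof -
        obtain q' where "q = Suc q'" using q_bounds by (cases q) auto
        then show ?thesis using \<open>4 * (card FF * card GG) \<le> _\<close> by (simp add: algebra_simps)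
      qed
      have 2: "4 * (q * V) \<le> U"
      proof -
        have "4 * (q * (t * a)) \<le> 4 * (t * ((a + 1) * (a + 1)))"
        proof -
          have "q * a \<le> (a + 1) * (a + 1)" using q_bounds by (intro mult_le_mono) auto
          then have "4 * t * (q * a) \<le> 4 * t * ((a + 1) * (a + 1))" by (rule mult_le_mono2)
          then show ?thesis by (simp only: mult_ac)
        qed
        also have "\<dots> \<le> Q\<^sup>2" by (rule Q_sq_t)
        finally have "4 * (q * (t * a)) * \<phi> l (t + 1) \<le> Q\<^sup>2 * \<phi> l (t + 1)" by (rule mult_le_mono1)
        also have "\<dots> \<le> \<phi> l t" by (rule g_ratio)
        finally have "\<phi> k (t + 1) * (4 * (q * (t * a)) * \<phi> l (t + 1)) \<le> U" unfolding U_def by (rule mult_le_mono2)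
        then show ?thesis unfolding V_def by (simp only: mult_ac)
      qed
      have 3: "q * U \<le> max q (t + 1) * U" by (intro mult_le_mono1) simp
      have "small"
      proof -
        have "4 * (card FF * card GG) + 3 * U \<le> 4 * (q * U) + 4 * (q * V)"
          using 1 by (simp add: distrib_left)
        then have "4 * (card FF * card GG) + 2 * U \<le> 4 * (q * U)" using 2 by linarith
        then have "3 * (card FF * card GG) + U \<le> 3 * (q * U)" by linarith
        also have "\<dots> \<le> 3 * (max q (t + 1) * U)" using 3 by (rule mult_le_mono2)
        finally show ?thesis unfolding U_def .
      qed
      then show ?thesis by simp
    qed
  qed
qed

lemma common_case:
  "small
   \<or> (\<exists>M. X \<subseteq> M \<and> card M = l \<and> singletons M \<and> FF \<subseteq> AX n k X M \<and> GG \<subseteq> BX n l X M)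
   \<or> (\<exists>T. card T = t + 1 \<and> singletons T \<and> FF \<subseteq> CT n k T \<and> GG \<subseteq> DT n t l T)"
proof (cases "card GG \<le> (t + 1) * \<phi> l t")
  case True
  show ?thesis
  proof (cases "\<exists>G\<in>GG. card (X \<inter> G) + 2 \<le> t")
    case near: False
    show ?thesis
    proof (cases "\<exists>B. B \<notin> X \<and> (\<forall>F\<in>FF. B \<in> F)")
      case False
      have "t \<le> card (X \<inter> G) + 1" if "G \<in> GG" for G
        using near that by (rule_tac ccontr) (auto simp: not_le)
      then show ?thesis using generic_case[OF True] False by blast
    next
      case True': True
      then show ?thesis using common_extra_block[OF True] by blast
    qed
  next
    case far: True
    then show ?thesis using far_member_small[OF True] by blast
  qed
next
  case False
  then show ?thesis using large_cover_small by blast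
qed

end

end

section \<open>Partitions into t + 2 blocks\<close>

text \<open>The product expanded to second order: twice the second elementary symmetric sum is the
  squared sum minus the sum of squares. The second conjunct, its nonnegativity, is carried along for
  the induction.\<close>

lemma prod_ge_pairs:
  fixes w :: "'a \<Rightarrow> real"
  assumes "finite I" "\<And>i. i \<in> I \<Longrightarrow> 0 \<le> w i"
  shows "2 + 2 * sum w I + ((sum w I)\<^sup>2 - (\<Sum>i\<in>I. (w i)\<^sup>2)) \<le> 2 * (\<Prod>i\<in>I. 1 + w i)
    \<and> (\<Sum>i\<in>I. (w i)\<^sup>2) \<le> (sum w I)\<^sup>2"
  using assms
proof (induction I rule: finite_induct)
  case (insert x I)
  define e s p where "e = sum w I" and "s = (\<Sum>i\<in>I. (w i)\<^sup>2)" and "p = (\<Prod>i\<in>I. 1 + w i)"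
  have IH: "2 + 2 * e + (e\<^sup>2 - s) \<le> 2 * p" "s \<le> e\<^sup>2"
    using insert unfolding e_def s_def p_def by auto
  have w: "0 \<le> w x" "0 \<le> e" using insert by (auto simp: e_def intro: sum_nonneg)
  have "(2 + 2 * e + (e\<^sup>2 - s)) * (1 + w x) \<le> 2 * p * (1 + w x)"
    using IH w by (intro mult_right_mono) auto
  moreover have "0 \<le> (e\<^sup>2 - s) * w x" "0 \<le> e * w x" using IH w by auto
  ultimately have "2 + 2 * (w x + e) + ((w x + e)\<^sup>2 - ((w x)\<^sup>2 + s)) \<le> 2 * ((1 + w x) * p)"
    "(w x)\<^sup>2 + s \<le> (w x + e)\<^sup>2"
    using IH by (auto simp: algebra_simps power2_eq_square)
  then show ?case using insert(1,2) by (simp add: e_def s_def p_def)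
qed simp

lemma sum_pairs:
  fixes v :: "'a \<Rightarrow> real"
  assumes "finite I"
  shows "(\<Sum>i\<in>I. \<Sum>j\<in>I - {i}. v i * v j) = (sum v I)\<^sup>2 - (\<Sum>i\<in>I. (v i)\<^sup>2)"
proof -
  have "(\<Sum>i\<in>I. \<Sum>j\<in>I - {i}. v i * v j) = (\<Sum>i\<in>I. v i * sum v I - (v i)\<^sup>2)"
  proof (rule sum.cong[OF refl])
    fix i assume "i \<in> I"
    then have "sum v I = v i + sum v (I - {i})" using assms by (rule sum.remove[rotated])
    moreover have "(\<Sum>j\<in>I - {i}. v i * v j) = v i * sum v (I - {i})" by (simp only: sum_distrib_left)
    ultimately show "(\<Sum>j\<in>I - {i}. v i * v j) = v i * sum v I - (v i)\<^sup>2"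
      by (simp add: algebra_simps power2_eq_square)
  qed
  also have "\<dots> = (sum v I)\<^sup>2 - (\<Sum>i\<in>I. (v i)\<^sup>2)"
    by (simp add: sum_subtractf sum_distrib_right[symmetric] power2_eq_square)
  finally show ?thesis .
qed

text \<open>Put \<open>w = 2 ^ u - 1\<close>, so that \<open>2 ^ sum u I\<close> is the product of
  the \<open>1 + w\<close>, and bound it below by \<open>prod_ge_pairs\<close>. The second-order
  term D vanishes if all weight sits on one index. Two indices with positive u force
  \<open>D \<ge> 2 * (sum u I - 1)\<close>, and this surplus makes
  \<open>few_singletons_bound\<close> strict.\<close>

lemma pairs_bound:
  fixes u :: "'a \<Rightarrow> nat"
  assumes I: "finite I" "i \<in> I" "j \<in> I" "i \<noteq> j" "1 \<le> u i" "1 \<le> u j"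
  shows "(\<Sum>i\<in>I. \<Sum>j\<in>I - {i}. 2 ^ u i * 2 ^ u j) + (real (card I) - 2) * (2 * (real (sum u I) - 1))
     \<le> (real (card I) - 1) * (real (card I) - 2) + 2 * (real (card I) - 1) * 2 ^ sum u I"
proof -
  define w where "w x = 2 ^ u x - (1 :: real)" for x
  define e s m where "e = sum w I" and "s = (\<Sum>i\<in>I. (w i)\<^sup>2)" and "m = real (card I)"
  define D where "D = e\<^sup>2 - s"
  have w0: "0 \<le> w x" for x by (simp add: w_def)
  have "2 + 2 * e + D \<le> 2 * (\<Prod>i\<in>I. 1 + w i)"
    using prod_ge_pairs[of I w] I w0 by (simp add: e_def s_def D_def)
  also have "(\<Prod>i\<in>I. 1 + w i) = 2 ^ sum u I" by (simp add: w_def power_sum)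
  finally have V: "2 + 2 * e + D \<le> 2 * 2 ^ sum u I" .
  have "sum (\<lambda>x. 2 ^ u x) I = e + m" by (simp add: e_def w_def sum_subtractf m_def)
  moreover have "(\<Sum>i\<in>I. (2 ^ u i)\<^sup>2) = s + 2 * e + m"
  proof -
    have "(\<Sum>i\<in>I. (2 ^ u i)\<^sup>2) = (\<Sum>i\<in>I. (w i)\<^sup>2 + 2 * w i + 1)"
      by (rule sum.cong) (auto simp: w_def power2_eq_square algebra_simps)
    then show ?thesis by (simp add: sum.distrib s_def e_def m_def sum_distrib_left)
  qed
  ultimately have S: "(\<Sum>i\<in>I. \<Sum>j\<in>I - {i}. 2 ^ u i * 2 ^ u j) = m * (m - 1) + 2 * (m - 1) * e + D"
    unfolding sum_pairs[OF I(1)] by (simp add: D_def power2_eq_square algebra_simps)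
  have "card {i, j} \<le> card I" using I by (intro card_mono) auto
  then have m2: "2 \<le> m" using I by (simp add: m_def)
  have D: "2 * (real (sum u I) - 1) \<le> D"
  proof -
    define r where "r = sum w (I - {i})"
    have e: "e = w i + r" unfolding e_def r_def using I by (simp add: sum.remove)
    have "(\<Sum>x\<in>I - {i}. (w x)\<^sup>2) \<le> r\<^sup>2"
      using prod_ge_pairs[of "I - {i}" w] I w0 by (simp add: r_def)
    then have "s \<le> (w i)\<^sup>2 + r\<^sup>2" unfolding s_def using I by (simp add: sum.remove)
    then have 1: "2 * (w i * r) \<le> D" unfolding D_def e by (simp add: power2_eq_square algebra_simps)
    have ge: "1 \<le> w x" if "1 \<le> u x" for x
      using power_increasing[of 1 "u x" "2 :: real"] that by (simp add: w_def)
    have "w j \<le> r" unfolding r_def using I w0 by (intro member_le_sum) auto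
    then have "1 \<le> r" using ge[of j] I by simp
    \<comment> \<open>Since w i and r are both at least 1, their product is at least their sum minus
      1.\<close>
    then have "0 \<le> (w i - 1) * (r - 1)" using ge[of i] I by simp
    then have 2: "e - 1 \<le> w i * r" unfolding e by (simp add: algebra_simps)
    have "real (sum u I) \<le> e" unfolding e_def of_nat_sum
    proof (rule sum_mono)
      fix x
      have "u x + 1 \<le> 2 ^ u x" unfolding Suc_eq_plus1[symmetric] by (rule Suc_leI) (rule less_exp)
      then have "real (u x + 1) \<le> real (2 ^ u x)" by (rule of_nat_mono)
      then show "real (u x) \<le> w x" by (simp add: w_def)
    qed
    then show ?thesis using 1 2 by simp
  qed
  have "(m - 1) * (2 + 2 * e + D) \<le> (m - 1) * (2 * 2 ^ sum u I)" using V m2 by (intro mult_left_mono) auto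
  moreover have "(m - 2) * (2 * (real (sum u I) - 1)) \<le> (m - 2) * D" using D m2 by (intro mult_left_mono) auto
  ultimately show ?thesis unfolding S m_def[symmetric] by (simp add: algebra_simps)
qed

context large_ground_set
begin

lemma N_Suc: "\<exists>N'. N = Suc (Suc N')"
  using N_ge by (intro exI[of _ "N - 2"]) simp

lemma phi_2: "\<phi> (t + 2) t = 2 ^ (N - 1) - 1" "\<phi> (t + 2) (t + 1) = 1"
proof -
  have "N = Suc (N - 1)" using N_ge by simp
  then have "Stirling N (Suc (Suc 0)) = 2 ^ (N - 1) - 1" using Stirling_2[of "N - 1"] by metis
  then show "\<phi> (t + 2) t = 2 ^ (N - 1) - 1" by (simp add: \<phi>_def N_def numeral_2_eq_2 del: Stirling.simps)
  have "n - (t + 1) = Suc (n - (t + 2))" using N_ge by simp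
  then show "\<phi> (t + 2) (t + 1) = 1" by (simp add: \<phi>_def del: Stirling.simps)
qed

lemma phi_2_large: "36 * (t + 1) \<le> \<phi> (t + 2) t"
proof -
  have "6 * 6 \<le> Q * Q" using Q_ge(3) by (intro mult_le_mono) auto
  then have "(t + 1) * (6 * 6) \<le> (t + 1)\<^sup>2 * Q\<^sup>2"
    unfolding power2_eq_square by (rule mult_le_mono[rotated]) simp
  also have "\<dots> \<le> \<phi> (t + 2) t" using Stirling_2_large by (simp add: \<phi>_def N_def)
  finally show ?thesis by simp
qed

lemma determined:
  assumes "F \<in> Pi_part n (t + 2)" "F' \<in> Pi_part n (t + 2)" "W \<subseteq> F" "W \<subseteq> F'" "card W = t + 1"
  shows "F = F'"
proof -
  have "finite W" using assms(5) by (metis Suc_eq_plus1 card.infinite nat.distinct(1))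
  then have "card {P \<in> Pi_part n (t + 2). W \<subseteq> P} \<le> 1"
    using card_containing_le[of W "t + 2" n] assms(5) phi_2(2) by (simp add: \<phi>_def)
  moreover have "finite {P \<in> Pi_part n (t + 2). W \<subseteq> P}" by simp
  ultimately show ?thesis using assms card_le_Suc0_iff_eq[of "{P \<in> Pi_part n (t + 2). W \<subseteq> P}"]
    by simp
qed

text \<open>Each G contains all blocks of \<open>F0\<close> except a pair A, B, and splits their
  union into two blocks. The resulting sum over pairs would be largest with all excess points in one
  block, the situation of type (C, D); \<open>A0\<close> and \<open>B0\<close> rule that
  out.\<close>

lemma few_singletons_bound:
  assumes F0: "F0 \<in> Pi_part n (t + 2)" and GG: "GG \<subseteq> Pi_part n (t + 2)"
    and cr: "\<And>G. G \<in> GG \<Longrightarrow> t \<le> card (F0 \<inter> G)" and t2: "2 \<le> t"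
    and AB: "A0 \<in> F0" "B0 \<in> F0" "A0 \<noteq> B0" "card A0 \<noteq> 1" "card B0 \<noteq> 1"
  shows "card GG + t < (t + 1) * \<phi> (t + 2) t"
proof -
  have fF: "finite F0" and cF: "card F0 = t + 2" using Pi_part_finite[OF F0] Pi_part_card[OF F0] by auto
  have UF: "\<Union>F0 = {1..n}" by (rule Pi_part_Union[OF F0])
  have fB: "finite B" if "B \<in> F0" for B using UF that by (metis Union_upper finite_atLeastAtMost finite_subset)
  have c1: "1 \<le> card B" if "B \<in> F0" for B
    using that Pi_part_nonempty[OF F0] fB by (simp add: Suc_le_eq card_gt_0_iff)
  \<comment> \<open>With the excess \<open>u B\<close> over one point, the union of A and B has
    \<open>2 ^ (u A + u B + 1) - 1\<close> partitions into two blocks.\<close>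
  define u where "u B = card B - 1" for B :: "nat set"
  define Cn where "Cn A B = {G \<in> Pi_part n (t + 2). F0 - {A, B} \<subseteq> G}" for A B
  have Cn_le: "card (Cn A B) \<le> 2 * (2 ^ u A * 2 ^ u B)" if "A \<in> F0" "B \<in> F0" "A \<noteq> B" for A B
  proof -
    have disj: "disjoint F0" "{} \<notin> F0" using F0 by (auto simp: Pi_part_def partition_on_def)
    have W: "disjoint (F0 - {A, B})" "{} \<notin> F0 - {A, B}" "\<Union>(F0 - {A, B}) \<subseteq> {1..n}"
      using disj UF by (auto intro: pairwise_subset)
    have cW: "card (F0 - {A, B}) = t" using that fF cF by (simp add: card_Diff_subset)
    have "card (\<Union>F0) = (\<Sum>B\<in>F0. card B)" using disj(1) fB by (intro card_Union_disjoint) auto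
    also have "\<dots> = card A + card B + (\<Sum>B\<in>F0 - {A, B}. card B)"
      using that fF sum.remove[of F0 A card] sum.remove[of "F0 - {A}" B card]
      by (simp add: Diff_insert2[symmetric] insert_commute)
    also have "(\<Sum>B\<in>F0 - {A, B}. card B) = card (\<Union>(F0 - {A, B}))"
      using W(1) fB by (intro card_Union_disjoint[symmetric]) auto
    finally have cU: "n - card (\<Union>(F0 - {A, B})) = card A + card B" unfolding UF by simp
    have AB: "card A + card B = Suc (Suc (u A + u B))" using c1[OF that(1)] c1[OF that(2)] by (simp add: u_def)
    have "card (Cn A B) = Stirling (card A + card B) 2"
      unfolding Cn_def Pi_part_parts using card_parts_containing[OF _ W, of "t + 2"] cW cU by simp
    also have "\<dots> = 2 ^ Suc (u A + u B) - 1"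
      unfolding AB numeral_2_eq_2 by (rule Stirling_2[unfolded numeral_2_eq_2])
    also have "\<dots> \<le> 2 * (2 ^ u A * 2 ^ u B)" by (simp add: power_add)
    finally show ?thesis .
  qed
  define P where "P = (SIGMA A:F0. F0 - {A})"
  have finP: "finite P" using fF by (simp add: P_def)
  have pair: "\<exists>A B. A \<in> F0 \<and> B \<in> F0 \<and> A \<noteq> B \<and> F0 - {A, B} \<subseteq> G" if G: "G \<in> GG" for G
  proof -
    obtain W where W: "W \<subseteq> F0 \<inter> G" "card W = t" using cr[OF G] by (metis obtain_subset_with_card_n)
    then have "card (F0 - W) = 2" using fF cF finite_subset[of W F0] by (simp add: card_Diff_subset)
    then obtain A B where AB: "F0 - W = {A, B}" "A \<noteq> B" by (auto simp: card_2_iff)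
    have "A \<in> F0" "B \<in> F0" using AB(1) by blast+
    moreover have "F0 - {A, B} \<subseteq> G" using W(1) unfolding AB(1)[symmetric] by blast
    ultimately show ?thesis using AB(2) by blast
  qed
  then obtain pa pb where p: "\<And>G. G \<in> GG \<Longrightarrow> pa G \<in> F0 \<and> pb G \<in> F0 \<and> pa G \<noteq> pb G \<and> F0 - {pa G, pb G} \<subseteq> G"
    by metis
  \<comment> \<open>each G is counted by the two orderings of a pair of blocks of F0 that it may avoid\<close>
  have "2 * card GG = card (GG \<times> (UNIV :: bool set))"
    by (simp add: card_cartesian_product mult.commute)
  also have "\<dots> \<le> card (SIGMA p:P. Cn (fst p) (snd p))"
  proof (rule card_inj_on_le)
    let ?h = "\<lambda>(G, b). (if b then (pa G, pb G) else (pb G, pa G), G)"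
    show "inj_on ?h (GG \<times> UNIV)" using p by (auto intro!: inj_onI split: if_splits)
    show "?h ` (GG \<times> UNIV) \<subseteq> (SIGMA p:P. Cn (fst p) (snd p))"
      using p GG by (fastforce simp: P_def Cn_def insert_commute)
    show "finite (SIGMA p:P. Cn (fst p) (snd p))" using finP by (auto simp: Cn_def)
  qed
  also have "\<dots> = (\<Sum>p\<in>P. card (Cn (fst p) (snd p)))"
    using finP by (intro card_SigmaI) (auto simp: Cn_def)
  also have "\<dots> \<le> (\<Sum>p\<in>P. 2 * (2 ^ u (fst p) * 2 ^ u (snd p)))"
  proof (rule sum_mono)
    fix p assume "p \<in> P"
    then have "fst p \<in> F0" "snd p \<in> F0" "fst p \<noteq> snd p" by (auto simp: P_def)
    then show "card (Cn (fst p) (snd p)) \<le> 2 * (2 ^ u (fst p) * 2 ^ u (snd p))" by (rule Cn_le)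
  qed
  also have "\<dots> = 2 * (\<Sum>A\<in>F0. \<Sum>B\<in>F0 - {A}. 2 ^ u A * 2 ^ u B)"
  proof -
    have "(\<Sum>A\<in>F0. \<Sum>B\<in>F0 - {A}. 2 ^ u A * 2 ^ u B) = (\<Sum>p\<in>P. 2 ^ u (fst p) * (2 :: nat) ^ u (snd p))"
      unfolding P_def using fF by (subst sum.Sigma) (auto simp: case_prod_beta)
    then show ?thesis by (simp only: sum_distrib_left)
  qed
  finally have "card GG \<le> (\<Sum>A\<in>F0. \<Sum>B\<in>F0 - {A}. 2 ^ u A * 2 ^ u B)" by simp
  then have "real (card GG) \<le> real (\<Sum>A\<in>F0. \<Sum>B\<in>F0 - {A}. 2 ^ u A * 2 ^ u B)" by (rule of_nat_mono)
  then have 1: "real (card GG) \<le> (\<Sum>A\<in>F0. \<Sum>B\<in>F0 - {A}. 2 ^ u A * 2 ^ u B)" by simp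
  have su: "sum u F0 = N - 2"
  proof -
    have disj: "disjoint F0" using F0 by (auto simp: Pi_part_def partition_on_def)
    have "n = (\<Sum>B\<in>F0. card B)" using card_Union_disjoint[OF disj] fB UF by simp
    also have "\<dots> = (\<Sum>B\<in>F0. u B + 1)"    proof (rule sum.cong[OF refl])
      fix B assume "B \<in> F0"
      then show "card B = u B + 1" using c1[of B] by (simp add: u_def)
    qed
    also have "\<dots> = sum u F0 + (t + 2)" unfolding sum.distrib using cF by simp
    finally show ?thesis using N_ge by simp
  qed
  have "1 \<le> u A0" "1 \<le> u B0" using c1[OF AB(1)] c1[OF AB(2)] AB by (auto simp: u_def)
  then have 2: "(\<Sum>A\<in>F0. \<Sum>B\<in>F0 - {A}. 2 ^ u A * 2 ^ u B) + real t * (2 * (real (N - 2) - 1))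
     \<le> (real t + 1) * real t + 2 * (real t + 1) * 2 ^ (N - 2)"
    using pairs_bound[of F0 A0 B0 u] AB fF unfolding su cF by (simp add: add.commute)
  obtain N' where N': "N = Suc (Suc N')" using N_Suc by blast
  have NN: "t + 4 \<le> 2 * N' - 2" "1 \<le> N'" using N_ge N' by auto
  have "real t * (real t + 4) \<le> real t * (2 * (real (N - 2) - 1))"
    using NN by (intro mult_left_mono) (auto simp: N' of_nat_diff)
  then have "real (card GG) + real t * (real t + 4) \<le> (real t + 1) * real t + 2 * (real t + 1) * 2 ^ (N - 2)"
    using 1 2 by simp
  then have "real (card GG) + 3 * real t \<le> (real t + 1) * (2 * 2 ^ (N - 2))"
    by (simp add: algebra_simps)
  then have "real (card GG + 3 * t) \<le> real ((t + 1) * 2 ^ (N - 1))" by (simp add: N' algebra_simps)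
  then have 3: "card GG + 3 * t \<le> (t + 1) * 2 ^ (N - 1)" unfolding of_nat_le_iff .
  \<comment> \<open>Replacing \<open>\<phi> (t + 2) t = 2 ^ (N - 1) - 1\<close> costs
    \<open>t + 1\<close>. Strictness needs \<open>3 * t > 2 * t + 1\<close>, that is t at least
    2.\<close>
  have "(t + 1) * \<phi> (t + 2) t + (t + 1) = (t + 1) * 2 ^ (N - 1)"
  proof -
    have "(2 :: nat) ^ (N - 1) = \<phi> (t + 2) t + 1" unfolding phi_2 by simp
    then show ?thesis by (simp add: algebra_simps)
  qed
  then show ?thesis using 3 t2 by linarith
qed

text \<open>Either \<open>FF\<close> has a single member, with at most one non-singleton block or
  with two; or it has exactly two members, as X and one more block determine a partition, and then
  few members of \<open>GG\<close> miss X. The term t is the deficit of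
  \<open>card (Dfam n (t + 2) t)\<close> against \<open>(t + 1) * \<phi> (t + 2) t\<close>.\<close>

lemma pair_case:
  assumes t2: "2 \<le> t"
    and FF: "FF \<subseteq> Pi_part n (t + 2)" and GG: "GG \<subseteq> Pi_part n (t + 2)" and cr: "cross_t_int t FF GG"
    and X: "card X = t" "\<And>F. F \<in> FF \<Longrightarrow> X \<subseteq> F" and ne: "FF \<noteq> {}"
    and G0: "G0 \<in> GG" "\<not> X \<subseteq> G0"
  shows "card FF * card GG + t < (t + 1) * \<phi> (t + 2) t
   \<or> (\<exists>T. card T = t + 1 \<and> singletons T \<and> FF \<subseteq> CT n (t + 2) T \<and> GG \<subseteq> DT n t (t + 2) T)"
proof -
  have finX: "finite X" using X(1) t1 by (metis card.infinite not_one_le_zero)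
  have finFF: "finite FF" and finGG: "finite GG" using finite_subfam FF GG by blast+
  have cr': "t \<le> card (F \<inter> G)" if "F \<in> FF" "G \<in> GG" for F G
    using cr that by (simp add: cross_t_int_def)
  have FP: "F \<in> Pi_part n (t + 2)" if "F \<in> FF" for F using FF that by auto
  have GP: "G \<in> Pi_part n (t + 2)" if "G \<in> GG" for G using GG that by auto
  obtain F1 where F1: "F1 \<in> FF" using ne by auto
  have fF1: "finite F1" "card F1 = t + 2" using Pi_part_finite[OF FP[OF F1]] Pi_part_card[OF FP[OF F1]] by auto
  show ?thesis
  proof (cases "FF = {F1}")
    case True
    show ?thesis
    proof (cases "\<exists>A\<in>F1. \<exists>B\<in>F1. A \<noteq> B \<and> card A \<noteq> 1 \<and> card B \<noteq> 1")
      case two: True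
      then obtain A B where "A \<in> F1" "B \<in> F1" "A \<noteq> B" "card A \<noteq> 1" "card B \<noteq> 1" by blast
      then have "card GG + t < (t + 1) * \<phi> (t + 2) t"
        using cr'[OF F1] few_singletons_bound[OF FP[OF F1] GG _ t2, of A B] by blast
      then show ?thesis using True by simp
    next
      case False
      have "\<exists>Z\<in>F1. \<forall>A\<in>F1 - {Z}. card A = 1"
      proof (cases "\<forall>A\<in>F1. card A = 1")
        case True
        moreover have "F1 \<noteq> {}" using fF1 by auto
        ultimately show ?thesis by blast
      qed (use False in blast)
      then obtain Z where Z: "Z \<in> F1" "\<forall>A\<in>F1 - {Z}. card A = 1" by blast
      define T where "T = F1 - {Z}"
      have cT: "card T = t + 1" using Z fF1 by (simp add: T_def)
      have fT: "finite T" using fF1 by (simp add: T_def)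
      have "A \<subseteq> {1..n}" if "A \<in> T" for A
        using that Pi_part_Union[OF FP[OF F1]] by (auto simp: T_def)
      then have sT: "singletons T" using Z by (simp add: singletons_def T_def)
      \<comment> \<open>Otherwise Z is among exactly t common blocks of \<open>F1\<close> and G. The
        two remaining blocks of \<open>F1\<close> are singletons, so the two remaining blocks of G,
        which cover the same two points, are the same singletons.\<close>
      have "t \<le> card (T \<inter> G)" if G: "G \<in> GG" for G
      proof (rule ccontr)
        assume less: "\<not> t \<le> card (T \<inter> G)"
        have fG: "finite G" "card G = t + 2" using Pi_part_finite[OF GP[OF G]] Pi_part_card[OF GP[OF G]] by auto
        have ZG: "Z \<in> G"
        proof (rule ccontr)
          assume "Z \<notin> G"
          then have "F1 \<inter> G = T \<inter> G" using Z by (auto simp: T_def)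
          then show False using cr'[OF F1 G] less by simp
        qed
        have "F1 \<inter> G = insert Z (T \<inter> G)" using Z ZG by (auto simp: T_def)
        then have "card (F1 \<inter> G) = Suc (card (T \<inter> G))" using fT by (simp add: T_def)
        then have cFG: "card (F1 \<inter> G) = t" using cr'[OF F1 G] less by simp
        have R: "card (F1 - G) = 2" "card (G - F1) = 2"
          using card_Diff_subset_Int[of F1 G] card_Diff_subset_Int[of G F1] cFG fF1 fG
          by (simp_all add: Int_commute)
        have disj: "disjoint F1" "disjoint G"
          using FP[OF F1] GP[OF G] by (auto simp: Pi_part_def partition_on_def)
        have finb: "finite B" if "B \<in> F1 \<union> G" for B
          using that Pi_part_Union[OF FP[OF F1]] Pi_part_Union[OF GP[OF G]]
          by (metis UnE Union_upper finite_atLeastAtMost finite_subset)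
        have UU: "\<Union>(G - F1) = \<Union>(F1 - G)"
        proof -
          have d: "\<Union>(H - H') = {1..n} - \<Union>(H \<inter> H')" if "disjoint H" "\<Union>H = {1..n}" for H H' :: "nat set set"
          proof -
            have "\<Union>(H - H') \<inter> \<Union>(H \<inter> H') = {}" using disjointD[OF that(1)] by blast
            moreover have "\<Union>(H - H') \<union> \<Union>(H \<inter> H') = {1..n}" using that(2) by blast
            ultimately show ?thesis by blast
          qed
          show ?thesis using d[OF disj(1) Pi_part_Union[OF FP[OF F1]], of G]
              d[OF disj(2) Pi_part_Union[OF GP[OF G]], of F1] by (simp add: Int_commute)
        qed
        have "card (\<Union>(F1 - G)) = (\<Sum>B\<in>F1 - G. card B)"
          using disj finb by (intro card_Union_disjoint) (auto intro: pairwise_subset)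
        also have "\<dots> = (\<Sum>B\<in>F1 - G. 1)" using Z ZG by (intro sum.cong) auto
        finally have c2: "card (\<Union>(G - F1)) = 2" using R UU by simp
        have "\<not> card (G - F1) < card (\<Union>(G - F1))" using c2 R by simp
        then have one: "card B = 1" if "B \<in> G - F1" for B
          using card_Union_gt[of "G - F1" B] that disj Pi_part_nonempty[OF GP[OF G]] finb fG
          by (force intro: pairwise_subset)
        have "G - F1 \<noteq> {}" using R(2) by (metis card.empty zero_neq_numeral)
        then obtain B where B: "B \<in> G - F1" by blast
        then obtain y where y: "B = {y}" using one by (metis card_1_singletonE)
        then obtain C where C: "C \<in> F1 - G" "y \<in> C" using UU B by blast
        then have "card C = 1" using Z ZG by auto
        then have "C = B" using C y by (metis card_1_singletonE singletonD)
        then show False using B C by simp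
      qed
      then have "GG \<subseteq> DT n t (t + 2) T" using GG by (auto simp: DT_def)
      moreover have "FF \<subseteq> CT n (t + 2) T" using FF True by (auto simp: CT_def T_def)
      ultimately show ?thesis using cT sT by blast
    qed
  next
    case False
    then obtain F2 where F2: "F2 \<in> FF" "F2 \<noteq> F1" using F1 by blast
    have fF2: "finite F2" "card F2 = t + 2" using Pi_part_finite[OF FP[OF F2(1)]] Pi_part_card[OF FP[OF F2(1)]] by auto
    have one: "card {F \<in> HH. W \<subseteq> F} \<le> 1" if "HH \<subseteq> Pi_part n (t + 2)" "card W = t + 1" for HH W
    proof -
      have "finite W" using that(2) by (metis Suc_eq_plus1 card.infinite nat.distinct(1))
      then show ?thesis using sub_containing_le[OF that(1), of W] that(2) phi_2(2) by (simp add: \<phi>_def)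
    qed
    have F12: "B \<in> X" if "B \<in> F1" "B \<in> F2" for B
    proof (rule ccontr)
      assume "B \<notin> X"
      then have "card (insert B X) = t + 1" using finX X by simp
      then have "F1 = F2" using determined[OF FP[OF F1] FP[OF F2(1)], of "insert B X"] that X(2) F1 F2 by auto
      then show False using F2 by simp
    qed
    have c2: "card (F1 - X) = 2" "card (F2 - X) = 2"
      using card_Diff_subset[of X F1] card_Diff_subset[of X F2] X F1 F2 finX fF1 fF2 by auto
    have UD: "\<Union>(F - X) = {1..n} - \<Union>X" if "F \<in> FF" for F
    proof -
      have "disjoint F" using FP[OF that] by (auto simp: Pi_part_def partition_on_def)
      then have "\<Union>(F - X) \<inter> \<Union>X = {}" using X(2)[OF that] disjointD[of F] by blast
      moreover have "\<Union>(F - X) \<union> \<Union>X = {1..n}" using X(2)[OF that] Pi_part_Union[OF FP[OF that]] by blast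
      ultimately show ?thesis by blast
    qed
    define Gp where "Gp = {G \<in> GG. \<not> X \<subseteq> G}"
    have hit: "t \<le> card (X \<inter> G) + card ((F - X) \<inter> G)" if "F \<in> FF" "G \<in> GG" for F G
    proof -
      have "F \<inter> G = (X \<inter> G) \<union> ((F - X) \<inter> G)" using X(2)[OF that(1)] by auto
      then show ?thesis using cr'[OF that] card_Un_le[of "X \<inter> G" "(F - X) \<inter> G"] by simp
    qed
    \<comment> \<open>Otherwise G contains both blocks of \<open>F1 - X\<close> and both of
      \<open>F2 - X\<close>. These are two different partitions of the same set, so some of the
      blocks overlap.\<close>
    have near: "t \<le> card (X \<inter> G) + 1" if G: "G \<in> GG" for G
    proof (rule ccontr)
      assume "\<not> ?thesis"
      then have "2 \<le> card ((F1 - X) \<inter> G)" "2 \<le> card ((F2 - X) \<inter> G)"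
        using hit[OF F1 G] hit[OF F2(1) G] by auto
      then have sub: "F1 - X \<subseteq> G" "F2 - X \<subseteq> G"
        using c2 fF1 fF2 card_seteq[of "F1 - X" "(F1 - X) \<inter> G"] card_seteq[of "F2 - X" "(F2 - X) \<inter> G"] by auto
      have "F1 - X \<noteq> {}" using c2(1) by (metis card.empty zero_neq_numeral)
      then obtain A where A: "A \<in> F1 - X" by blast
      have "A \<noteq> {}" using A Pi_part_nonempty[OF FP[OF F1]] by auto
      then obtain y where y: "y \<in> A" by auto
      then have "y \<in> \<Union>(F2 - X)" using UD[OF F1] UD[OF F2(1)] A by blast
      then obtain B where B: "B \<in> F2 - X" "y \<in> B" by auto
      then have "A \<noteq> B" using F12 A by auto
      then show False using Pi_part_disjoint[OF GP[OF G], of A B] sub A B y by auto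
    qed
    have miss: "\<exists>x\<in>X. X \<inter> G = X - {x}" if "G \<in> Gp" for G
      using that near[of G] finX X(1) by (intro Int_eq_Diff_singleton) (auto simp: Gp_def)
    have cX: "card (X \<inter> G) = t - 1" if "G \<in> Gp" for G
      using miss[OF that] X finX by auto
    have G0p: "G0 \<in> Gp" using G0 by (simp add: Gp_def)
    have "card FF \<le> 2"
    proof -
      obtain x0 where x0: "x0 \<in> X" "X \<inter> G0 = X - {x0}" using miss[OF G0p] by blast
      obtain M where M: "M \<subseteq> G0" "M \<inter> X = {}" "card M = t + 2 - t"
        and cov: "FF \<subseteq> (\<Union>B\<in>M. {F \<in> FF. insert B X \<subseteq> F})"
        by (rule obtain_blocks[OF FF ne X(2) GP[OF G0(1)] cr'[OF _ G0(1)] finX X(1) x0]) (auto intro: that)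
      have finM: "finite M" using M(3) by (intro card_ge_0_finite) simp
      have "card FF \<le> card (\<Union>B\<in>M. {F \<in> FF. insert B X \<subseteq> F})"
        using cov finM finFF by (intro card_mono) auto
      also have "\<dots> \<le> card M * 1"
      proof (rule card_UN_bound[OF finM])
        fix B assume "B \<in> M"
        then have "card (insert B X) = t + 1" using M finX X by (subst card_insert_disjoint) auto
        then show "card {F \<in> FF. insert B X \<subseteq> F} \<le> 1" by (rule one[OF FF])
      qed
      finally show ?thesis using M by simp
    qed
    moreover have "card GG \<le> \<phi> (t + 2) t + 4 * t"
    proof -
      \<comment> \<open>A member of \<open>Gp\<close> is determined by the block x of X that it
        lacks and by one of the two further blocks of each of \<open>F1\<close> and
        \<open>F2\<close>; this gives \<open>4 * t\<close>.\<close>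
      have "Gp \<subseteq> (\<Union>(x, B, C)\<in>X \<times> (F1 - X) \<times> (F2 - X). {G \<in> GG. (X - {x}) \<union> {B, C} \<subseteq> G})"
      proof
        fix G assume G: "G \<in> Gp"
        then have GG': "G \<in> GG" by (simp add: Gp_def)
        obtain x where x: "x \<in> X" "X \<inter> G = X - {x}" using miss[OF G] by blast
        have "\<exists>B. B \<in> (F - X) \<inter> G" if "F \<in> FF" for F
          using hit[OF that GG'] cX[OF G] t1 by (metis One_nat_def Suc_pred add.right_neutral all_not_in_conv card.empty less_eq_Suc_le not_less_eq_eq order_refl)
        then obtain B C where "B \<in> (F1 - X) \<inter> G" "C \<in> (F2 - X) \<inter> G" using F1 F2 by meson
        then show "G \<in> (\<Union>(x, B, C)\<in>X \<times> (F1 - X) \<times> (F2 - X). {G \<in> GG. (X - {x}) \<union> {B, C} \<subseteq> G})"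
          using x GG' by auto
      qed
      then have "card Gp \<le> card (\<Union>(x, B, C)\<in>X \<times> (F1 - X) \<times> (F2 - X). {G \<in> GG. (X - {x}) \<union> {B, C} \<subseteq> G})"
        using finGG finX fF1 fF2 by (intro card_mono) auto
      also have "\<dots> \<le> card (X \<times> (F1 - X) \<times> (F2 - X)) * 1"
      proof (rule card_UN_bound)
        show "finite (X \<times> (F1 - X) \<times> (F2 - X))" using finX fF1 fF2 by simp
        fix z assume "z \<in> X \<times> (F1 - X) \<times> (F2 - X)"
        then obtain x B C where z: "z = (x, B, C)" "x \<in> X" "B \<in> F1" "B \<notin> X" "C \<in> F2" "C \<notin> X" by auto
        have "B \<noteq> C" using z F12 by auto
        then have "card ((X - {x}) \<union> {B, C}) = t + 1" using z finX X t1 by (simp add: card_insert_if)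
        then show "card (case z of (x, B, C) \<Rightarrow> {G \<in> GG. (X - {x}) \<union> {B, C} \<subseteq> G}) \<le> 1"
          unfolding z(1) prod.case by (rule one[OF GG])
      qed
      also have "\<dots> = 4 * t" using X c2 by (simp add: card_cartesian_product)
      finally have "card Gp \<le> 4 * t" .
      moreover have "card {G \<in> GG. X \<subseteq> G} \<le> \<phi> (t + 2) t"
        using sub_containing_le[OF GG, of X] finX X by (simp add: \<phi>_def)
      moreover have "card GG \<le> card {G \<in> GG. X \<subseteq> G} + card Gp"
      proof -
        have "GG = {G \<in> GG. X \<subseteq> G} \<union> Gp" by (auto simp: Gp_def)
        then show ?thesis by (metis card_Un_le)
      qed
      ultimately show ?thesis by simp
    qed
    ultimately have "card FF * card GG \<le> 2 * (\<phi> (t + 2) t + 4 * t)" by (rule mult_le_mono)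
    moreover have "3 * \<phi> (t + 2) t \<le> (t + 1) * \<phi> (t + 2) t" using t2 by (intro mult_le_mono1) simp
    moreover have "card FF * card GG + t < 3 * \<phi> (t + 2) t"
      using \<open>card FF * card GG \<le> _\<close> phi_2_large t1 by simp
    ultimately show ?thesis by (meson order_less_le_trans)
  qed
qed

text \<open>Takes the place of \<open>common_case\<close> when the family sharing X has only t + 2
  blocks: one branching already determines F, and any F is a cover of \<open>GG\<close> with t + 2
  blocks. \<open>swap_crude\<close> shows that this loose bound suffices.\<close>

lemma crude_bound:
  assumes FF: "FF \<subseteq> Pi_part n (t + 2)" and GG: "GG \<subseteq> Pi_part n l" and cr: "cross_t_int t FF GG"
    and X: "card X = t" "\<And>F. F \<in> FF \<Longrightarrow> X \<subseteq> F" and ne: "FF \<noteq> {}"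
    and G0: "G0 \<in> GG" "\<not> X \<subseteq> G0" and l: "t + 2 \<le> l" "l \<le> K"
  shows "2 * (card FF * card GG) \<le> (a + 1) * ((t + 2) * (t + 1)) * \<phi> l t"
proof -
  have finX: "finite X" using X(1) t1 by (metis card.infinite not_one_le_zero)
  obtain F1 where F1: "F1 \<in> FF" using ne by auto
  have F1P: "F1 \<in> Pi_part n (t + 2)" using F1 FF by auto
  have "card (X \<inter> G0) < card X" using finX G0 by (intro psubset_card_mono) auto
  then have "card {F \<in> FF. X \<subseteq> F} \<le> (l - t + 1) * Stirling (n - (card X + 1)) (t + 2 - (card X + 1))"
    using X finX by (intro extend_once[OF FF cr G0(1) GG]) auto
  then have "card {F \<in> FF. X \<subseteq> F} \<le> l - t + 1" using phi_2(2) X by (simp add: \<phi>_def)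
  moreover have "{F \<in> FF. X \<subseteq> F} = FF" using X by auto
  ultimately have F: "card FF \<le> a + 1" using l Kta by simp
  have tc: "t_cover t GG F1" using F1 cr Pi_part_finite[OF F1P] by (auto simp: t_cover_def cross_t_int_def)
  have "card GG \<le> (card F1 choose t) * \<phi> l t"
  proof (rule t_cover_card[OF GG tc])
    fix Y assume "Y \<subseteq> F1" "card Y = t"
    then show "card {F \<in> GG. Y \<subseteq> F} \<le> \<phi> l t"
      using sub_containing_le[OF GG, of Y] l finite_subset[OF _ Pi_part_finite[OF F1P]] by (simp add: \<phi>_def)
  qed
  then have G: "card GG \<le> ((t + 2) choose t) * \<phi> l t" using Pi_part_card[OF F1P] by simp
  have "2 * (t + 2 choose t) = (t + 2) * (t + 1)"
    using binomial_absorb_comp[of "t + 2" t] binomial_absorb_comp[of "t + 1" t] by simp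
  then have "(a + 1) * ((t + 2) * (t + 1)) * \<phi> l t = 2 * ((a + 1) * ((t + 2 choose t) * \<phi> l t))"
    by (metis mult.assoc mult.left_commute)
  then show ?thesis using mult_le_mono[OF F G] by linarith
qed

end

section \<open>The extremal families\<close>

lemma sum_nonempty_subsets:
  fixes h :: "nat \<Rightarrow> int"
  assumes "finite A"
  shows "(\<Sum>B | B \<subseteq> A \<and> B \<noteq> {}. h (card B)) = (\<Sum>j = 1..card A. int (card A choose j) * h j)"
proof -
  let ?S = "{B. B \<subseteq> A \<and> B \<noteq> {}}"
  have fS: "finite ?S" using assms by simp
  have "(\<Sum>B\<in>?S. h (card B)) = (\<Sum>j\<in>{1..card A}. \<Sum>B\<in>{B \<in> ?S. card B = j}. h (card B))"
  proof (rule sum.group[symmetric, OF fS])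
    show "card ` ?S \<subseteq> {1..card A}"
    proof
      fix j assume "j \<in> card ` ?S"
      then obtain B where B: "j = card B" "B \<subseteq> A" "B \<noteq> {}" by auto
      then have "finite B" using assms finite_subset by blast
      then show "j \<in> {1..card A}" using B assms by (simp add: Suc_le_eq card_gt_0_iff card_mono)
    qed
  qed simp
  also have "\<dots> = (\<Sum>j\<in>{1..card A}. int (card A choose j) * h j)"
  proof (rule sum.cong[OF refl])
    fix j assume "j \<in> {1..card A}"
    then have "{B \<in> ?S. card B = j} = {B. B \<subseteq> A \<and> card B = j}" by auto
    moreover have "card {B. B \<subseteq> A \<and> card B = j} = card A choose j" by (rule n_subsets[OF assms])
    ultimately show "(\<Sum>B\<in>{B \<in> ?S. card B = j}. h (card B)) = int (card A choose j) * h j" by simp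
  qed
  finally show ?thesis .
qed

lemma sing_image: "(\<lambda>i. {i}) ` (\<Union>X) = X" if "\<And>B. B \<in> X \<Longrightarrow> card B = 1" for X :: "'a set set"
proof -
  have "\<exists>x. B = {x}" if "B \<in> X" for B using \<open>\<And>B. B \<in> X \<Longrightarrow> card B = 1\<close>[OF that] by (metis card_1_singletonE)
  then show ?thesis by (fastforce simp: image_iff)
qed

section \<open>The action of permutations on partitions and families\<close>

definition blockwise :: "(nat \<Rightarrow> nat) \<Rightarrow> nat set set \<Rightarrow> nat set set" where
  "blockwise \<sigma> P = (\<lambda>B. \<sigma> ` B) ` P"

lemma perm_fam_blockwise: "perm_fam \<sigma> F = blockwise \<sigma> ` F"
  by (simp add: perm_fam_def blockwise_def)

lemma blockwise_Pi_part:
  assumes "\<sigma> permutes {1..n}" "P \<in> Pi_part n k" shows "blockwise \<sigma> P \<in> Pi_part n k"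
proof -
  have P: "partition_on {1..n} P" "card P = k" using assms by (auto simp: Pi_part_def)
  have inj: "inj_on \<sigma> {1..n}" using assms(1) by (rule permutes_inj_on)
  have "partition_on (\<sigma> ` {1..n}) ((`) \<sigma> ` P - {{}})" by (rule partition_on_inj_image[OF P(1) inj])
  moreover have "(`) \<sigma> ` P - {{}} = blockwise \<sigma> P" using partition_onD3[OF P(1)] by (auto simp: blockwise_def)
  moreover have "\<sigma> ` {1..n} = {1..n}" using assms(1) by (rule permutes_image)
  moreover have "card (blockwise \<sigma> P) = k" unfolding blockwise_def P(2)[symmetric]
  proof (rule card_image)
    show "inj_on ((`) \<sigma>) P" using permutes_inj[OF assms(1)] by (auto simp: inj_on_def inj_image_eq_iff)
  qed
  ultimately show ?thesis by (simp add: Pi_part_def)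
qed

lemma blockwise_inverse:
  assumes "\<sigma> permutes S"
  shows "blockwise \<sigma> (blockwise (inv \<sigma>) P) = P"
  using permutes_inverses[OF assms] by (simp add: blockwise_def image_image)

lemma inj_image_permutes: "\<sigma> permutes S \<Longrightarrow> inj ((`) \<sigma>)"
  using permutes_inj[of \<sigma> S] by (auto simp: inj_def inj_image_eq_iff)

lemma blockwise_subset: "\<sigma> permutes S \<Longrightarrow> blockwise \<sigma> X \<subseteq> blockwise \<sigma> P \<longleftrightarrow> X \<subseteq> P"
  unfolding blockwise_def by (rule inj_image_subset_iff[OF inj_image_permutes])

lemma blockwise_Int: "\<sigma> permutes S \<Longrightarrow> blockwise \<sigma> X \<inter> blockwise \<sigma> P = blockwise \<sigma> (X \<inter> P)"
  unfolding blockwise_def by (rule image_Int[OF inj_image_permutes, symmetric])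

lemma blockwise_Diff: "\<sigma> permutes S \<Longrightarrow> blockwise \<sigma> X - blockwise \<sigma> P = blockwise \<sigma> (X - P)"
  unfolding blockwise_def by (rule image_set_diff[OF inj_image_permutes, symmetric])

lemma card_blockwise: "\<sigma> permutes S \<Longrightarrow> card (blockwise \<sigma> X) = card X"
  unfolding blockwise_def by (rule card_image) (metis inj_image_permutes inj_on_subset subset_UNIV)

text \<open>The inverse permutation supplies preimages, so for families cut out by a condition only
  the equivariance of the condition remains to be checked.\<close>

lemma perm_fam_Collect:
  assumes \<sigma>: "\<sigma> permutes {1..n}" and iff: "\<And>P. R (blockwise \<sigma> P) \<longleftrightarrow> R' P"
  shows "perm_fam \<sigma> {P \<in> Pi_part n k. R' P} = {P \<in> Pi_part n k. R P}"
proof -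
  have "P \<in> blockwise \<sigma> ` {P \<in> Pi_part n k. R' P}" if "P \<in> Pi_part n k" "R P" for P
  proof (rule image_eqI[where x = "blockwise (inv \<sigma>) P"])
    show *: "P = blockwise \<sigma> (blockwise (inv \<sigma>) P)" using blockwise_inverse[OF \<sigma>] by simp
    show "blockwise (inv \<sigma>) P \<in> {P \<in> Pi_part n k. R' P}"
      using blockwise_Pi_part[OF permutes_inv[OF \<sigma>] that(1)] that(2) iff[of "blockwise (inv \<sigma>) P"] * by auto
  qed
  then show ?thesis unfolding perm_fam_blockwise
    using blockwise_Pi_part[OF \<sigma>] iff by blast
qed

lemma perm_fam_AX:
  assumes \<sigma>: "\<sigma> permutes {1..n}"
  shows "perm_fam \<sigma> (AX n k X M) = AX n k (blockwise \<sigma> X) (blockwise \<sigma> M)"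
  unfolding AX_def using perm_fam_Collect[OF \<sigma>,
    of "\<lambda>P. blockwise \<sigma> X \<subseteq> P \<and> P \<inter> (blockwise \<sigma> M - blockwise \<sigma> X) \<noteq> {}" "\<lambda>P. X \<subseteq> P \<and> P \<inter> (M - X) \<noteq> {}"]
  by (simp add: blockwise_subset[OF \<sigma>] blockwise_Diff[OF \<sigma>] blockwise_Int[OF \<sigma>]) (simp add: blockwise_def)

lemma perm_fam_CT:
  assumes \<sigma>: "\<sigma> permutes {1..n}"
  shows "perm_fam \<sigma> (CT n k T) = CT n k (blockwise \<sigma> T)"
  unfolding CT_def by (rule perm_fam_Collect[OF \<sigma>]) (rule blockwise_subset[OF \<sigma>])

lemma perm_fam_DT:
  assumes \<sigma>: "\<sigma> permutes {1..n}"
  shows "perm_fam \<sigma> (DT n t k T) = DT n t k (blockwise \<sigma> T)"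
  unfolding DT_def by (rule perm_fam_Collect[OF \<sigma>]) (simp add: blockwise_Int[OF \<sigma>] card_blockwise[OF \<sigma>])

lemma perm_fam_BX:
  assumes \<sigma>: "\<sigma> permutes {1..n}"
  shows "perm_fam \<sigma> (BX n l X M) = BX n l (blockwise \<sigma> X) (blockwise \<sigma> M)"
proof -
  have U: "\<Union>(blockwise \<sigma> M) = \<sigma> ` \<Union>M" by (auto simp: blockwise_def)
  have inj: "inj \<sigma>" by (rule permutes_inj[OF \<sigma>])
  have R: "{1..n} - \<sigma> ` \<Union>M = \<sigma> ` ({1..n} - \<Union>M)"
    using image_set_diff[OF inj, of "{1..n}" "\<Union>M"] permutes_image[OF \<sigma>] by simp
  have one: "blockwise \<sigma> ((M - {B}) \<union> {B \<union> ({1..n} - \<Union>M)})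
      = (blockwise \<sigma> M - {\<sigma> ` B}) \<union> {\<sigma> ` B \<union> ({1..n} - \<Union>(blockwise \<sigma> M))}" for B
  proof -
    have "blockwise \<sigma> (M - {B}) = blockwise \<sigma> M - {\<sigma> ` B}"
      using blockwise_Diff[OF \<sigma>, of M "{B}"] by (simp add: blockwise_def)
    then show ?thesis unfolding U R by (simp add: blockwise_def image_Un)
  qed
  have "blockwise \<sigma> ` {(M - {B}) \<union> {B \<union> ({1..n} - \<Union>M)} | B. B \<in> X}
    = {(blockwise \<sigma> M - {B}) \<union> {B \<union> ({1..n} - \<Union>(blockwise \<sigma> M))} | B. B \<in> blockwise \<sigma> X}" (is "?L = ?R")
  proof -
    have "?L = (\<lambda>B. blockwise \<sigma> ((M - {B}) \<union> {B \<union> ({1..n} - \<Union>M)})) ` X" by blast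
    also have "\<dots> = (\<lambda>B. (blockwise \<sigma> M - {\<sigma> ` B}) \<union> {\<sigma> ` B \<union> ({1..n} - \<Union>(blockwise \<sigma> M))}) ` X"
      by (simp only: one)
    also have "\<dots> = ?R" unfolding blockwise_def[of \<sigma> X] by blast
    finally show ?thesis .
  qed
  moreover have "perm_fam \<sigma> {F \<in> Pi_part n l. X \<subseteq> F} = {F \<in> Pi_part n l. blockwise \<sigma> X \<subseteq> F}"
    by (rule perm_fam_Collect[OF \<sigma>]) (rule blockwise_subset[OF \<sigma>])
  ultimately show ?thesis unfolding BX_def perm_fam_blockwise image_Un by simp
qed

text \<open>Three bijections are glued, on X, on \<open>M - X\<close> and on the rest of the ground
  set; outside it the map is the identity, as \<open>permutes\<close> demands.\<close>

lemma exists_normalizing_perm: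
  assumes "X \<subseteq> M" "M \<subseteq> {1..n}" "card X = t" "card M = l"
  shows "\<exists>\<sigma>. \<sigma> permutes {1..n} \<and> \<sigma> ` X = {1..t} \<and> \<sigma> ` M = {1..l}"
proof -
  have fin: "finite M" "finite X" using assms by (auto intro: finite_subset)
  have tl: "t \<le> l" "l \<le> n" using assms fin card_mono[of M X] card_mono[of "{1..n}" M] by auto
  have "card (M - X) = card {t+1..l}" "card ({1..n} - M) = card {l+1..n}"
    using assms fin by (auto simp: card_Diff_subset)
  then obtain f g h where f: "bij_betw f X {1..t}" and g: "bij_betw g (M - X) {t+1..l}"
    and h: "bij_betw h ({1..n} - M) {l+1..n}"
    using finite_same_card_bij[of X "{1..t}"] finite_same_card_bij[of "M - X" "{t+1..l}"]
      finite_same_card_bij[of "{1..n} - M" "{l+1..n}"] assms fin by auto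
  define s where "s x = (if x \<in> X then f x else if x \<in> M then g x else if x \<in> {1..n} then h x else x)" for x
  have sX: "bij_betw s X {1..t}" using f by (rule bij_betw_cong[THEN iffD1, rotated]) (simp add: s_def)
  have "bij_betw s (M - X) {t+1..l}" using g by (rule bij_betw_cong[THEN iffD1, rotated]) (simp add: s_def)
  then have "bij_betw s (X \<union> (M - X)) ({1..t} \<union> {t+1..l})" using sX by (intro bij_betw_combine) auto
  moreover have "X \<union> (M - X) = M" "{1..t} \<union> {t+1..l} = {1..l}" using assms tl by auto
  ultimately have sM: "bij_betw s M {1..l}" by simp
  have "bij_betw s ({1..n} - M) {l+1..n}"
    using h by (rule bij_betw_cong[THEN iffD1, rotated]) (use assms in \<open>auto simp: s_def\<close>)
  then have "bij_betw s (M \<union> ({1..n} - M)) ({1..l} \<union> {l+1..n})" using sM by (intro bij_betw_combine) auto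
  moreover have "M \<union> ({1..n} - M) = {1..n}" "{1..l} \<union> {l+1..n} = {1..n}" using assms tl by auto
  ultimately have "bij_betw s {1..n} {1..n}" by simp
  then have "s permutes {1..n}" by (rule bij_imp_permutes) (use assms in \<open>auto simp: s_def\<close>)
  then show ?thesis using sX sM by (auto simp: bij_betw_def)
qed

lemma blockwise_sing:
  assumes "\<And>B. B \<in> X \<Longrightarrow> card B = 1" "\<sigma> ` \<Union>X = {1..s}"
  shows "blockwise \<sigma> X = sing s"
proof -
  have "blockwise \<sigma> X = blockwise \<sigma> ((\<lambda>i. {i}) ` \<Union>X)" using sing_image[of X] assms(1) by simp
  also have "\<dots> = (\<lambda>i. {i}) ` (\<sigma> ` \<Union>X)" by (simp add: blockwise_def image_image)
  finally show ?thesis using assms(2) by (simp add: sing_def)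
qed

text \<open>\<open>iso_pair\<close> controls the map only on \<open>{1..n}\<close>, so injectivity
  is lifted to sets of subsets of \<open>{1..n}\<close>.\<close>

lemma card_perm_fam:
  assumes "F \<subseteq> Pi_part n k" "bij_betw \<sigma> {1..n} {1..n}"
  shows "card (perm_fam \<sigma> F) = card F"
proof -
  have "inj_on \<sigma> {1..n}" using assms(2) by (rule bij_betw_imp_inj_on)
  then have "inj_on ((`) ((`) \<sigma>)) (Pow (Pow {1..n}))" by (intro inj_on_image_Pow)
  moreover have "F \<subseteq> Pow (Pow {1..n})" using assms(1) Pi_part_Union by fastforce
  ultimately have "inj_on (\<lambda>P. (\<lambda>B. \<sigma> ` B) ` P) F" by (rule inj_on_subset)
  then show ?thesis unfolding perm_fam_def by (rule card_image)
qed

lemma iso_pair_card: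
  assumes "F \<subseteq> Pi_part n k" "G \<subseteq> Pi_part n l" "iso_pair n (F, G) (F', G')"
  shows "card F = card F'" "card G = card G'"
  using assms card_perm_fam by (auto simp: iso_pair_def)

lemma iso_pair_permI:
  assumes "\<sigma> permutes {1..n}" "perm_fam \<sigma> F = F'" "perm_fam \<sigma> G = G'"
  shows "iso_pair n (F, G) (F', G')"
  using assms permutes_imp_bij[OF assms(1)] by (auto simp: iso_pair_def)

section \<open>Cardinalities of the extremal families\<close>

context large_ground_set
begin

lemma singletons_subset: "singletons M \<Longrightarrow> X \<subseteq> M \<Longrightarrow> singletons X"
  by (auto simp: singletons_def)

lemma singletons_card_Union:
  assumes "singletons M"
  shows "card (\<Union>M) = card M" "\<Union>M \<subseteq> {1..n}" "disjoint M" "{} \<notin> M"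
proof -
  have 1: "\<And>B. B \<in> M \<Longrightarrow> card B = 1" using assms by (simp add: singletons_def)
  have "card ((\<lambda>i. {i}) ` \<Union>M) = card (\<Union>M)" by (rule card_image) simp
  then show "card (\<Union>M) = card M" using sing_image[OF 1] by simp
  show "\<Union>M \<subseteq> {1..n}" using assms by (auto simp: singletons_def)
  have "disjoint ((\<lambda>i. {i}) ` \<Union>M)" by (auto simp: disjoint_def)
  then show "disjoint M" using sing_image[OF 1] by simp
  show "{} \<notin> M" using 1 by fastforce
qed

lemma singletons_count:
  assumes "singletons W" "card W \<le> k"
  shows "card {P \<in> Pi_part n k. W \<subseteq> P} = \<phi> k (card W)"
  using card_parts_containing[of "{1..n}" W k] singletons_card_Union[OF assms(1)] assms(2)
  by (simp add: Pi_part_parts \<phi>_def)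

lemma singletons_sing: "s \<le> n \<Longrightarrow> singletons (sing s)" and card_sing: "card (sing s) = s"
  by (auto simp: singletons_def sing_def card_image)

lemma sing_mono: "s \<le> s' \<Longrightarrow> sing s \<subseteq> sing s'"
  by (auto simp: sing_def)

lemma normalize:
  assumes "singletons M" "X \<subseteq> M" "card X = r" "card M = s"
  obtains \<sigma> where "\<sigma> permutes {1..n}" "blockwise \<sigma> X = sing r" "blockwise \<sigma> M = sing s"
proof -
  have sX: "singletons X" using assms singletons_subset by blast
  have "\<Union>X \<subseteq> \<Union>M" using assms by blast
  then obtain \<sigma> where \<sigma>: "\<sigma> permutes {1..n}" "\<sigma> ` \<Union>X = {1..r}" "\<sigma> ` \<Union>M = {1..s}"
    using exists_normalizing_perm[of "\<Union>X" "\<Union>M" n r s] singletons_card_Union[OF sX]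
      singletons_card_Union[OF assms(1)] assms by auto
  then show ?thesis using blockwise_sing[of X \<sigma> r] blockwise_sing[of M \<sigma> s] sX assms(1)
    by (intro that[OF \<sigma>(1)]) (auto simp: singletons_def)
qed

lemma AX_Union: "X \<subseteq> M \<Longrightarrow> AX n k X M = (\<Union>B\<in>M - X. {P \<in> Pi_part n k. insert B X \<subseteq> P})"
  by (auto simp: AX_def)

text \<open>Inclusion-exclusion over the blocks of \<open>M - X\<close>: prescribing a subset Y of
  them leaves the partitions that contain the \<open>t + card Y\<close> singletons of
  \<open>X \<union> Y\<close>.\<close>

lemma card_AX:
  assumes M: "singletons M" "X \<subseteq> M" "card X = t" "card M = l" and l: "t + 2 \<le> l" "l \<le> k"
  shows "int (card (AX n k X M)) = (\<Sum>j = 1..l - t. (-1) ^ (j - 1) * int ((l - t) choose j) * int (\<phi> k (t + j)))"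
proof -
  have finM: "finite M" using M l by (intro card_ge_0_finite) simp
  have finX: "finite X" using M finM finite_subset by blast
  have cMX: "card (M - X) = l - t" using M finX by (simp add: card_Diff_subset)
  define E where "E B = {P \<in> Pi_part n k. insert B X \<subseteq> P}" for B
  have inter: "card (\<Inter>(E ` Y)) = \<phi> k (t + card Y)" if Y: "Y \<subseteq> M - X" "Y \<noteq> {}" for Y
  proof -
    have "\<Inter>(E ` Y) = {P \<in> Pi_part n k. X \<union> Y \<subseteq> P}" using Y by (auto simp: E_def)
    moreover have "singletons (X \<union> Y)" using M Y by (auto simp: singletons_def)
    moreover have fY: "finite Y" using Y finM finite_subset by blast
    moreover have c: "card (X \<union> Y) = t + card Y" using Y M finX fY by (subst card_Un_disjoint) auto
    moreover have "card Y \<le> l - t" using Y finM cMX by (metis card_mono finite_Diff)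
    ultimately show ?thesis using singletons_count[of "X \<union> Y" k] l by simp
  qed
  have "int (card (\<Union>(E ` (M - X)))) = (\<Sum>Y | Y \<subseteq> M - X \<and> Y \<noteq> {}. (- 1) ^ (card Y + 1) * int (card (\<Inter>(E ` Y))))"
  proof -
    interpret Incl_Excl finite "int \<circ> card"
      by standard (auto simp: card_Un_disjnt)
    show ?thesis using restricted_indexed[of "M - X" E] finM by (simp add: E_def)
  qed
  also have "\<dots> = (\<Sum>Y | Y \<subseteq> M - X \<and> Y \<noteq> {}. (- 1) ^ (card Y + 1) * int (\<phi> k (t + card Y)))"
    using inter by (intro sum.cong) auto
  also have "\<dots> = (\<Sum>j = 1..card (M - X). int (card (M - X) choose j) * ((- 1) ^ (j + 1) * int (\<phi> k (t + j))))"
    using finM by (intro sum_nonempty_subsets) simp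
  also have "\<dots> = (\<Sum>j = 1..l - t. (-1) ^ (j - 1) * int ((l - t) choose j) * int (\<phi> k (t + j)))"
  proof (rule sum.cong)
    fix j assume j: "j \<in> {1..l - t}"
    then have "(- 1 :: int) ^ (j + 1) = (- 1) ^ (j - 1)" by (cases j) auto
    then show "int (card (M - X) choose j) * ((- 1) ^ (j + 1) * int (\<phi> k (t + j)))
      = (-1) ^ (j - 1) * int ((l - t) choose j) * int (\<phi> k (t + j))" unfolding cMX by simp
  qed (simp add: cMX)
  finally show ?thesis unfolding AX_Union[OF M(2)] E_def .
qed

text \<open>Bonferroni-type estimates. For the second, one \<open>E B\<close> is kept whole and
  every other one gives up its overlap with it; \<open>AB_less_CD\<close> needs this when the
  leading terms tie. For the third, only members lying in exactly one \<open>E B\<close> are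
  counted.\<close>

lemma AX_bounds:
  assumes M: "singletons M" "X \<subseteq> M" "card X = t" "card M = t + q" and q: "2 \<le> q" "t + q \<le> k"
  shows "card (AX n k X M) \<le> q * \<phi> k (t + 1)"
    and "card (AX n k X M) + (q - 1) * \<phi> k (t + 2) \<le> q * \<phi> k (t + 1)"
    and "q * \<phi> k (t + 1) \<le> card (AX n k X M) + q * q * \<phi> k (t + 2)"
proof -
  have finM: "finite M" using M q by (intro card_ge_0_finite) simp
  have finX: "finite X" using M finM finite_subset by blast
  have cMX: "card (M - X) = q" using M finX by (simp add: card_Diff_subset)
  define Y where "Y = M - X"
  have Y: "finite Y" "card Y = q" using finM cMX by (auto simp: Y_def)
  define E where "E B = {P \<in> Pi_part n k. insert B X \<subseteq> P}" for B
  have fE: "finite (E B)" for B by (simp add: E_def)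
  have A: "AX n k X M = (\<Union>B\<in>Y. E B)" unfolding AX_Union[OF M(2)] E_def Y_def ..
  have sg: "singletons W" if "W \<subseteq> M" for W using that M singletons_subset by blast
  have cE: "card (E B) = \<phi> k (t + 1)" if "B \<in> Y" for B
  proof -
    have "card (insert B X) = t + 1" using that finX M by (simp add: Y_def)
    then show ?thesis using singletons_count[of "insert B X" k] sg[of "insert B X"] that M q
      by (simp add: E_def Y_def)
  qed
  have cEE: "card (E B \<inter> E C) = \<phi> k (t + 2)" if "B \<in> Y" "C \<in> Y" "B \<noteq> C" for B C
  proof -
    have e: "E B \<inter> E C = {P \<in> Pi_part n k. insert B (insert C X) \<subseteq> P}" by (auto simp: E_def)
    have "card (insert B (insert C X)) = t + 2" using that finX M by (simp add: Y_def)
    then show ?thesis unfolding e using singletons_count[of "insert B (insert C X)" k] sg[of "insert B (insert C X)"] that M q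
      by (simp add: Y_def)
  qed
  show "card (AX n k X M) \<le> q * \<phi> k (t + 1)"
    unfolding A Y(2)[symmetric] using cE by (intro card_UN_bound[OF Y(1)]) simp
  show "card (AX n k X M) + (q - 1) * \<phi> k (t + 2) \<le> q * \<phi> k (t + 1)"
  proof -
    have "Y \<noteq> {}" using Y q by auto
    then obtain B where B: "B \<in> Y" by blast
    have "(\<Union>B\<in>Y. E B) = E B \<union> (\<Union>C\<in>Y - {B}. E C - E B)" using B by blast
    then have "card (AX n k X M) \<le> card (E B) + card (\<Union>C\<in>Y - {B}. E C - E B)" unfolding A by (metis card_Un_le)
    also have "card (\<Union>C\<in>Y - {B}. E C - E B) \<le> card (Y - {B}) * (\<phi> k (t + 1) - \<phi> k (t + 2))"
    proof (rule card_UN_bound)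
      fix C assume C: "C \<in> Y - {B}"
      have "card (E C - E B) = card (E C) - card (E C \<inter> E B)"
        by (rule card_Diff_subset_Int) (simp add: fE)
      then show "card (E C - E B) \<le> \<phi> k (t + 1) - \<phi> k (t + 2)" using C B cE[of C] cEE[of C B] by simp
    qed (use Y in simp)
    finally have "card (AX n k X M) \<le> \<phi> k (t + 1) + (q - 1) * (\<phi> k (t + 1) - \<phi> k (t + 2))"
      using cE[OF B] Y B by simp
    moreover obtain d where "\<phi> k (t + 1) = \<phi> k (t + 2) + d"
    proof -
      have "0 < card (Y - {B})" using Y B q by simp
      then have "Y - {B} \<noteq> {}" by (metis card.empty less_irrefl)
      then obtain C where "C \<in> Y" "C \<noteq> B" by blast
      then have "\<phi> k (t + 2) \<le> \<phi> k (t + 1)"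
        using cE[OF B] cEE[OF B, of C] fE[of B] by (metis Int_lower1 card_mono)
      then show ?thesis using that le_Suc_ex by blast
    qed
    moreover obtain q' where "q = Suc q'" using q by (cases q) auto
    ultimately show ?thesis by (simp add: algebra_simps)
  qed
  show "q * \<phi> k (t + 1) \<le> card (AX n k X M) + q * q * \<phi> k (t + 2)"
  proof -
    have "(\<Sum>B\<in>Y. card (E B)) \<le> (\<Sum>B\<in>Y. card (E B - (\<Union>C\<in>Y - {B}. E C)) + q * \<phi> k (t + 2))"
    proof (rule sum_mono)
      fix B assume B: "B \<in> Y"
      have "card (E B) \<le> card (E B - (\<Union>C\<in>Y - {B}. E C)) + card (\<Union>C\<in>Y - {B}. E B \<inter> E C)"
      proof -
        have "E B = (E B - (\<Union>C\<in>Y - {B}. E C)) \<union> (\<Union>C\<in>Y - {B}. E B \<inter> E C)" by blast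
        then show ?thesis by (metis card_Un_le)
      qed
      also have "card (\<Union>C\<in>Y - {B}. E B \<inter> E C) \<le> card (Y - {B}) * \<phi> k (t + 2)"
      proof (rule card_UN_bound)
        fix C assume "C \<in> Y - {B}"
        then show "card (E B \<inter> E C) \<le> \<phi> k (t + 2)"
          using cEE[OF _ B, of C] by (simp add: Int_commute)
      qed (use Y in simp)
      also have "\<dots> \<le> q * \<phi> k (t + 2)" using Y by (intro mult_le_mono1) (metis card_Diff1_le)
      finally show "card (E B) \<le> card (E B - (\<Union>C\<in>Y - {B}. E C)) + q * \<phi> k (t + 2)" by simp
    qed
    also have "\<dots> = (\<Sum>B\<in>Y. card (E B - (\<Union>C\<in>Y - {B}. E C))) + q * (q * \<phi> k (t + 2))"
      using Y by (simp add: sum.distrib)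
    also have "(\<Sum>B\<in>Y. card (E B - (\<Union>C\<in>Y - {B}. E C))) = card (\<Union>B\<in>Y. E B - (\<Union>C\<in>Y - {B}. E C))"
      using Y fE by (intro card_UN_disjoint[symmetric]) auto
    also have "\<dots> \<le> card (AX n k X M)" unfolding A using Y fE by (intro card_mono) auto
    finally show ?thesis using cE Y by (simp add: mult.assoc)
  qed
qed

text \<open>Since l < n, some point r is left uncovered. Hence the exceptional member for x lacks x
  but contains the other blocks of X, so these t partitions are distinct and none of them contains
  X.\<close>

lemma card_BX:
  assumes M: "singletons M" "X \<subseteq> M" "card X = t" "card M = l" and l: "t \<le> l" "l \<le> K"
  shows "card (BX n l X M) = \<phi> l t + t"
proof -
  have finX: "finite X" using M(3) t1 by (metis card.infinite not_one_le_zero)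
  define R where "R = {1..n} - \<Union>M"
  define ex where "ex x = (M - {x}) \<union> {x \<union> R}" for x
  have "l < n" using l N_ge Kta by simp
  then have "\<not> {1..n} \<subseteq> \<Union>M"
    using singletons_card_Union[OF M(1)] M(4) by (metis card_atLeastAtMost card_subset_eq diff_Suc_1 finite_atLeastAtMost less_irrefl subset_antisym)
  then obtain r where "r \<in> {1..n}" "r \<notin> \<Union>M" by blast
  then have r: "r \<in> R" by (simp add: R_def)
  have notin: "x \<notin> ex x" if "x \<in> X" for x
  proof
    assume "x \<in> ex x"
    then have "x = x \<union> R" by (simp add: ex_def)
    then have "r \<in> x" using r by blast
    then show False using r that M(2) by (auto simp: R_def)
  qed
  have is_in: "x \<in> ex y" if "x \<in> X" "x \<noteq> y" for x y using that M(2) by (auto simp: ex_def)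
  have inj: "inj_on ex X" by (rule inj_onI) (metis notin is_in)
  have "BX n l X M = {F \<in> Pi_part n l. X \<subseteq> F} \<union> ex ` X" by (auto simp: BX_def ex_def R_def)
  moreover have "{F \<in> Pi_part n l. X \<subseteq> F} \<inter> ex ` X = {}" using notin by auto
  moreover have "card {F \<in> Pi_part n l. X \<subseteq> F} = \<phi> l t"
    using singletons_count[of X l] singletons_subset[OF M(1,2)] M(3) l by simp
  ultimately show ?thesis using finX M(3) by (simp add: card_Un_disjoint card_image[OF inj])
qed

lemma card_CT: "singletons T \<Longrightarrow> card T = t + 1 \<Longrightarrow> t + 1 \<le> k \<Longrightarrow> card (CT n k T) = \<phi> k (t + 1)"
  using singletons_count[of T k] by (simp add: CT_def)

text \<open>A member contains T or lacks exactly one of its t + 1 blocks. The additive form avoids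
  truncated subtraction.\<close>

lemma card_DT:
  assumes T: "singletons T" "card T = t + 1" and l: "t + 1 \<le> l"
  shows "card (DT n t l T) + t * \<phi> l (t + 1) = (t + 1) * \<phi> l t"
proof -
  have finT: "finite T" using T(2) by (intro card_ge_0_finite) simp
  define A where "A = {F \<in> Pi_part n l. T \<subseteq> F}"
  define D where "D x = {F \<in> Pi_part n l. T - {x} \<subseteq> F}" for x
  have cA: "card A = \<phi> l (t + 1)" using singletons_count[OF T(1), of l] T l by (simp add: A_def)
  have AD: "A \<subseteq> D x" for x by (auto simp: A_def D_def)
  have finA: "finite A" by (simp add: A_def)
  have finD: "finite (D x)" for x by (simp add: D_def)
  have cD: "card (D x - A) = \<phi> l t - \<phi> l (t + 1)" if "x \<in> T" for x
  proof -
    have "card (D x) = \<phi> l t" using singletons_count[of "T - {x}" l] singletons_subset[OF T(1)] that T finT l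
      by (auto simp: D_def)
    then show ?thesis using AD[of x] finA cA by (simp add: card_Diff_subset)
  qed
  have le: "\<phi> l (t + 1) \<le> \<phi> l t"
  proof -
    obtain x where x: "x \<in> T" using T(2) by fastforce
    have "card (D x) = \<phi> l t" using singletons_count[of "T - {x}" l] singletons_subset[OF T(1)] x T finT l
      by (auto simp: D_def)
    then show ?thesis using card_mono[OF finD AD, of x] cA by simp
  qed
  have "DT n t l T = A \<union> (\<Union>x\<in>T. D x - A)"
  proof
    show "DT n t l T \<subseteq> A \<union> (\<Union>x\<in>T. D x - A)"
    proof
      fix F assume F: "F \<in> DT n t l T"
      show "F \<in> A \<union> (\<Union>x\<in>T. D x - A)"
      proof (cases "T \<subseteq> F")
        case False
        then obtain x where x: "x \<in> T" "x \<notin> F" by auto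
        have "T \<inter> F = T - {x}"
        proof (rule card_seteq)
          show "T \<inter> F \<subseteq> T - {x}" "finite (T - {x})" using x finT by auto
          show "card (T - {x}) \<le> card (T \<inter> F)" using F x T finT by (simp add: DT_def)
        qed
        then show ?thesis using F x by (auto simp: A_def D_def DT_def)
      qed (use F in \<open>auto simp: A_def DT_def\<close>)
    qed
    show "A \<union> (\<Union>x\<in>T. D x - A) \<subseteq> DT n t l T"
    proof -
      have "t \<le> card (T \<inter> F)" if "x \<in> T" "T - {x} \<subseteq> F" for x F
      proof -
        have "card (T - {x}) \<le> card (T \<inter> F)" using that finT by (intro card_mono) auto
        then show ?thesis using that T finT by simp
      qed
      moreover have "t \<le> card (T \<inter> F)" if "T \<subseteq> F" for F using that T by (simp add: Int_absorb2)
      ultimately show ?thesis by (auto simp: A_def D_def DT_def)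
    qed
  qed
  moreover have "card (A \<union> (\<Union>x\<in>T. D x - A)) = card A + card (\<Union>x\<in>T. D x - A)"
    using finA finT finD by (intro card_Un_disjoint) auto
  ultimately have "card (DT n t l T) = card A + card (\<Union>x\<in>T. D x - A)" by simp
  also have "card (\<Union>x\<in>T. D x - A) = (\<Sum>x\<in>T. card (D x - A))"
  proof (rule card_UN_disjoint)
    show "\<forall>x\<in>T. \<forall>y\<in>T. x \<noteq> y \<longrightarrow> (D x - A) \<inter> (D y - A) = {}" by (auto simp: D_def A_def)
  qed (use finT finD in auto)
  also have "\<dots> = (t + 1) * (\<phi> l t - \<phi> l (t + 1))" using cD T by simp
  finally have c: "card (DT n t l T) = \<phi> l (t + 1) + (t + 1) * (\<phi> l t - \<phi> l (t + 1))" using cA by simp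
  obtain d where "\<phi> l t = \<phi> l (t + 1) + d" using le le_Suc_ex by blast
  then show ?thesis unfolding c by (simp add: algebra_simps)
qed

end

section \<open>Comparing the bounds\<close>

lemma prod_eq_imp:
  fixes x y :: nat
  assumes "x \<le> X" "y \<le> Y" "x * y = X * Y" "0 < X * Y"
  shows "x = X" "y = Y"
proof -
  have "0 < x * y" using assms(3,4) by simp
  then have pos: "0 < X" "0 < Y" "0 < x" "0 < y" using assms(4) by simp_all
  show "x = X"
  proof (rule ccontr)
    assume "x \<noteq> X"
    then have "x * y < X * y" using assms(1) pos by simp
    also have "\<dots> \<le> X * Y" using assms(2) by simp
    finally show False using assms(3) by simp
  qed
  then show "y = Y" using assms(3) pos by simp
qed

context large_ground_set
begin

lemma AA_eq:
  assumes "singletons M" "X \<subseteq> M" "card X = t" "card M = l" "t + 2 \<le> l" "l \<le> k" "k \<le> K"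
  shows "card (AX n k X M) = card (Afam n k l t)"
proof -
  have "singletons (sing l)" using singletons_sing assms N_ge Kta by simp
  moreover have "sing t \<subseteq> sing l" using assms by (intro sing_mono) simp
  ultimately have "int (card (AX n k X M)) = int (card (AX n k (sing t) (sing l)))"
    using card_AX[OF assms(1-6)] card_AX[of "sing l" "sing t" l k] card_sing assms by simp
  then show ?thesis by (simp add: Afam_def)
qed

lemma card_Afam:
  assumes "t + 2 \<le> l" "l \<le> k" "k \<le> K"
  shows "int (card (Afam n k l t)) = (\<Sum>j = 1..l - t. (-1) ^ (j - 1) * int ((l - t) choose j) * int (\<phi> k (t + j)))"
  unfolding Afam_def
  using singletons_sing sing_mono card_sing assms N_ge Kta by (intro card_AX) auto

lemma card_Bfam: "t + 2 \<le> l \<Longrightarrow> l \<le> K \<Longrightarrow> card (Bfam n l t) = \<phi> l t + t"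
  unfolding Bfam_def
  using singletons_sing[of l] sing_mono[of t l] card_sing N_ge Kta by (intro card_BX) auto

lemma card_Cfam: "t + 2 \<le> k \<Longrightarrow> k \<le> K \<Longrightarrow> card (Cfam n k t) = \<phi> k (t + 1)"
  unfolding Cfam_def using singletons_sing[of "t + 1"] card_sing N_ge by (intro card_CT) auto

lemma card_Dfam: "t + 2 \<le> l \<Longrightarrow> l \<le> K \<Longrightarrow> card (Dfam n l t) + t * \<phi> l (t + 1) = (t + 1) * \<phi> l t"
  unfolding Dfam_def using singletons_sing[of "t + 1"] card_sing N_ge by (intro card_DT) auto

lemma DD_eq:
  assumes "singletons T" "card T = t + 1" "t + 2 \<le> l" "l \<le> K"
  shows "card (DT n t l T) = card (Dfam n l t)"
  using card_DT[OF assms(1,2), of l] card_Dfam[of l] assms by simp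

lemma iso_AB:
  assumes M: "X \<subseteq> M" "card M = l" "card X = t" "singletons M"
    and FG: "FF = AX n k X M" "GG = BX n l X M"
  shows "iso_pair n (FF, GG) (Afam n k l t, Bfam n l t)"
proof -
  obtain \<sigma> where s: "\<sigma> permutes {1..n}" "blockwise \<sigma> X = sing t" "blockwise \<sigma> M = sing l"
    by (rule normalize[OF M(4,1,3,2)])
  show ?thesis unfolding FG Afam_def Bfam_def
    using perm_fam_AX[OF s(1)] perm_fam_BX[OF s(1)] s by (intro iso_pair_permI[OF s(1)]) auto
qed

lemma iso_CD:
  assumes T: "card T = t + 1" "singletons T"
    and FG: "FF = CT n k T" "GG = DT n t l T"
  shows "iso_pair n (FF, GG) (Cfam n k t, Dfam n l t)"
proof -
  obtain \<sigma> where s: "\<sigma> permutes {1..n}" "blockwise \<sigma> T = sing (t + 1)"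
    by (rule normalize[OF T(2) subset_refl T(1,1)])
  show ?thesis unfolding FG Cfam_def Dfam_def
    using perm_fam_CT[OF s(1)] perm_fam_DT[OF s(1)] s by (intro iso_pair_permI[OF s(1)]) auto
qed

lemma finite_extremal [simp]: "finite (AX n k X M)" "finite (CT n k X)" "finite (DT n t k X)"
  by (simp_all add: AX_def CT_def DT_def)

lemma finite_BX: "finite X \<Longrightarrow> finite (BX n l X M)"
  by (simp add: BX_def)

lemma AX_le:
  assumes "X \<subseteq> M" "card X = t" "card M = t + q" "finite M" "t + 2 \<le> k"
  shows "card (AX n k X M) \<le> q * \<phi> k (t + 1)"
proof -
  have finX: "finite X" using assms finite_subset by blast
  have "card (M - X) = q" using assms finX by (simp add: card_Diff_subset)
  moreover have "card (\<Union>B\<in>M - X. {P \<in> Pi_part n k. insert B X \<subseteq> P}) \<le> card (M - X) * \<phi> k (t + 1)"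
  proof (rule card_UN_bound)
    fix B assume "B \<in> M - X"
    then have "card (insert B X) = t + 1" using finX assms by simp
    then show "card {P \<in> Pi_part n k. insert B X \<subseteq> P} \<le> \<phi> k (t + 1)"
      using card_containing_le[of "insert B X" k n] finX assms by (simp add: \<phi>_def)
  qed (use assms in simp)
  ultimately show ?thesis unfolding AX_Union[OF assms(1)] by simp
qed

text \<open>The common unit for the extremal products; \<open>\<theta>'\<close> is the unit with the
  roles of \<open>K\<close> and \<open>l\<close> interchanged.\<close>

definition \<theta> where "\<theta> l = \<phi> K (t + 1) * \<phi> l t"
definition \<theta>' where "\<theta>' l = \<phi> l (t + 1) * \<phi> K t"

context
  fixes l :: nat
  assumes l: "t + 2 \<le> l" "l \<le> K"
begin


lemma theta_pos: "0 < \<theta> l"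
  using phi_pos[of "t + 1" K] phi_pos[of t l] l K by (simp add: \<theta>_def)

lemma Afam_low:
  assumes "t + 3 \<le> K"
  shows "4 * ((l - t) * \<theta> l) \<le> 4 * (card (Afam n K l t) * \<phi> l t) + \<theta> l"
proof -
  define q where "q = l - t"
  have q: "2 \<le> q" "t + q \<le> K" "l = t + q" "q \<le> a" using l Kta by (auto simp: q_def)
  have s: "singletons (sing l)" using singletons_sing l N_ge Kta by simp
  have "q * \<phi> K (t + 1) \<le> card (Afam n K l t) + q * q * \<phi> K (t + 2)"
    unfolding Afam_def using AX_bounds(3)[OF s sing_mono, of t q K] card_sing q by simp
  moreover have "4 * (q * q * \<phi> K (t + 2)) \<le> \<phi> K (t + 1)"
  proof -
    have "4 * (q * q) \<le> 4 * ((a + 1) * (a + 1))" using q by (intro mult_le_mono2 mult_le_mono) auto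
    then have "4 * (q * q) * \<phi> K (t + 2) \<le> Q\<^sup>2 * \<phi> K (t + 2)" using Q_sq by (intro mult_le_mono1) simp
    also have "\<dots> \<le> \<phi> K (t + 1)" using phi_ratio[of "t + 1" K] assms by (simp add: eval_nat_numeral)
    finally show ?thesis by (simp only: mult.assoc)
  qed
  ultimately have "4 * (q * \<phi> K (t + 1)) \<le> 4 * card (Afam n K l t) + \<phi> K (t + 1)" by linarith
  then have "4 * (q * \<phi> K (t + 1)) * \<phi> l t \<le> (4 * card (Afam n K l t) + \<phi> K (t + 1)) * \<phi> l t"
    by (rule mult_le_mono1)
  then show ?thesis unfolding \<theta>_def q_def[symmetric] by (simp add: algebra_simps)
qed

lemma Dfam_low: "4 * ((t + 1) * \<theta> l) \<le> 4 * (card (Cfam n K t) * card (Dfam n l t)) + \<theta> l"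
proof -
  have "4 * t \<le> 4 * (t * ((a + 1) * (a + 1)))" by simp
  then have "4 * t * \<phi> l (t + 1) \<le> Q\<^sup>2 * \<phi> l (t + 1)" using Q_sq_t by (intro mult_le_mono1) linarith
  also have "\<dots> \<le> \<phi> l t" using phi_ratio[of t l] l by simp
  finally have "4 * ((t + 1) * \<phi> l t) \<le> 4 * card (Dfam n l t) + \<phi> l t"
    using card_Dfam[OF l] by simp
  then have "\<phi> K (t + 1) * (4 * ((t + 1) * \<phi> l t)) \<le> \<phi> K (t + 1) * (4 * card (Dfam n l t) + \<phi> l t)"
    by (rule mult_le_mono2)
  then show ?thesis unfolding \<theta>_def using card_Cfam[OF K] by (simp add: algebra_simps)
qed

section \<open>Interchanging the two block numbers\<close>

lemma swap_ratio:
  assumes "l < K"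
  shows "(1 - \<epsilon>)\<^sup>2 * ((real (a - 1) * real (l - t)) / (real a * real (l - t - 1))) ^ (N - 1) * real (\<theta>' l) \<le> real (\<theta> l)"
proof -
  have "l - t < a" "2 \<le> l - t" using assms l Kta by auto
  note c = Stirling_ratio_compare[OF this(2,1) order_refl]
  have e: "\<phi> K t = Stirling N a" "\<phi> K (t + 1) = Stirling (N - 1) (a - 1)"
    "\<phi> l t = Stirling N (l - t)" "\<phi> l (t + 1) = Stirling (N - 1) (l - t - 1)"
    by (simp_all add: \<phi>_def N_def a_def)
  show ?thesis using c unfolding \<theta>_def \<theta>'_def e of_nat_mult by (simp only: mult.commute)
qed

lemma max_le: "real (max (l - t) (t + 1)) * \<epsilon> \<le> 1 / 4"
proof -
  have "real (l - t) * \<epsilon> \<le> real a * \<epsilon>" using l Kta eps by (intro mult_right_mono) auto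
  then show ?thesis using eps by (auto simp: max_def)
qed

text \<open>The base in \<open>swap_ratio\<close> is \<open>1 + z\<close> with
  \<open>z = d / (a * (b - 1))\<close>. As \<open>N - 1 \<ge> 4 * a\<close>, Bernoulli makes its
  power at least \<open>1 + 4 * d / (b - 1)\<close>. Interchanging the roles raises the coefficient
  by at most d, which this factor outweighs.\<close>

lemma swap_large:
  assumes lK: "l < K"
  shows "4 * ((max a (t + 1) + 1) * \<theta>' l) + \<theta> l < 4 * (max (l - t) (t + 1) * \<theta> l)"
proof -
  define b d c where "b = l - t" and "d = a - b" and "c = max b (t + 1)"
  have b: "2 \<le> b" "b + d = a" "1 \<le> d" "b \<le> c" using lK l Kta by (auto simp: b_def d_def c_def)
  define z where "z = real d / (real a * real (b - 1))"
  have z: "(real (a - 1) * real b) / (real a * real (b - 1)) = 1 + z"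
  proof -
    have "real (a - 1) * real b = real a * real (b - 1) + real d"
    proof -
      obtain b' where "b = Suc b'" using b by (cases b) auto
      then show ?thesis using b(2)[symmetric] by (simp add: algebra_simps)
    qed
    moreover have "real a * real (b - 1) \<noteq> 0" using b a2 by simp
    ultimately show ?thesis unfolding z_def by (metis add_divide_distrib divide_self)
  qed
  have z0: "0 \<le> z" by (simp add: z_def)
  have "4 * real d / real (b - 1) \<le> real (N - 1) * z"
  proof -
    have "4 * real a \<le> real (N - 1)" using N_ge by simp
    then have "(4 * real a) * z \<le> real (N - 1) * z" using z0 by (intro mult_right_mono)
    moreover have "(4 * real a) * z = 4 * real d / real (b - 1)" using b by (simp add: z_def)
    ultimately show ?thesis by simp
  qed
  moreover have "1 + real (N - 1) * z \<le> (1 + z) ^ (N - 1)" using z0 by (intro Bernoulli_inequality) simp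
  ultimately have Z: "1 + 4 * real d / real (b - 1) \<le> (1 + z) ^ (N - 1)" by simp
  have th: "(1 - \<epsilon>)\<^sup>2 * (1 + z) ^ (N - 1) * real (\<theta>' l) \<le> real (\<theta> l)"
    using swap_ratio[OF lK] z unfolding b_def by (simp add: b_def[symmetric])
  have c1: "real c * \<epsilon> \<le> 1 / 4" using max_le by (simp add: c_def b_def)
  have cpos: "1 \<le> real c" using b by simp
  have e2: "1 - 2 * \<epsilon> \<le> (1 - \<epsilon>)\<^sup>2" by (simp add: power2_eq_square algebra_simps)
  \<comment> \<open>The loss \<open>(1 - \<epsilon>)^2\<close> costs at most 2, since
    \<open>c * \<epsilon>\<close> is at most 1/4.\<close>
  have "4 * real c - 3 \<le> (4 * real c - 1) * (1 - 2 * \<epsilon>)"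
    using c1 eps by (simp add: algebra_simps)
  also have "\<dots> \<le> (4 * real c - 1) * (1 - \<epsilon>)\<^sup>2" using e2 cpos by (intro mult_left_mono) auto
  finally have 1: "4 * real c - 3 \<le> (4 * real c - 1) * (1 - \<epsilon>)\<^sup>2" .
  \<comment> \<open>From b at most c the correction is at least \<open>16 * d\<close>, and
    \<open>12 * d > 7\<close>.\<close>
  have "4 * real c + 4 * real d + 4 < (4 * real c - 3) * (1 + 4 * real d / real (b - 1))"
  proof -
    have b1: "0 < real (b - 1)" using b by simp
    have bc: "real (b - 1) \<le> 4 * real c - 3" using b cpos by (simp add: of_nat_diff)
    have "1 * (4 * real d) \<le> ((4 * real c - 3) / real (b - 1)) * (4 * real d)"
      using bc b1 by (intro mult_right_mono) (auto simp: le_divide_eq)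
    moreover have "4 * (4 * real d) \<le> ((4 * real c - 3) / real (b - 1)) * (4 * real d)"
    proof (rule mult_right_mono)
      have "4 * real (b - 1) \<le> 4 * real c - 3" using b by (simp add: of_nat_diff)
      then show "4 \<le> (4 * real c - 3) / real (b - 1)" using b1 by (simp add: le_divide_eq)
    qed simp
    ultimately show ?thesis using b by (simp add: algebra_simps)
  qed
  also have "\<dots> \<le> ((4 * real c - 1) * (1 - \<epsilon>)\<^sup>2) * (1 + z) ^ (N - 1)"
    using 1 Z cpos by (intro mult_mono) auto
  finally have 2: "4 * real c + 4 * real d + 4 < (4 * real c - 1) * ((1 - \<epsilon>)\<^sup>2 * (1 + z) ^ (N - 1))"
    by (simp add: mult.assoc)
  have mx: "max a (t + 1) \<le> c + d" using b by (auto simp: c_def)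
  have tp: "0 < real (\<theta>' l)" using phi_pos[of "t + 1" l] phi_pos[of t K] l K by (simp add: \<theta>'_def)
  have "4 * (real (max a (t + 1) + 1) * real (\<theta>' l)) \<le> (4 * real c + 4 * real d + 4) * real (\<theta>' l)"
  proof -
    have "real (max a (t + 1) + 1) \<le> real (c + d + 1)" using mx by (intro of_nat_mono) simp
    then have "real (max a (t + 1) + 1) * real (\<theta>' l) \<le> real (c + d + 1) * real (\<theta>' l)" by (intro mult_right_mono) auto
    then show ?thesis by (simp add: algebra_simps)
  qed
  also have "\<dots> < (4 * real c - 1) * ((1 - \<epsilon>)\<^sup>2 * (1 + z) ^ (N - 1)) * real (\<theta>' l)"
    using 2 tp by (intro mult_strict_right_mono)
  also have "\<dots> = (4 * real c - 1) * ((1 - \<epsilon>)\<^sup>2 * (1 + z) ^ (N - 1) * real (\<theta>' l))" by (simp only: mult.assoc)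
  also have "\<dots> \<le> (4 * real c - 1) * real (\<theta> l)" using th cpos by (intro mult_left_mono) auto
  finally have "real (4 * ((max a (t + 1) + 1) * \<theta>' l) + \<theta> l) < real (4 * (c * \<theta> l))"
    by (simp add: algebra_simps)
  then show ?thesis unfolding c_def b_def of_nat_less_iff .
qed

text \<open>\<open>(4 / 3) ^ 3 > 2\<close>, so cubes are compared.\<close>

lemma four_thirds_pow: "(real Q)\<^sup>2 \<le> (4 / 3) ^ (N - 1)" if a3: "3 \<le> a"
proof (rule power_le_imp_le_base[where n = 2])
  have "Q ^ 6 \<le> Q ^ (2 * a + 2)" using Q_ge(3) a3 by (intro power_increasing) auto
  also have "\<dots> \<le> 2 ^ (t + 1) * Q ^ (2 * a + 2)" by simp
  also have "\<dots> \<le> 2 ^ (N - 1)" by (rule two_pow)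
  finally have "real (Q ^ 6) \<le> real (2 ^ (N - 1))" by (rule of_nat_mono)
  then have "(real Q) ^ 6 \<le> 2 ^ (N - 1)" by simp
  also have "\<dots> \<le> ((4 / 3) ^ 3) ^ (N - 1)" by (intro power_mono) (auto simp: power3_eq_cube)
  also have "((4 / 3 :: real) ^ 3) ^ (N - 1) = ((4 / 3) ^ (N - 1)) ^ 3"
    by (simp only: power_mult[symmetric] mult.commute)
  also have "real Q ^ 6 = ((real Q)\<^sup>2) ^ 3" by (simp flip: power_mult)
  finally show "((real Q)\<^sup>2) ^ Suc 2 \<le> ((4 / 3) ^ (N - 1)) ^ Suc 2"
    by (simp only: Suc_numeral arith_simps semiring_norm)
qed simp

text \<open>For l = t + 2 the base in \<open>swap_ratio\<close> is \<open>2 * (a - 1) / a\<close>,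
  at least 4/3. Hence \<open>\<theta> l\<close> exceeds \<open>\<theta>' l\<close> by a factor of at
  least \<open>3 / 4 * Q^2\<close>, while \<open>crude_bound\<close> costs only
  \<open>(t + 2) * Q / 2\<close>.\<close>

lemma swap_crude:
  assumes l2: "l = t + 2" and lK: "l < K" and P: "2 * P \<le> (a + 1) * ((t + 2) * (t + 1)) * \<phi> K t"
  shows "4 * P + \<theta> l < 4 * (max (l - t) (t + 1) * \<theta> l)"
proof -
  have a3: "3 \<le> a" using l2 lK Kta by simp
  have th': "\<theta>' l = \<phi> K t" unfolding \<theta>'_def l2 phi_2(2) by simp
  have "4 / 3 \<le> (real (a - 1) * real (l - t)) / (real a * real (l - t - 1))"
    using a3 l2 by (simp add: field_simps of_nat_diff)
  then have "(4 / 3) ^ (N - 1) \<le> ((real (a - 1) * real (l - t)) / (real a * real (l - t - 1))) ^ (N - 1)"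
    by (intro power_mono) auto
  then have Z: "(real Q)\<^sup>2 \<le> ((real (a - 1) * real (l - t)) / (real a * real (l - t - 1))) ^ (N - 1)"
    using four_thirds_pow[OF a3] by linarith
  have e2: "3 / 4 \<le> (1 - \<epsilon>)\<^sup>2"
  proof -
    have "1 - 2 * \<epsilon> \<le> (1 - \<epsilon>)\<^sup>2" by (simp add: power2_eq_square algebra_simps)
    then show ?thesis using eps by simp
  qed
  have "3 / 4 * (real Q)\<^sup>2 \<le> (1 - \<epsilon>)\<^sup>2 * ((real (a - 1) * real (l - t)) / (real a * real (l - t - 1))) ^ (N - 1)"
    using e2 Z by (intro mult_mono) auto
  then have "3 / 4 * (real Q)\<^sup>2 * real (\<theta>' l) \<le> (1 - \<epsilon>)\<^sup>2 * ((real (a - 1) * real (l - t)) / (real a * real (l - t - 1))) ^ (N - 1) * real (\<theta>' l)"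
    by (intro mult_right_mono) auto
  then have th: "3 / 4 * (real Q)\<^sup>2 * real (\<theta>' l) \<le> real (\<theta> l)" using swap_ratio[OF lK] by linarith
  have "3 * (real Q)\<^sup>2 * real (\<theta>' l) \<le> real (4 * \<theta> l)" using th by simp
  then have "real (3 * Q\<^sup>2 * \<theta>' l) \<le> real (4 * \<theta> l)" by simp
  then have th: "3 * Q\<^sup>2 * \<theta>' l \<le> 4 * \<theta> l" unfolding of_nat_le_iff .
  have tp: "0 < \<theta>' l" using phi_pos[of t K] K by (simp add: th')
  have "4 * P \<le> 2 * ((t + 2) * Q) * \<theta>' l" using P unfolding th' Q_def by (simp add: algebra_simps)
  also have "2 * ((t + 2) * Q) \<le> Q\<^sup>2"
  proof -
    have "2 * (t + 2) \<le> Q" using Q_ge(2) t1 by simp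
    then have "2 * (t + 2) * Q \<le> Q * Q" by (rule mult_le_mono1)
    then show ?thesis by (simp add: power2_eq_square)
  qed
  finally have "4 * P \<le> Q\<^sup>2 * \<theta>' l" by simp
  then have "3 * (4 * P) \<le> 4 * \<theta> l" using th by simp
  moreover have "2 * \<theta> l \<le> max (l - t) (t + 1) * \<theta> l" using t1 by (intro mult_le_mono1) auto
  ultimately show ?thesis using theta_pos by linarith
qed

text \<open>With q = l - t the leading coefficients are q and t + 1. If q is at most t they decide.
  If q = t + 1 they tie, and the claim reduces to \<open>main\<close>: essentially
  \<open>\<phi> l t / \<phi> l (t + 1)\<close> must exceed
  \<open>\<phi> K (t + 1) / \<phi> K (t + 2)\<close>.\<close>

lemma AB_less_CD:
  assumes "l \<le> 2 * t + 1" "t + 3 \<le> K" and ex: "(K, l) \<notin> {(2 * t + 1, 2 * t + 1), (4, 3)}"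
  shows "card (Afam n K l t) * (\<phi> l t + t) < \<phi> K (t + 1) * card (Dfam n l t)"
proof -
  define q where "q = l - t"
  have q: "2 \<le> q" "t + q \<le> K" "l = t + q" "q \<le> a" "q \<le> t + 1" using l Kta assms by (auto simp: q_def)
  have s: "singletons (sing l)" using singletons_sing l N_ge Kta by simp
  have A1: "card (Afam n K l t) \<le> q * \<phi> K (t + 1)"
    and A2: "card (Afam n K l t) + (q - 1) * \<phi> K (t + 2) \<le> q * \<phi> K (t + 1)"
    unfolding Afam_def using AX_bounds(1,2)[OF s sing_mono, of t q K] card_sing q by simp_all
  have g1: "1 \<le> \<phi> l (t + 1)" using phi_pos[of "t + 1" l] l by simp
  have f1: "1 \<le> \<phi> K (t + 1)" using phi_pos[of "t + 1" K] assms by simp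
  have gr: "Q\<^sup>2 * \<phi> l (t + 1) \<le> \<phi> l t" using phi_ratio[of t l] l by simp
  have Qt: "9 * ((t + 1) * (t + 1)) \<le> Q\<^sup>2"
    using mult_le_mono[OF Q_ge(2) Q_ge(2)] by (simp add: power2_eq_square algebra_simps)
  note D = card_Dfam[OF l]
  show ?thesis
  proof (cases "q \<le> t")
    case True
    have "(t * t + t) * \<phi> l (t + 1) < \<phi> l t"
    proof -
      have "(t * t + t) < Q\<^sup>2" using Qt by simp
      then have "(t * t + t) * \<phi> l (t + 1) < Q\<^sup>2 * \<phi> l (t + 1)" using g1 by simp
      then show ?thesis using gr by (rule less_le_trans)
    qed
    then have "t * (t * \<phi> l (t + 1)) + t * \<phi> l (t + 1) < \<phi> l t" by (simp only: add_mult_distrib mult.assoc)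
    moreover have "t * t \<le> t * (t * \<phi> l (t + 1))" using mult_le_mono2[OF g1, of t] by (intro mult_le_mono2) simp
    moreover have "card (Dfam n l t) + t * \<phi> l (t + 1) = t * \<phi> l t + \<phi> l t" using D by simp
    ultimately have "t * \<phi> l t + t * t < card (Dfam n l t)" by linarith
    then have "t * (\<phi> l t + t) < card (Dfam n l t)" by (simp only: distrib_left)
    then have "\<phi> K (t + 1) * (t * (\<phi> l t + t)) < \<phi> K (t + 1) * card (Dfam n l t)" using f1 by simp
    moreover have "card (Afam n K l t) * (\<phi> l t + t) \<le> (t * \<phi> K (t + 1)) * (\<phi> l t + t)"
      using A1 True by (intro mult_le_mono1) (meson le_trans mult_le_mono1)
    moreover have "(t * \<phi> K (t + 1)) * (\<phi> l t + t) = \<phi> K (t + 1) * (t * (\<phi> l t + t))"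
      by (simp only: mult_ac)
    ultimately show ?thesis by linarith
  next
    case False
    then have qt: "q = t + 1" using q by simp
    \<comment> \<open>Here l = 2 t + 1, so the excluded pair with equal entries is exactly the case
      K = l.\<close>
    have aq: "q + 1 \<le> a" using ex qt q assms Kta by auto
    have e: "0 < 1 - \<epsilon>" using eps by simp
    define u where "u = (real (a - 1) / real (a - 2)) ^ (N - 2)"
    have up: "(1 - \<epsilon>) * real (\<phi> K (t + 1)) \<le> u * real (\<phi> K (t + 2))"
    proof -
      have "a - 1 - 1 = a - 2" "N - 1 - 1 = N - 2" by auto
      moreover have "\<phi> K (t + 1) = Stirling (N - 1) (a - 1)" "\<phi> K (t + 2) = Stirling (N - 2) (a - 2)"
        by (simp_all add: \<phi>_def N_def a_def)
      ultimately show ?thesis using Stirling_ratio_up[of "a - 1" "N - 1"] aq q(1) N_ge by (simp add: u_def)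
    qed
    have u0: "0 < u" using aq q by (simp add: u_def)
    have main: "(t + 1) * \<phi> K (t + 1) + \<phi> K (t + 1) * \<phi> l (t + 1) < \<phi> K (t + 2) * \<phi> l t"
    proof (cases "t = 1")
      case t1': True
      \<comment> \<open>For t = 1 a factor 3 has to be beaten. The exclusion of (4, 3) gives a at
        least 4, so u is at most \<open>(3/2) ^ (N - 2)\<close>, far below
        \<open>\<phi> l t = 2 ^ (N - 1) - 1\<close>; for K = 4 it would be
        \<open>2 ^ (N - 2)\<close>.\<close>
      then have l3: "l = t + 2" and a4: "4 \<le> a" using qt q ex Kta aq by auto
      have "u \<le> (3 / 2) ^ (N - 2)" unfolding u_def
        using a4 by (intro power_mono) (auto simp: field_simps of_nat_diff)
      then have "(1 - \<epsilon>) * real (\<phi> K (t + 1)) \<le> (3 / 2) ^ (N - 2) * real (\<phi> K (t + 2))"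
        using up by (meson mult_right_mono of_nat_0_le_iff order_trans)
      moreover have "7 / 8 * real (\<phi> K (t + 1)) \<le> (1 - \<epsilon>) * real (\<phi> K (t + 1))"
        using eps by (intro mult_right_mono) auto
      ultimately have 1: "7 / 8 * real (\<phi> K (t + 1)) \<le> (3 / 2) ^ (N - 2) * real (\<phi> K (t + 2))" by linarith
      have f2: "1 \<le> real (\<phi> K (t + 2))" using phi_pos[of "t + 2" K] assms(2) by simp
      obtain N' where N': "N = Suc (Suc N')" using N_Suc by blast
      have "8 \<le> 1 + real N' * (1 / 3)" using N_ge N' a4 t1' by simp
      also have "\<dots> \<le> (1 + 1 / 3) ^ N'" by (rule Bernoulli_inequality) simp
      finally have "8 * (3 / 2) ^ N' \<le> (1 + 1 / 3) ^ N' * (3 / 2 :: real) ^ N'" by (intro mult_right_mono) auto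
      also have "\<dots> = 2 ^ N'" by (simp add: power_mult_distrib[symmetric])
      finally have 2: "8 * (3 / 2 :: real) ^ N' \<le> 2 ^ N'" .
      have one: "1 \<le> (3 / 2 :: real) ^ N'" by simp
      have "real (\<phi> l t) = 2 * 2 ^ N' - 1" unfolding l3 phi_2 N' by (simp add: of_nat_diff)
      then have "8 * (3 / 2) ^ N' < real (\<phi> l t)" using 2 one by linarith
      then have "8 * (3 / 2) ^ N' * real (\<phi> K (t + 2)) < real (\<phi> l t) * real (\<phi> K (t + 2))"
        using f2 by (intro mult_strict_right_mono) auto
      moreover have "3 * real (\<phi> K (t + 1)) \<le> 8 * ((3 / 2) ^ N' * real (\<phi> K (t + 2)))" using 1 N' by simp
      ultimately have "real (3 * \<phi> K (t + 1)) < real (\<phi> K (t + 2) * \<phi> l t)" by (simp add: algebra_simps)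
      then have "3 * \<phi> K (t + 1) < \<phi> K (t + 2) * \<phi> l t" unfolding of_nat_less_iff .
      moreover have "(t + 1) * \<phi> K (t + 1) + \<phi> K (t + 1) * \<phi> l (t + 1) = 3 * \<phi> K (t + 1)"
        unfolding l3 phi_2(2) by (simp add: t1')
      ultimately show ?thesis by simp
    next
      case False
      then have t2: "2 \<le> t" using t1 by simp
      define v where "v = (real q / real (q - 1)) ^ (N - 1)"
      have low: "(1 - \<epsilon>) * v * real (\<phi> l (t + 1)) \<le> real (\<phi> l t)"
        using Stirling_ratio_low[of q N] q by (simp add: v_def \<phi>_def N_def)
      \<comment> \<open>The bases satisfy \<open>(a - 1) / (a - 2) \<le> q / (q - 1)\<close>, and v
        has one more factor than u. This extra factor \<open>(t + 1) / t\<close> is the whole gain;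
        the terms \<open>1 - \<epsilon>\<close> and the summand
        \<open>(t + 1) * \<phi> K (t + 1)\<close> take at most half of its excess over 1
        each.\<close>
      have uv: "(real (t + 1) / real t) * u \<le> v"
      proof -
        have "N - 1 = Suc (N - 2)" using N_ge by simp
        moreover have "real (a - 1) / real (a - 2) \<le> real q / real (q - 1)"
        proof -
          obtain i where i: "a = q + 1 + i" using aq le_Suc_ex by blast
          obtain q' where "q = Suc (Suc q')" using q(1) by (metis Suc_le_D numeral_2_eq_2 Suc_le_mono)
          then show ?thesis using i by (simp add: field_simps)
        qed
        then have "u \<le> (real q / real (q - 1)) ^ (N - 2)" unfolding u_def by (intro power_mono) auto
        then have "(real q / real (q - 1)) * u \<le> (real q / real (q - 1)) * (real q / real (q - 1)) ^ (N - 2)"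
          by (intro mult_left_mono) auto
        ultimately show ?thesis unfolding v_def using qt by simp
      qed
      have "(1 - \<epsilon>) * real (\<phi> K (t + 1)) * ((1 - \<epsilon>) * v * real (\<phi> l (t + 1)))
         \<le> u * real (\<phi> K (t + 2)) * real (\<phi> l t)"
        by (rule mult_mono[OF up low]) (use e u0 in \<open>auto simp: v_def\<close>)
      moreover have "(1 - \<epsilon>) * real (\<phi> K (t + 1)) * ((1 - \<epsilon>) * ((real (t + 1) / real t) * u) * real (\<phi> l (t + 1)))
        \<le> (1 - \<epsilon>) * real (\<phi> K (t + 1)) * ((1 - \<epsilon>) * v * real (\<phi> l (t + 1)))"
        using uv e by (intro mult_left_mono mult_right_mono) auto
      ultimately have "u * ((1 - \<epsilon>)\<^sup>2 * (real (t + 1) / real t) * (real (\<phi> K (t + 1)) * real (\<phi> l (t + 1))))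
         \<le> u * (real (\<phi> K (t + 2)) * real (\<phi> l t))"
        by (simp add: power2_eq_square mult_ac)
      then have r: "(1 - \<epsilon>)\<^sup>2 * (real (t + 1) / real t) * (real (\<phi> K (t + 1)) * real (\<phi> l (t + 1)))
         \<le> real (\<phi> K (t + 2)) * real (\<phi> l t)" using u0 by (rule mult_left_le_imp_le)
      have "1 + 1 / (2 * real t) \<le> (1 - \<epsilon>)\<^sup>2 * (real (t + 1) / real t)"
      proof -
        have "(1 - 2 * \<epsilon>) * real (t + 1) \<le> (1 - \<epsilon>)\<^sup>2 * real (t + 1)"
          by (intro mult_right_mono) (auto simp: power2_eq_square algebra_simps)
        moreover have "real t + 1 / 2 \<le> (1 - 2 * \<epsilon>) * real (t + 1)" using eps(4) by (simp add: algebra_simps)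
        ultimately have "real t + 1 / 2 \<le> (1 - \<epsilon>)\<^sup>2 * real (t + 1)" by linarith
        then have "(real t + 1 / 2) / real t \<le> ((1 - \<epsilon>)\<^sup>2 * real (t + 1)) / real t"
          by (intro divide_right_mono) auto
        moreover have "(real t + 1 / 2) / real t = 1 + 1 / (2 * real t)"
          using t2 by (simp add: add_divide_distrib)
        ultimately show ?thesis by simp
      qed
      then have "(1 + 1 / (2 * real t)) * (real (\<phi> K (t + 1)) * real (\<phi> l (t + 1)))
        \<le> (1 - \<epsilon>)\<^sup>2 * (real (t + 1) / real t) * (real (\<phi> K (t + 1)) * real (\<phi> l (t + 1)))"
        by (intro mult_right_mono) auto
      with r have r2: "(1 + 1 / (2 * real t)) * (real (\<phi> K (t + 1)) * real (\<phi> l (t + 1))) \<le> real (\<phi> K (t + 2)) * real (\<phi> l t)"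
        by linarith
      have "2 * t * (t + 1) < \<phi> l (t + 1)"
      proof -
        have "Q\<^sup>2 * \<phi> l (t + 2) \<le> \<phi> l (t + 1)" using phi_ratio[of "t + 1" l] l q qt t2 by (simp add: eval_nat_numeral)
        moreover have "1 \<le> \<phi> l (t + 2)" using phi_pos[of "t + 2" l] l q qt t2 by simp
        ultimately have "Q\<^sup>2 \<le> \<phi> l (t + 1)" by (metis le_trans mult_le_mono2 nat_mult_1_right)
        then show ?thesis using Qt by simp
      qed
      then have "real (2 * t * (t + 1)) < real (\<phi> l (t + 1))" by (rule of_nat_less_iff[THEN iffD2])
      then have "real (t + 1) < 1 / (2 * real t) * real (\<phi> l (t + 1))" using t2 by (simp add: field_simps)
      then have "real (\<phi> K (t + 1)) * real (t + 1) < real (\<phi> K (t + 1)) * (1 / (2 * real t) * real (\<phi> l (t + 1)))"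
        using f1 by (intro mult_strict_left_mono) auto
      then have "real ((t + 1) * \<phi> K (t + 1) + \<phi> K (t + 1) * \<phi> l (t + 1)) < real (\<phi> K (t + 2) * \<phi> l t)"
        using r2 by (simp add: algebra_simps)
      then show ?thesis unfolding of_nat_less_iff .
    qed
    define x y z w where "x = \<phi> K (t + 1)" and "y = \<phi> K (t + 2)" and "z = \<phi> l t" and "w = \<phi> l (t + 1)"
    have A2': "card (Afam n K l t) + t * y \<le> (t + 1) * x" using A2 qt by (simp add: x_def y_def)
    have "(card (Afam n K l t) + t * y) * (z + t) \<le> ((t + 1) * x) * (z + t)" using A2' by (rule mult_le_mono1)
    then have i1: "card (Afam n K l t) * (z + t) + t * (y * z) \<le> (t + 1) * x * z + t * ((t + 1) * x)"
      by (simp add: algebra_simps)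
    have "t * ((t + 1) * x + x * w) < t * (y * z)" using main t1 unfolding x_def y_def z_def w_def by simp
    then have i2: "t * ((t + 1) * x) + t * (x * w) < t * (y * z)" by (simp add: distrib_left)
    have "x * (card (Dfam n l t) + t * w) = x * ((t + 1) * z)" using D unfolding w_def z_def by simp
    then have i3: "x * card (Dfam n l t) + t * (x * w) = (t + 1) * x * z" by (simp add: algebra_simps)
    show ?thesis using i1 i2 i3 unfolding x_def[symmetric] z_def[symmetric] by linarith
  qed
qed

end

end

section \<open>The product bound\<close>

lemma iso_pair_swap: "iso_pair n (F, G) (F', G') \<Longrightarrow> iso_pair n (G, F) (G', F')"
  by (auto simp: iso_pair_def)

text \<open>A nonempty \<open>GG\<close> makes the set of common blocks finite; an infinite set has
  \<open>card\<close> 0 and would count as non-trivial.\<close>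

lemma no_common_subset:
  assumes nt: "non_trivial t FF GG" and GG: "GG \<noteq> {}" "GG \<subseteq> Pi_part n l"
    and X: "\<And>F. F \<in> FF \<Longrightarrow> X \<subseteq> F" "\<And>G. G \<in> GG \<Longrightarrow> X \<subseteq> G" "card X = t"
  shows False
proof -
  let ?I = "{B. \<forall>P\<in>FF \<union> GG. B \<in> P}"
  obtain G where G: "G \<in> GG" using GG by auto
  then have "finite G" using GG Pi_part_finite[of G n l] by auto
  moreover have "?I \<subseteq> G" using G by auto
  ultimately have "finite ?I" by (rule finite_subset[rotated])
  moreover have "X \<subseteq> ?I" using X by auto
  ultimately have "card X \<le> card ?I" by (rule card_mono)
  then show False using nt X(3) by (simp add: non_trivial_def)
qed

context large_ground_set
begin

lemma finite_of_card_t: "card X = t \<Longrightarrow> finite X"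
  using t1 by (metis card.infinite not_one_le_zero)

text \<open>Equality of positive products forces equality of both factors, and then both inclusions
  of families are equalities.\<close>

lemma beta_bound:
  assumes l: "t + 2 \<le> l" "l \<le> K"
    and M: "X \<subseteq> M" "card M = l" "card X = t" "singletons M"
    and FG: "FF \<subseteq> AX n K X M" "GG \<subseteq> BX n l X M"
  shows "card FF * card GG \<le> card (Afam n K l t) * (\<phi> l t + t)"
    and "card FF * card GG = card (Afam n K l t) * (\<phi> l t + t) \<Longrightarrow> 0 < card (Afam n K l t)
      \<Longrightarrow> iso_pair n (FF, GG) (Afam n K l t, Bfam n l t)"
proof -
  have A: "card (AX n K X M) = card (Afam n K l t)" using M l by (intro AA_eq) auto
  have B: "card (BX n l X M) = \<phi> l t + t" using M l by (intro card_BX) auto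
  have fB: "finite (BX n l X M)" using finite_BX finite_of_card_t M(3) by blast
  have cF: "card FF \<le> card (Afam n K l t)" using card_mono[OF _ FG(1)] A by simp
  have cG: "card GG \<le> \<phi> l t + t" using card_mono[OF fB FG(2)] B by simp
  show "card FF * card GG \<le> card (Afam n K l t) * (\<phi> l t + t)" by (rule mult_le_mono[OF cF cG])
  assume e: "card FF * card GG = card (Afam n K l t) * (\<phi> l t + t)" and p: "0 < card (Afam n K l t)"
  have "0 < card (Afam n K l t) * (\<phi> l t + t)" using p t1 by simp
  from prod_eq_imp[OF cF cG e this] have "card FF = card (AX n K X M)" "card GG = card (BX n l X M)"
    using A B by auto
  then have "FF = AX n K X M" "GG = BX n l X M"
    using card_subset_eq[OF finite_extremal(1) FG(1)] card_subset_eq[OF fB FG(2)] by blast+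
  then show "iso_pair n (FF, GG) (Afam n K l t, Bfam n l t)" by (rule iso_AB[OF M])
qed

lemma gamma_bound:
  assumes l: "t + 2 \<le> l" "l \<le> K"
    and T: "card T = t + 1" "singletons T" and FG: "FF \<subseteq> CT n K T" "GG \<subseteq> DT n t l T"
  shows "card FF * card GG \<le> \<phi> K (t + 1) * card (Dfam n l t)"
    and "card FF * card GG = \<phi> K (t + 1) * card (Dfam n l t)
      \<Longrightarrow> iso_pair n (FF, GG) (Cfam n K t, Dfam n l t)"
proof -
  have C: "card (CT n K T) = \<phi> K (t + 1)" using T K by (intro card_CT) auto
  have D: "card (DT n t l T) = card (Dfam n l t)" using T l by (intro DD_eq) auto
  have cF: "card FF \<le> \<phi> K (t + 1)" using card_mono[OF _ FG(1)] C by simp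
  have cG: "card GG \<le> card (Dfam n l t)" using card_mono[OF _ FG(2)] D by simp
  show "card FF * card GG \<le> \<phi> K (t + 1) * card (Dfam n l t)" by (rule mult_le_mono[OF cF cG])
  assume e: "card FF * card GG = \<phi> K (t + 1) * card (Dfam n l t)"
  have "0 < \<phi> K (t + 1) * card (Dfam n l t)"
    using Dfam_low[OF l] theta_pos[OF l] t1 card_Cfam[OF K] by (cases "\<phi> K (t + 1) * card (Dfam n l t)") auto
  from prod_eq_imp[OF cF cG e this] have "card FF = card (CT n K T)" "card GG = card (DT n t l T)"
    using C D by auto
  then have "FF = CT n K T" "GG = DT n t l T"
    using card_subset_eq[OF finite_extremal(2) FG(1)] card_subset_eq[OF finite_extremal(3) FG(2)] by blast+
  then show "iso_pair n (FF, GG) (Cfam n K t, Dfam n l t)" by (rule iso_CD[OF T])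
qed

text \<open>The assumption on P is the common test for all non-extremal cases: the maximum selects
  the leading coefficient of the extremal product for the given l, and the unit
  \<open>\<theta> l\<close>, divided by 4, allows for its error.\<close>

lemma AB_target:
  assumes l: "2 * t + 2 \<le> l" "l \<le> K" and P: "4 * P + \<theta> l < 4 * (max (l - t) (t + 1) * \<theta> l)"
  shows "P < card (Afam n K l t) * (\<phi> l t + t)"
proof -
  have l2: "t + 2 \<le> l" "t + 3 \<le> K" using l t1 by auto
  have "max (l - t) (t + 1) = l - t" using l by simp
  then have "4 * P < 4 * (card (Afam n K l t) * \<phi> l t)"
    using Afam_low[OF l2(1) l(2) l2(2)] P by simp
  then have "P < card (Afam n K l t) * \<phi> l t" by simp
  also have "\<dots> \<le> card (Afam n K l t) * (\<phi> l t + t)" by (intro mult_le_mono2) simp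
  finally show ?thesis .
qed

lemma CD_target:
  assumes l: "t + 2 \<le> l" "l \<le> 2 * t + 1" "l \<le> K" and P: "4 * P + \<theta> l < 4 * (max (l - t) (t + 1) * \<theta> l)"
  shows "P < \<phi> K (t + 1) * card (Dfam n l t)"
proof -
  have "max (l - t) (t + 1) = t + 1" using l by simp
  then have "4 * P < 4 * (\<phi> K (t + 1) * card (Dfam n l t))"
    using Dfam_low[OF l(1,3)] P card_Cfam[OF K] by simp
  then show ?thesis by simp
qed

lemma small_target:
  assumes l: "t + 2 \<le> l" "l \<le> K" and P: "3 * P + \<theta> l \<le> 3 * (max (l - t) (t + 1) * \<theta> l)"
  shows "4 * P + \<theta> l < 4 * (max (l - t) (t + 1) * \<theta> l)"
proof -
  define m where "m = max (l - t) (t + 1) * \<theta> l"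
  have "3 * P + \<theta> l \<le> 3 * m" using P by (simp add: m_def)
  then show ?thesis using theta_pos[OF l] unfolding m_def[symmetric] by linarith
qed

lemma le_theta_target:
  assumes l: "t + 2 \<le> l" "l \<le> K" and P: "P \<le> \<theta> l"
  shows "4 * P + \<theta> l < 4 * (max (l - t) (t + 1) * \<theta> l)"
proof -
  have "2 * \<theta> l \<le> max (l - t) (t + 1) * \<theta> l" using t1 by (intro mult_le_mono1) auto
  then show ?thesis using P theta_pos[OF l] by linarith
qed

context
  fixes l FF GG X G0
  assumes l: "t + 2 \<le> l" "l \<le> K"
    and FF: "FF \<subseteq> Pi_part n K" and GG: "GG \<subseteq> Pi_part n l" and cr: "cross_t_int t FF GG"
    and X: "card X = t" "\<And>F. F \<in> FF \<Longrightarrow> X \<subseteq> F" and ne: "FF \<noteq> {}"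
    and G0: "G0 \<in> GG" "\<not> X \<subseteq> G0"
begin

lemma main_cases:
  assumes "t + 3 \<le> K"
  shows "4 * (card FF * card GG) + \<theta> l < 4 * (max (l - t) (t + 1) * \<theta> l)
   \<or> (\<exists>M. X \<subseteq> M \<and> card M = l \<and> singletons M \<and> FF \<subseteq> AX n K X M \<and> GG \<subseteq> BX n l X M)
   \<or> (\<exists>T. card T = t + 1 \<and> singletons T \<and> FF \<subseteq> CT n K T \<and> GG \<subseteq> DT n t l T)"
proof -
  have "l = t + (l - t)" using l by simp
  from common_case[OF assms order_refl l this FF GG cr X ne G0]
  show ?thesis using small_target[OF l, of "card FF * card GG"] unfolding \<theta>_def by blast
qed

lemma main_i:
  assumes l2: "2 * t + 2 \<le> l"
  shows "card FF * card GG \<le> card (Afam n K l t) * (\<phi> l t + t)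
    \<and> (card FF * card GG = card (Afam n K l t) * (\<phi> l t + t)
        \<longrightarrow> iso_pair n (FF, GG) (Afam n K l t, Bfam n l t))"
proof -
  have K3: "t + 3 \<le> K" using l l2 t1 by simp
  have pos: "0 < card (Afam n K l t)"
    using AB_target[OF l2 l(2), of 0] theta_pos[OF l] t1 l2 le_theta_target[OF l, of 0] by (cases "card (Afam n K l t)") auto
  from main_cases[OF K3] show ?thesis
  proof (elim disjE exE conjE)
    assume "4 * (card FF * card GG) + \<theta> l < 4 * (max (l - t) (t + 1) * \<theta> l)"
    then have "card FF * card GG < card (Afam n K l t) * (\<phi> l t + t)" by (rule AB_target[OF l2 l(2)])
    then show ?thesis by simp
  next
    fix M assume "X \<subseteq> M" "card M = l" "singletons M" "FF \<subseteq> AX n K X M" "GG \<subseteq> BX n l X M"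
    then show ?thesis using beta_bound[OF l _ _ X(1), of M FF GG] pos by blast
  next
    fix T assume T: "card T = t + 1" "singletons T" "FF \<subseteq> CT n K T" "GG \<subseteq> DT n t l T"
    have "card FF * card GG \<le> \<phi> K (t + 1) * card (Dfam n l t)" by (rule gamma_bound(1)[OF l T])
    also have "\<dots> \<le> \<phi> K (t + 1) * ((t + 1) * \<phi> l t)" using card_Dfam[OF l] by (intro mult_le_mono2) simp
    also have "\<dots> = (t + 1) * \<theta> l" by (simp only: \<theta>_def mult_ac)
    finally have 1: "card FF * card GG \<le> (t + 1) * \<theta> l" .
    \<comment> \<open>From l at least 2 t + 2 the coefficient of (C, D) is a full unit below that of
      (A, B).\<close>
    have "(t + 1) * \<theta> l + \<theta> l \<le> max (l - t) (t + 1) * \<theta> l"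
    proof -
      have "(t + 1 + 1) * \<theta> l \<le> max (l - t) (t + 1) * \<theta> l" using l2 by (intro mult_le_mono1) simp
      then show ?thesis by simp
    qed
    then have "4 * (card FF * card GG) + \<theta> l < 4 * (max (l - t) (t + 1) * \<theta> l)"
      using 1 theta_pos[OF l] by linarith
    then have "card FF * card GG < card (Afam n K l t) * (\<phi> l t + t)" by (rule AB_target[OF l2 l(2)])
    then show ?thesis by simp
  qed
qed

lemma main_ii:
  assumes l2: "l \<le> 2 * t + 1" and ex: "(K, l) \<notin> {(2 * t + 1, 2 * t + 1), (4, 3)}"
  shows "card FF * card GG \<le> \<phi> K (t + 1) * card (Dfam n l t)
    \<and> (card FF * card GG = \<phi> K (t + 1) * card (Dfam n l t)
        \<longrightarrow> iso_pair n (FF, GG) (Cfam n K t, Dfam n l t))"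
proof (cases "t + 3 \<le> K")
  case True
  from main_cases[OF True] show ?thesis
  proof (elim disjE exE conjE)
    assume "4 * (card FF * card GG) + \<theta> l < 4 * (max (l - t) (t + 1) * \<theta> l)"
    then have "card FF * card GG < \<phi> K (t + 1) * card (Dfam n l t)" by (rule CD_target[OF l(1) l2 l(2)])
    then show ?thesis by simp
  next
    fix M assume M: "X \<subseteq> M" "card M = l" "singletons M" "FF \<subseteq> AX n K X M" "GG \<subseteq> BX n l X M"
    have "card FF * card GG \<le> card (Afam n K l t) * (\<phi> l t + t)"
      by (rule beta_bound(1)[OF l M(1,2) X(1) M(3-5)])
    also have "\<dots> < \<phi> K (t + 1) * card (Dfam n l t)" by (rule AB_less_CD[OF l l2 True ex])
    finally show ?thesis by simp
  next
    fix T assume T: "card T = t + 1" "singletons T" "FF \<subseteq> CT n K T" "GG \<subseteq> DT n t l T"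
    then show ?thesis using gamma_bound[OF l T] by blast
  qed
next
  case False
  then have K2: "K = t + 2" "l = t + 2" using K l by auto
  \<comment> \<open>For t = 1 both block numbers would be 3 = 2 t + 1, an excluded pair.\<close>
  then have t2: "2 \<le> t" using ex t1 by (cases "t = 1") auto
  have D: "card (Dfam n l t) + t = (t + 1) * \<phi> (t + 2) t" "\<phi> K (t + 1) = 1"
    using card_Dfam[OF l] phi_2(2) unfolding K2 by simp_all
  have "card FF * card GG + t < (t + 1) * \<phi> (t + 2) t
   \<or> (\<exists>T. card T = t + 1 \<and> singletons T \<and> FF \<subseteq> CT n (t + 2) T \<and> GG \<subseteq> DT n t (t + 2) T)"
    using FF GG unfolding K2 by (rule pair_case[OF t2 _ _ cr X(1) _ ne G0]) (rule X(2))
  then show ?thesis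
  proof (elim disjE exE conjE)
    assume "card FF * card GG + t < (t + 1) * \<phi> (t + 2) t"
    then show ?thesis using D by simp
  next
    fix T assume T: "card T = t + 1" "singletons T" "FF \<subseteq> CT n (t + 2) T" "GG \<subseteq> DT n t (t + 2) T"
    then show ?thesis using gamma_bound[OF l, of T FF GG] K2 by blast
  qed
qed

end

text \<open>If the family with fewer blocks is the one sharing X, \<open>common_case\<close> is
  applied with the roles interchanged. All three outcomes fit under
  \<open>(max a (t + 1) + 1) * \<theta>' l\<close>, which \<open>swap_large\<close> beats; so no
  extremal pair arises here.\<close>

lemma swapped_strict:
  assumes l: "t + 2 \<le> l" "l < K"
    and FF: "FF \<subseteq> Pi_part n K" and GG: "GG \<subseteq> Pi_part n l" and cr: "cross_t_int t FF GG"
    and X: "card X = t" "\<And>G. G \<in> GG \<Longrightarrow> X \<subseteq> G" and ne: "GG \<noteq> {}"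
    and F0: "F0 \<in> FF" "\<not> X \<subseteq> F0"
  shows "4 * (card FF * card GG) + \<theta> l < 4 * (max (l - t) (t + 1) * \<theta> l)"
proof -
  note cr' = cross_t_int_sym[OF cr]
  have lK: "l \<le> K" using l by simp
  show ?thesis
  proof (cases "t + 3 \<le> l")
    case False
    then have l2: "l = t + 2" using l by simp
    have "2 * (card GG * card FF) \<le> (a + 1) * ((t + 2) * (t + 1)) * \<phi> K t"
      by (rule crude_bound[OF GG[unfolded l2] FF cr' X ne F0 K order_refl])
    then show ?thesis unfolding mult.commute[of "card GG"] by (rule swap_crude[OF l(1) lK l2 l(2)])
  next
    case True
    have "3 * (card GG * card FF) + \<phi> l (t + 1) * \<phi> K t \<le> 3 * (max a (t + 1) * (\<phi> l (t + 1) * \<phi> K t))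
      \<or> (\<exists>M. X \<subseteq> M \<and> card M = K \<and> singletons M \<and> GG \<subseteq> AX n l X M \<and> FF \<subseteq> BX n K X M)
      \<or> (\<exists>T. card T = t + 1 \<and> singletons T \<and> GG \<subseteq> CT n l T \<and> FF \<subseteq> DT n t K T)"
      by (rule common_case[OF True lK K order_refl Kta GG FF cr' X(1) _ ne F0]) (rule X(2))
    then have "card GG * card FF \<le> (max a (t + 1) + 1) * \<theta>' l"
    proof (elim disjE exE conjE)
      assume "3 * (card GG * card FF) + \<phi> l (t + 1) * \<phi> K t \<le> 3 * (max a (t + 1) * (\<phi> l (t + 1) * \<phi> K t))"
      then have "3 * (card GG * card FF) \<le> 3 * (max a (t + 1) * \<theta>' l)" unfolding \<theta>'_def by linarith
      then have "card GG * card FF \<le> max a (t + 1) * \<theta>' l" by simp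
      also have "\<dots> \<le> (max a (t + 1) + 1) * \<theta>' l" by (intro mult_le_mono1 le_add1)
      finally show ?thesis .
    next
      fix M assume M: "X \<subseteq> M" "card M = K" "singletons M" "GG \<subseteq> AX n l X M" "FF \<subseteq> BX n K X M"
      have finM: "finite M" using M(2) K by (intro card_ge_0_finite) simp
      have fB: "finite (BX n K X M)" using finite_BX finite_of_card_t X(1) by blast
      have "card GG \<le> card (AX n l X M)" using M(4) by (intro card_mono) auto
      also have "\<dots> \<le> a * \<phi> l (t + 1)" using M X(1) finM l Kta by (intro AX_le) auto
      finally have G: "card GG \<le> a * \<phi> l (t + 1)" .
      have "card FF \<le> card (BX n K X M)" using M(5) fB by (intro card_mono)
      also have "\<dots> = \<phi> K t + t" using M X(1) K by (intro card_BX) auto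
      finally have F: "card FF \<le> \<phi> K t + t" .
      \<comment> \<open>The t exceptional members of B cost at most one extra
        \<open>\<theta>' l\<close>, hence the \<open>+ 1\<close> in the common bound.\<close>
      have at: "a * t \<le> \<phi> K t"
      proof -
        have "a * t \<le> (a + 1) * (a + 1) * t" by (intro mult_le_mono1) simp
        also have "\<dots> \<le> 4 * (t * ((a + 1) * (a + 1)))" by (simp only: mult.commute[of t])
        also have "\<dots> \<le> Q\<^sup>2" by (rule Q_sq_t)
        also have "\<dots> \<le> Q\<^sup>2 * \<phi> K (t + 1)" using phi_pos[of "t + 1" K] K by simp
        also have "\<dots> \<le> \<phi> K t" using phi_ratio[of t K] K by simp
        finally show ?thesis .
      qed
      have "card GG * card FF \<le> (a * \<phi> l (t + 1)) * (\<phi> K t + t)" by (rule mult_le_mono[OF G F])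
      also have "\<dots> = a * \<theta>' l + \<phi> l (t + 1) * (a * t)" by (simp add: \<theta>'_def algebra_simps)
      also have "\<dots> \<le> a * \<theta>' l + \<phi> l (t + 1) * \<phi> K t" using at by simp
      also have "\<dots> = (a + 1) * \<theta>' l" by (simp add: \<theta>'_def)
      also have "\<dots> \<le> (max a (t + 1) + 1) * \<theta>' l" by (intro mult_le_mono1) simp
      finally show ?thesis .
    next
      fix T assume T: "card T = t + 1" "singletons T" "GG \<subseteq> CT n l T" "FF \<subseteq> DT n t K T"
      have "card GG \<le> card (CT n l T)" using T(3) by (intro card_mono) auto
      also have "\<dots> = \<phi> l (t + 1)" using T l by (intro card_CT) auto
      finally have G: "card GG \<le> \<phi> l (t + 1)" .
      have "card FF \<le> card (DT n t K T)" using T(4) by (intro card_mono) auto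
      also have "\<dots> \<le> (t + 1) * \<phi> K t" using card_DT[OF T(2,1), of K] K by simp
      finally have F: "card FF \<le> (t + 1) * \<phi> K t" .
      have "card GG * card FF \<le> \<phi> l (t + 1) * ((t + 1) * \<phi> K t)" by (rule mult_le_mono[OF G F])
      also have "\<dots> = (t + 1) * \<theta>' l" by (simp only: \<theta>'_def mult_ac)
      also have "\<dots> \<le> (max a (t + 1) + 1) * \<theta>' l" by (intro mult_le_mono1) simp
      finally show ?thesis .
    qed
    then have "4 * (card FF * card GG) \<le> 4 * ((max a (t + 1) + 1) * \<theta>' l)" by (simp add: mult.commute)
    then show ?thesis using swap_large[OF l(1) lK l(2)] by linarith
  qed
qed

text \<open>Non-triviality turns a common t-set of one family into a member of the other family that
  misses it. The interchanged roles survive only for equal block numbers, where they yield the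
  second form of equality.\<close>

lemma classification:
  assumes l: "t + 2 \<le> l" "l \<le> K"
    and FF: "FF \<subseteq> Pi_part n K" and GG: "GG \<subseteq> Pi_part n l" and cr: "cross_t_int t FF GG"
    and nt: "non_trivial t FF GG"
  shows "4 * (card FF * card GG) + \<theta> l < 4 * (max (l - t) (t + 1) * \<theta> l)
    \<or> (\<exists>X G. card X = t \<and> (\<forall>F\<in>FF. X \<subseteq> F) \<and> FF \<noteq> {} \<and> G \<in> GG \<and> \<not> X \<subseteq> G)
    \<or> l = K \<and> (\<exists>X F. card X = t \<and> (\<forall>G\<in>GG. X \<subseteq> G) \<and> GG \<noteq> {} \<and> F \<in> FF \<and> \<not> X \<subseteq> F)"
proof (cases "FF = {} \<or> GG = {}")
  case True
  then have "card FF * card GG \<le> \<theta> l" by auto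
  from le_theta_target[OF l this] show ?thesis by (rule disjI1)
next
  case False
  then have ne: "FF \<noteq> {}" "GG \<noteq> {}" by auto
  consider X where "card X = t" "\<forall>F\<in>FF. X \<subseteq> F" | X where "card X = t" "\<forall>G\<in>GG. X \<subseteq> G"
    | "\<And>X. card X = t \<Longrightarrow> \<exists>F\<in>FF. \<not> X \<subseteq> F" "\<And>X. card X = t \<Longrightarrow> \<exists>G\<in>GG. \<not> X \<subseteq> G"
    by blast
  then show ?thesis
  proof cases
    case (1 X)
    then have "\<exists>G\<in>GG. \<not> X \<subseteq> G" using no_common_subset[OF nt ne(2) GG] by blast
    then show ?thesis using 1 ne by blast
  next
    case (2 X)
    then have "\<exists>F\<in>FF. \<not> X \<subseteq> F" using no_common_subset[OF nt ne(2) GG] by blast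
    then obtain F where F: "F \<in> FF" "\<not> X \<subseteq> F" by blast
    show ?thesis
    proof (cases "l = K")
      case True
      then show ?thesis using 2 ne F by blast
    next
      case False
      then have "l < K" using l by simp
      from swapped_strict[OF l(1) this FF GG cr 2(1) _ ne(2) F] 2(2) show ?thesis by (intro disjI1) blast
    qed
  next
    case 3
    have "card FF * card GG \<le> \<phi> K (t + 1) * \<phi> l t"
      by (rule no_common_bound[OF l order_refl FF GG cr ne 3])
    then have "card FF * card GG \<le> \<theta> l" unfolding \<theta>_def .
    from le_theta_target[OF l this] show ?thesis by (rule disjI1)
  qed
qed

context
  fixes l FF GG
  assumes l: "t + 2 \<le> l" "l \<le> K"
    and FF: "FF \<subseteq> Pi_part n K" and GG: "GG \<subseteq> Pi_part n l" and cr: "cross_t_int t FF GG"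
    and nt: "non_trivial t FF GG"
begin

text \<open>The converse of the equality statement needs only that isomorphic families have the same
  cardinalities.\<close>

lemma bound_i:
  assumes l2: "2 * t + 2 \<le> l"
  defines "T \<equiv> card (Afam n K l t) * (\<phi> l t + t)"
  shows "card FF * card GG \<le> T"
    and "card FF * card GG = T \<longleftrightarrow> iso_pair n (FF, GG) (Afam n K l t, Bfam n l t)
      \<or> (K = l \<and> iso_pair n (FF, GG) (Bfam n K t, Afam n l K t))"
proof -
  have "card FF * card GG \<le> T \<and> (card FF * card GG = T \<longrightarrow> iso_pair n (FF, GG) (Afam n K l t, Bfam n l t)
      \<or> (K = l \<and> iso_pair n (FF, GG) (Bfam n K t, Afam n l K t)))"
    using classification[OF l FF GG cr nt]
  proof (elim disjE exE conjE)
    assume "4 * (card FF * card GG) + \<theta> l < 4 * (max (l - t) (t + 1) * \<theta> l)"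
    then have "card FF * card GG < T" unfolding T_def by (rule AB_target[OF l2 l(2)])
    then show ?thesis by simp
  next
    fix X G assume "card X = t" "\<forall>F\<in>FF. X \<subseteq> F" "FF \<noteq> {}" "G \<in> GG" "\<not> X \<subseteq> G"
    then show ?thesis unfolding T_def using main_i[OF l FF GG cr, of X G] l2 by simp
  next
    fix X F assume *: "l = K" and h: "card X = t" "\<forall>G\<in>GG. X \<subseteq> G" "GG \<noteq> {}" "F \<in> FF" "\<not> X \<subseteq> F"
    have "card GG * card FF \<le> T \<and> (card GG * card FF = T
        \<longrightarrow> iso_pair n (GG, FF) (Afam n K l t, Bfam n l t))"
      unfolding T_def using FF GG *
      by (intro main_i[OF l _ _ cross_t_int_sym[OF cr] h(1) _ h(3-5) l2]) (auto dest: bspec[OF h(2)])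
    moreover have "iso_pair n (FF, GG) (Bfam n K t, Afam n l K t)"
      if "iso_pair n (GG, FF) (Afam n K l t, Bfam n l t)"
      using iso_pair_swap[OF that] * by simp
    ultimately show ?thesis using * unfolding mult.commute[of "card FF"] by metis
  qed
  moreover have "card FF * card GG = T" if "iso_pair n (FF, GG) (Afam n K l t, Bfam n l t)
      \<or> (K = l \<and> iso_pair n (FF, GG) (Bfam n K t, Afam n l K t))"
    using that
  proof (elim disjE conjE)
    assume "iso_pair n (FF, GG) (Afam n K l t, Bfam n l t)"
    from iso_pair_card[OF FF GG this] show ?thesis by (simp add: T_def card_Bfam[OF l])
  next
    assume k: "K = l" and i: "iso_pair n (FF, GG) (Bfam n K t, Afam n l K t)"
    from iso_pair_card[OF FF GG i] show ?thesis unfolding T_def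
      using card_Bfam[OF l] k by (simp add: mult.commute)
  qed
  ultimately show "card FF * card GG \<le> T"
    "card FF * card GG = T \<longleftrightarrow> iso_pair n (FF, GG) (Afam n K l t, Bfam n l t)
      \<or> (K = l \<and> iso_pair n (FF, GG) (Bfam n K t, Afam n l K t))" by blast+
qed

lemma bound_ii:
  assumes l2: "l \<le> 2 * t + 1" and ex: "(K, l) \<notin> {(2 * t + 1, 2 * t + 1), (4, 3)}"
  defines "T \<equiv> \<phi> K (t + 1) * card (Dfam n l t)"
  shows "card FF * card GG \<le> T"
    and "card FF * card GG = T \<longleftrightarrow> iso_pair n (FF, GG) (Cfam n K t, Dfam n l t)
      \<or> (K = l \<and> iso_pair n (FF, GG) (Dfam n K t, Cfam n l t))"
proof -
  have "card FF * card GG \<le> T \<and> (card FF * card GG = T \<longrightarrow> iso_pair n (FF, GG) (Cfam n K t, Dfam n l t)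
      \<or> (K = l \<and> iso_pair n (FF, GG) (Dfam n K t, Cfam n l t)))"
    using classification[OF l FF GG cr nt]
  proof (elim disjE exE conjE)
    assume "4 * (card FF * card GG) + \<theta> l < 4 * (max (l - t) (t + 1) * \<theta> l)"
    then have "card FF * card GG < T" unfolding T_def by (rule CD_target[OF l(1) l2 l(2)])
    then show ?thesis by simp
  next
    fix X G assume "card X = t" "\<forall>F\<in>FF. X \<subseteq> F" "FF \<noteq> {}" "G \<in> GG" "\<not> X \<subseteq> G"
    then show ?thesis unfolding T_def using main_ii[OF l FF GG cr, of X G] l2 ex by simp
  next
    fix X F assume *: "l = K" and h: "card X = t" "\<forall>G\<in>GG. X \<subseteq> G" "GG \<noteq> {}" "F \<in> FF" "\<not> X \<subseteq> F"
    have "card GG * card FF \<le> T \<and> (card GG * card FF = T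
        \<longrightarrow> iso_pair n (GG, FF) (Cfam n K t, Dfam n l t))"
      unfolding T_def using FF GG *
      by (intro main_ii[OF l _ _ cross_t_int_sym[OF cr] h(1) _ h(3-5) l2 ex]) (auto dest: bspec[OF h(2)])
    moreover have "iso_pair n (FF, GG) (Dfam n K t, Cfam n l t)"
      if "iso_pair n (GG, FF) (Cfam n K t, Dfam n l t)"
      using iso_pair_swap[OF that] * by simp
    ultimately show ?thesis using * unfolding mult.commute[of "card FF"] by metis
  qed
  moreover have "card FF * card GG = T" if "iso_pair n (FF, GG) (Cfam n K t, Dfam n l t)
      \<or> (K = l \<and> iso_pair n (FF, GG) (Dfam n K t, Cfam n l t))"
    using that
  proof (elim disjE conjE)
    assume "iso_pair n (FF, GG) (Cfam n K t, Dfam n l t)"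
    from iso_pair_card[OF FF GG this] show ?thesis by (simp add: T_def card_Cfam[OF K order_refl])
  next
    assume k: "K = l" and i: "iso_pair n (FF, GG) (Dfam n K t, Cfam n l t)"
    from iso_pair_card[OF FF GG i] show ?thesis unfolding T_def
      using card_Cfam[OF l] k by (simp add: mult.commute)
  qed
  ultimately show "card FF * card GG \<le> T"
    "card FF * card GG = T \<longleftrightarrow> iso_pair n (FF, GG) (Cfam n K t, Dfam n l t)
      \<or> (K = l \<and> iso_pair n (FF, GG) (Dfam n K t, Cfam n l t))" by blast+
qed

end

lemma phi_Stir: "\<phi> k (t + j) = Stir (n - t - j) (k - t - j)" "\<phi> k t = Stir (n - t) (k - t)"
  by (simp_all add: \<phi>_def Stir_eq)

end

theorem theorem1p5:
  fixes n k1 k2 t :: nat and F1 F2 :: "nat set set set"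
  assumes "t \<ge> 1"
    and "k1 \<ge> k2" and "k2 \<ge> t + 2"
    and "real n \<ge> 2 * L k1 t"
    and "F1 \<subseteq> Pi_part n k1" and "F2 \<subseteq> Pi_part n k2"
    and "cross_t_int t F1 F2" and "non_trivial t F1 F2"
  shows
   "(k2 \<ge> 2 * t + 2 \<and> n \<ge> t + 1 + (k1 - t) * (k2 - t) \<longrightarrow>
      (int (card F1 * card F2) \<le>
         (\<Sum>j = 1..k2 - t. (-1) ^ (j - 1) * int ((k2 - t) choose j)
              * int (Stir (n - t - j) (k1 - t - j)))
         * (int (Stir (n - t) (k2 - t)) + int t))
      \<and> (int (card F1 * card F2) =
         (\<Sum>j = 1..k2 - t. (-1) ^ (j - 1) * int ((k2 - t) choose j)
              * int (Stir (n - t - j) (k1 - t - j)))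
         * (int (Stir (n - t) (k2 - t)) + int t)
         \<longleftrightarrow> iso_pair n (F1, F2) (Afam n k1 k2 t, Bfam n k2 t)
             \<or> (k1 = k2 \<and> iso_pair n (F1, F2) (Bfam n k1 t, Afam n k2 k1 t))))
    \<and>
    (k2 \<le> 2 * t + 1 \<and> (k1, k2) \<notin> {(2 * t + 1, 2 * t + 1), (4, 3)} \<longrightarrow>
      (int (card F1 * card F2) \<le>
         int (Stir (n - t - 1) (k1 - t - 1))
         * (int (t + 1) * int (Stir (n - t) (k2 - t)) - int t * int (Stir (n - t - 1) (k2 - t - 1))))
      \<and> (int (card F1 * card F2) =
         int (Stir (n - t - 1) (k1 - t - 1))
         * (int (t + 1) * int (Stir (n - t) (k2 - t)) - int t * int (Stir (n - t - 1) (k2 - t - 1)))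
         \<longleftrightarrow> iso_pair n (F1, F2) (Cfam n k1 t, Dfam n k2 t)
             \<or> (k1 = k2 \<and> iso_pair n (F1, F2) (Dfam n k1 t, Cfam n k2 t))))"
proof -
  interpret large_ground_set n t k1 using assms by unfold_locales auto
  note i = bound_i[OF assms(3,2,5-8)] and ii = bound_ii[OF assms(3,2,5-8)]
  have A: "(\<Sum>j = 1..k2 - t. (-1) ^ (j - 1) * int ((k2 - t) choose j) * int (Stir (n - t - j) (k1 - t - j)))
    * (int (Stir (n - t) (k2 - t)) + int t) = int (card (Afam n k1 k2 t) * (\<phi> k2 t + t))"
    unfolding of_nat_mult of_nat_add card_Afam[OF assms(3,2) order_refl] phi_Stir ..
  \<comment> \<open>Passing to integers before solving for the cardinality makes the subtraction in
    the statement a genuine one.\<close>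
  have "int (card (Dfam n k2 t)) + int t * int (\<phi> k2 (t + 1)) = int (t + 1) * int (\<phi> k2 t)"
    using card_Dfam[OF assms(3,2)] unfolding of_nat_mult[symmetric] of_nat_add[symmetric] of_nat_eq_iff .
  then have "int (t + 1) * int (Stir (n - t) (k2 - t)) - int t * int (Stir (n - t - 1) (k2 - t - 1))
    = int (card (Dfam n k2 t))" unfolding phi_Stir by linarith
  then have C: "int (Stir (n - t - 1) (k1 - t - 1))
    * (int (t + 1) * int (Stir (n - t) (k2 - t)) - int t * int (Stir (n - t - 1) (k2 - t - 1)))
    = int (\<phi> k1 (t + 1) * card (Dfam n k2 t))" unfolding of_nat_mult phi_Stir by simp
  show ?thesis unfolding A C of_nat_le_iff of_nat_eq_iff using i ii by blast
qed

end
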